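(* Suppose $\mu$ is a Borel probability measure on $[0,1)^2$ that is singular with respect to two-dimensional Lebesgue measure, and that one of its two marginal measures is essentially equivalent to Lebesgue measure. Then $L^2(\mu)$ admits Fourier series with a one-sided outer sum and a bi-infinite inner sum: if the $y$-marginal $\mu_2$ is essentially equivalent to Lebesgue measure, then every $f\in L^2(\mu)$ can be written as $$f(x,y)=\sum_{n=0}^{\infty}\sum_{m=-\infty}^{\infty}d_{nm}e^{2\pi i(nx+my)},$$ and if the $x$-marginal $\mu_1$ is essentially equivalent to Lebesgue measure, then every $f\in L^2(\mu)$ can be written as $$f(x,y)=\sum_{n=0}^{\infty}\sum_{m=-\infty}^{\infty}d_{nm}e^{2\pi i(ny+mx)},$$ for some $d_{nm}\in\mathbb{C}$ depending on $f$, with conditional convergence in the norm of $L^2(\mu)$.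
   Context: The marginal measures of $\mu$ are $\mu_1=\mu\circ\pi_x^{-1}$ and $\mu_2=\mu\circ\pi_y^{-1}$, where $\pi_x(x,y)=x$ and $\pi_y(x,y)=y$. An absolutely continuous finite Borel measure $\nu$ on $[0,1)$ with Radon–Nikodym derivative $h$ with respect to Lebesgue measure is called essentially equivalent to Lebesgue measure if $h,\frac1h\in L^\infty(\nu)$. Conditional convergence in norm: the double sum is an iterated sum (for each $n$ the inner bi-infinite sum over $m$ converges in $L^2(\mu)$, and then the outer sum over $n$ converges in $L^2(\mu)$); unconditional convergence is not claimed. *)

theory Defs
  imports "HOL-Probability.Probability_Measure"
begin

abbreviation unit_lebesgue :: "real measure" where
  "unit_lebesgue \<equiv> restrict_space lborel {0..<1}"

abbreviation unit_square :: "(real \<times> real) set" where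
  "unit_square \<equiv> {0..<1} \<times> {0..<1}"

abbreviation square_lebesgue :: "(real \<times> real) measure" where
  "square_lebesgue \<equiv> restrict_space lborel unit_square"

definition marginal_x :: "(real \<times> real) measure \<Rightarrow> real measure" where
  "marginal_x \<mu> = distr \<mu> (restrict_space borel {0..<1}) fst"

definition marginal_y :: "(real \<times> real) measure \<Rightarrow> real measure" where
  "marginal_y \<mu> = distr \<mu> (restrict_space borel {0..<1}) snd"

definition mutually_singular :: "'a measure \<Rightarrow> 'a measure \<Rightarrow> bool" where
  "mutually_singular M N \<longleftrightarrow> sets M = sets N \<and>
     (\<exists>A\<in>sets M. emeasure M A = 0 \<and> emeasure N (space N - A) = 0)"

definition ess_bounded :: "'a measure \<Rightarrow> ('a \<Rightarrow> ennreal) \<Rightarrow> bool" where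
  "ess_bounded M h \<longleftrightarrow> h \<in> borel_measurable M \<and> (\<exists>C::real. AE x in M. h x \<le> ennreal C)"

(* The essential bounds are with respect to \<nu> itself, not Lebesgue measure, so the
   density may vanish on a set of positive Lebesgue measure. *)
definition ess_equiv_lebesgue :: "real measure \<Rightarrow> bool" where
  "ess_equiv_lebesgue \<nu> \<longleftrightarrow>
     finite_measure \<nu> \<and> sets \<nu> = sets (restrict_space borel {0..<1::real}) \<and>
     absolutely_continuous unit_lebesgue \<nu> \<and>
     ess_bounded \<nu> (RN_deriv unit_lebesgue \<nu>) \<and>
     ess_bounded \<nu> (\<lambda>x. 1 / RN_deriv unit_lebesgue \<nu> x)"

(* Elements of L2 are represented by functions; equality in L2 is vanishing L2_norm
   of the difference. *)
definition L2 :: "'a measure \<Rightarrow> ('a \<Rightarrow> complex) set" where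
  "L2 M = {f \<in> borel_measurable M. integrable M (\<lambda>x. (cmod (f x))\<^sup>2)}"

definition L2_norm :: "'a measure \<Rightarrow> ('a \<Rightarrow> complex) \<Rightarrow> real" where
  "L2_norm M f = sqrt (\<integral>x. (cmod (f x))\<^sup>2 \<partial>M)"

(* Membership in L2 is required because the Bochner integral of a non-integrable
   function is 0 by convention. *)
definition L2_tendsto ::
  "'a measure \<Rightarrow> ('i \<Rightarrow> 'a \<Rightarrow> complex) \<Rightarrow> ('a \<Rightarrow> complex) \<Rightarrow> 'i filter \<Rightarrow> bool" where
  "L2_tendsto M s g F \<longleftrightarrow> (\<forall>i. s i \<in> L2 M) \<and> g \<in> L2 M \<and>
     ((\<lambda>i. L2_norm M (\<lambda>x. s i x - g x)) \<longlongrightarrow> 0) F"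

definition L2_sums ::
  "'a measure \<Rightarrow> (nat \<Rightarrow> 'a \<Rightarrow> complex) \<Rightarrow> ('a \<Rightarrow> complex) \<Rightarrow> bool" where
  "L2_sums M u g \<longleftrightarrow> L2_tendsto M (\<lambda>N x. \<Sum>n<N. u n x) g sequentially"

(* The two ends of a bi-infinite sum tend to infinity independently. *)
definition L2_bisums ::
  "'a measure \<Rightarrow> (int \<Rightarrow> 'a \<Rightarrow> complex) \<Rightarrow> ('a \<Rightarrow> complex) \<Rightarrow> bool" where
  "L2_bisums M u g \<longleftrightarrow>
     L2_tendsto M (\<lambda>(K, L) x. \<Sum>m\<in>{- int K..int L}. u m x) g
       (sequentially \<times>\<^sub>F sequentially)"

definition L2_iterated_sums ::
  "'a measure \<Rightarrow> (nat \<Rightarrow> int \<Rightarrow> 'a \<Rightarrow> complex) \<Rightarrow> ('a \<Rightarrow> complex) \<Rightarrow> bool" where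
  "L2_iterated_sums M u f \<longleftrightarrow>
     (\<exists>g. (\<forall>n. L2_bisums M (u n) (g n)) \<and> L2_sums M g f)"

end

theory Submission
  imports Defs "HOL-Probability.Probability"
begin

text \<open>
Write $e(t) = e^{2\pi i t}$ and let $P$ be the orthogonal projection of $L^2(\mu)$ onto the functions of $y$. The
Kaczmarz iteration $t_0 = f$, $t_{n+1} = (1 - P)(\overline{e(x)}\, t_n) = \overline{e(x)}\, t_n - b_n(y)$ satisfies
$\|f - \sum_{k<n} e((k+1)x)\, b_k(y)\| = \|t_n\|$, so everything reduces to $\|t_n\| \to 0$. The set of $f$ with this
property is a closed subspace, and $f$ belongs to it iff $t_1$ does; hence, once it contains $1$, it contains all
$e(kx)\,c(y)$, and these span a dense subspace.

For $f = 1$ put $g_z = \sum_n z^n t_n$ and $\beta_z = \sum_n z^{n+1} b_n$. Then $(1 - z\,\overline{e(x)})\, g_z = 1 - \beta_z$,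
and orthogonality of the $t_n$ ($n \ge 1$) to the functions of $y$ gives $(1 - |z|^2)\, P|g_z|^2 = 1 - |\beta_z|^2$.
Averaging over $|z| = r$ bounds $\lim \|t_n\|^2$ by the mean of $(1 - r^2)|g_z|^2$, which is at most $4$ times the Poisson kernel
pointwise and at most $1$ on average over each fibre. As $\mu$ is singular and its marginal absolutely continuous, $\mu$ is
carried up to $\varepsilon$ by a compact set $K$ which is null for (Lebesgue measure) $\otimes$ (marginal): far from $K$
the Poisson kernel tends to $0$, and the neighbourhood of $K$ has small measure. So the limit is $0$.

Finally each $b_n(y)$ is expanded in its Fourier series; essential equivalence of the marginal makes convergence in
$L^2$ of Lebesgue measure imply convergence in $L^2(\mu)$.
\<close>

subsection \<open>Square-integrable functions\<close>

text \<open>Fibre by fibre this is the theory of singular measures on the circle. Since P maps g_z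
  to 1, the identity for g_z says that 1 / (1 - beta_z(y)) is the Cauchy transform of the fibre
  measure over y; as a function of z, beta_z(y) is inner exactly when that measure is singular, and
  1 - |beta_z|^2 is the defect that controls lim ||t_n||. Singularity cannot be avoided: on Lebesgue
  fibres the iteration from 1 has b_n = 0 for all n, and ||t_n|| stays 1. The measure \<mu> is never
  disintegrated. Statements about almost every fibre become integrals over sets {y in D}, and the
  boundary behaviour of beta_z is replaced by splitting the Poisson kernel into a near and a far
  part. Only nonnegative frequencies in x appear because the iteration divides by e(x) and never
  multiplies by it.\<close>

abbreviation L2_sq :: "'a measure \<Rightarrow> ('a \<Rightarrow> complex) \<Rightarrow> real" where
  "L2_sq M f \<equiv> \<integral>x. (cmod (f x))\<^sup>2 \<partial>M"

lemma L2_measurable: "f \<in> L2 M \<Longrightarrow> f \<in> borel_measurable M"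
  and L2_sq_integrable: "f \<in> L2 M \<Longrightarrow> integrable M (\<lambda>x. (cmod (f x))\<^sup>2)"
  by (auto simp: L2_def)

lemma borel_measurable_cnj [measurable (raw)]:
  "f \<in> borel_measurable M \<Longrightarrow> (\<lambda>x. cnj (f x)) \<in> borel_measurable M"
  by (erule measurable_compose) (intro borel_measurable_continuous_onI continuous_intros)

lemma cmod_add_sq_le: "(cmod (a + b))\<^sup>2 \<le> 2 * (cmod a)\<^sup>2 + 2 * (cmod b)\<^sup>2"
proof -
  have "(cmod (a + b))\<^sup>2 \<le> (cmod a + cmod b)\<^sup>2"
    by (intro power_mono norm_triangle_ineq) auto
  also have "\<dots> \<le> 2 * (cmod a)\<^sup>2 + 2 * (cmod b)\<^sup>2"
    using sum_squares_bound[of "cmod a" "cmod b"] by (simp add: power2_sum)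
  finally show ?thesis .
qed

lemma L2_dominated:
  assumes "g \<in> L2 M" "f \<in> borel_measurable M" "AE x in M. cmod (f x) \<le> C * cmod (g x)"
  shows "f \<in> L2 M"
proof -
  have "integrable M (\<lambda>x. (cmod (f x))\<^sup>2)"
  proof (rule Bochner_Integration.integrable_bound)
    show "integrable M (\<lambda>x. C\<^sup>2 * (cmod (g x))\<^sup>2)"
      using L2_sq_integrable[OF assms(1)] by simp
    show "AE x in M. norm ((cmod (f x))\<^sup>2) \<le> norm (C\<^sup>2 * (cmod (g x))\<^sup>2)"
      using assms(3) 
    proof eventually_elim
      case (elim x)
      then have "(cmod (f x))\<^sup>2 \<le> (C * cmod (g x))\<^sup>2" by (intro power_mono) auto
      then show ?case by (simp add: power_mult_distrib)
    qed
  qed (use assms(2) in simp)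
  then show ?thesis using assms(2) by (simp add: L2_def)
qed

lemma L2_add:
  assumes "f \<in> L2 M" "g \<in> L2 M" shows "(\<lambda>x. f x + g x) \<in> L2 M"
proof -
  note [measurable] = assms[THEN L2_measurable]
  have "integrable M (\<lambda>x. (cmod (f x + g x))\<^sup>2)"
  proof (rule Bochner_Integration.integrable_bound)
    show "integrable M (\<lambda>x. 2 * (cmod (f x))\<^sup>2 + 2 * (cmod (g x))\<^sup>2)"
      using assms[THEN L2_sq_integrable] by simp
    show "AE x in M. norm ((cmod (f x + g x))\<^sup>2) \<le> norm (2 * (cmod (f x))\<^sup>2 + 2 * (cmod (g x))\<^sup>2)"
      using cmod_add_sq_le by (intro AE_I2) auto
  qed simp
  then show ?thesis by (simp add: L2_def)
qed

lemma L2_mult_bounded: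
  assumes "f \<in> L2 M" "h \<in> borel_measurable M" "\<And>x. x \<in> space M \<Longrightarrow> cmod (h x) \<le> C"
  shows "(\<lambda>x. h x * f x) \<in> L2 M"
proof (rule L2_dominated[OF assms(1)])
  show "(\<lambda>x. h x * f x) \<in> borel_measurable M"
    using assms(2) L2_measurable[OF assms(1)] by measurable
  show "AE x in M. cmod (h x * f x) \<le> C * cmod (f x)"
    using assms(3) by (auto simp: norm_mult intro!: mult_right_mono)
qed

lemma L2_cmult: "f \<in> L2 M \<Longrightarrow> (\<lambda>x. c * f x) \<in> L2 M"
  by (rule L2_mult_bounded[where C="cmod c"]) auto

lemma L2_diff: "f \<in> L2 M \<Longrightarrow> g \<in> L2 M \<Longrightarrow> (\<lambda>x. f x - g x) \<in> L2 M"
  using L2_add[of f M "\<lambda>x. -1 * g x"] L2_cmult[of g M "-1"] by simp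

lemma L2_sum: "(\<And>i. i \<in> I \<Longrightarrow> f i \<in> L2 M) \<Longrightarrow> (\<lambda>x. \<Sum>i\<in>I. f i x) \<in> L2 M"
proof (induction I rule: infinite_finite_induct)
  case (insert i I)
  then show ?case using L2_add[of "f i" M] by simp
qed (auto simp: L2_def)

lemma L2_cnj: "f \<in> L2 M \<Longrightarrow> (\<lambda>x. cnj (f x)) \<in> L2 M"
  by (rule L2_dominated[where C=1]) (use L2_measurable[of f M] in auto)

lemma L2_mult_integrable:
  assumes "f \<in> L2 M" "g \<in> L2 M" shows "integrable M (\<lambda>x. f x * g x)"
proof (rule Bochner_Integration.integrable_bound)
  show "integrable M (\<lambda>x. (cmod (f x))\<^sup>2 + (cmod (g x))\<^sup>2)"
    using assms[THEN L2_sq_integrable] by simp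
  show "(\<lambda>x. f x * g x) \<in> borel_measurable M"
    using assms[THEN L2_measurable] by simp
  show "AE x in M. norm (f x * g x) \<le> norm ((cmod (f x))\<^sup>2 + (cmod (g x))\<^sup>2)"
  proof (rule AE_I2)
    fix x
    have "2 * (cmod (f x) * cmod (g x)) \<le> (cmod (f x))\<^sup>2 + (cmod (g x))\<^sup>2"
      using sum_squares_bound[of "cmod (f x)" "cmod (g x)"] by simp
    moreover have "0 \<le> cmod (f x) * cmod (g x)" by simp
    ultimately show "norm (f x * g x) \<le> norm ((cmod (f x))\<^sup>2 + (cmod (g x))\<^sup>2)"
      unfolding norm_mult real_norm_def by linarith
  qed
qed

lemma L2_sq_add_le:
  assumes "f \<in> L2 M" "g \<in> L2 M"
  shows "L2_sq M (\<lambda>x. f x + g x) \<le> 2 * L2_sq M f + 2 * L2_sq M g"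
proof -
  have "L2_sq M (\<lambda>x. f x + g x) \<le> (\<integral>x. 2 * (cmod (f x))\<^sup>2 + 2 * (cmod (g x))\<^sup>2 \<partial>M)"
    by (intro integral_mono)
       (use L2_sq_integrable[OF L2_add[OF assms]] assms[THEN L2_sq_integrable] cmod_add_sq_le in auto)
  then show ?thesis using assms[THEN L2_sq_integrable] by simp
qed

lemma L2_sq_cmult: "L2_sq M (\<lambda>x. c * f x) = (cmod c)\<^sup>2 * L2_sq M f"
  by (simp add: norm_mult power_mult_distrib)

lemma L2_sq_mono:
  assumes "g \<in> L2 M" "f \<in> L2 M" "AE x in M. cmod (f x) \<le> C * cmod (g x)"
  shows "L2_sq M f \<le> C\<^sup>2 * L2_sq M g"
proof -
  have "L2_sq M f \<le> (\<integral>x. C\<^sup>2 * (cmod (g x))\<^sup>2 \<partial>M)"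
  proof (rule integral_mono_AE)
    show "AE x in M. (cmod (f x))\<^sup>2 \<le> C\<^sup>2 * (cmod (g x))\<^sup>2"
      using assms(3) 
    proof eventually_elim
      case (elim x)
      then have "(cmod (f x))\<^sup>2 \<le> (C * cmod (g x))\<^sup>2" by (intro power_mono) auto
      then show ?case by (simp add: power_mult_distrib)
    qed
  qed (use assms(1,2)[THEN L2_sq_integrable] in auto)
  then show ?thesis by simp
qed

lemma L2_sq_add_orth:
  assumes "f \<in> L2 M" "g \<in> L2 M" "(\<integral>x. f x * cnj (g x) \<partial>M) = 0"
  shows "L2_sq M (\<lambda>x. f x + g x) = L2_sq M f + L2_sq M g"
proof -
  have i: "integrable M (\<lambda>x. f x * cnj (g x))"
    by (intro L2_mult_integrable L2_cnj assms)
  have "(\<integral>x. Re (f x * cnj (g x)) \<partial>M) = Re (\<integral>x. f x * cnj (g x) \<partial>M)"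
    using i by (rule integral_Re)
  then have 0: "(\<integral>x. Re (f x * cnj (g x)) \<partial>M) = 0" using assms(3) by simp
  have *: "(cmod (a + b))\<^sup>2 = (cmod a)\<^sup>2 + (cmod b)\<^sup>2 + 2 * Re (a * cnj b)" for a b
    unfolding cmod_power2 by (simp add: power2_eq_square algebra_simps)
  have "L2_sq M (\<lambda>x. f x + g x)
      = (\<integral>x. (cmod (f x))\<^sup>2 + (cmod (g x))\<^sup>2 + 2 * Re (f x * cnj (g x)) \<partial>M)" unfolding * ..
  also have "\<dots> = L2_sq M f + L2_sq M g + 2 * (\<integral>x. Re (f x * cnj (g x)) \<partial>M)"
    using assms(1,2)[THEN L2_sq_integrable] integrable_Re[OF i]
    by (subst Bochner_Integration.integral_add; (subst Bochner_Integration.integral_add)?;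
        simp del: times_complex.sel)
  finally show ?thesis using 0 by simp
qed

lemma (in finite_measure) L2_bounded:
  assumes "f \<in> borel_measurable M" "\<And>x. x \<in> space M \<Longrightarrow> cmod (f x) \<le> C"
  shows "f \<in> L2 M"
proof (rule L2_dominated[where g="\<lambda>_. 1" and C=C])
  show "(\<lambda>_. 1) \<in> L2 M" by (simp add: L2_def)
qed (use assms in auto)

lemma (in finite_measure) L2_integrable: "f \<in> L2 M \<Longrightarrow> integrable M f"
  using L2_mult_integrable[of f M "\<lambda>_. 1"] L2_bounded[of "\<lambda>_. 1" 1] by simp

subsection \<open>Conditional expectation as a function of the conditioning variable\<close>

text \<open>Doob-Dynkin factorisation. With values in \<open>ennreal\<close> the factors are built
  from indicators by sums and suprema, so no limit has to be shown to exist.\<close>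

lemma vimage_algebra_factor:
  fixes f :: "'a \<Rightarrow> ennreal"
  assumes "Y \<in> S \<rightarrow> space N" "f \<in> borel_measurable (vimage_algebra S Y N)"
  shows "\<exists>g\<in>borel_measurable N. \<forall>x\<in>S. f x = g (Y x)"
  using assms(2)
proof (induction rule: borel_measurable_induct)
  case (cong f g)
  then show ?case by simp
next
  case (set A)
  with assms(1) obtain B where "B \<in> sets N" "A = Y -` B \<inter> S"
    by (auto simp: sets_vimage_algebra2)
  then have *: "\<forall>x\<in>S. indicator A x = (indicator B (Y x) :: ennreal)"
    by (simp add: indicator_def)
  show ?case
  proof (rule bexI[where x="indicator B"])
    show "\<forall>x\<in>S. indicator A x = (indicator B (Y x) :: ennreal)" by fact
  qed (use \<open>B \<in> sets N\<close> in simp)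
next
  case (mult u c)
  then obtain g where "g \<in> borel_measurable N" "\<forall>x\<in>S. u x = g (Y x)" by blast
  then show ?case by (intro bexI[where x="\<lambda>y. c * g y"]) simp_all
next
  case (add u v)
  then obtain g h where "g \<in> borel_measurable N" "\<forall>x\<in>S. u x = g (Y x)"
    "h \<in> borel_measurable N" "\<forall>x\<in>S. v x = h (Y x)" by blast
  then show ?case by (intro bexI[where x="\<lambda>y. h y + g y"]) simp_all
next
  case (seq U)
  then obtain G where G: "\<And>i. G i \<in> borel_measurable N" "\<And>i. \<forall>x\<in>S. U i x = G i (Y x)" by metis
  show ?case
  proof (rule bexI[where x="\<lambda>y. SUP i. G i y"])
    show "\<forall>x\<in>S. (SUP i. U i) x = (SUP i. G i (Y x))"
      using G(2) by (simp add: image_comp)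
  qed (use G(1) in measurable)
qed

lemma cauchy_schwarz_integrable:
  fixes f g :: "'a \<Rightarrow> real"
  assumes [measurable]: "f \<in> borel_measurable M" "g \<in> borel_measurable M"
    and "integrable M (\<lambda>x. (f x)\<^sup>2)" "integrable M (\<lambda>x. (g x)\<^sup>2)"
  shows "integrable M (\<lambda>x. f x * g x)"
proof (rule Bochner_Integration.integrable_bound)
  show "integrable M (\<lambda>x. (f x)\<^sup>2 + (g x)\<^sup>2)" using assms by simp
  show "AE x in M. norm (f x * g x) \<le> norm ((f x)\<^sup>2 + (g x)\<^sup>2)"
  proof (rule AE_I2)
    fix x
    have "2 * (\<bar>f x\<bar> * \<bar>g x\<bar>) \<le> (f x)\<^sup>2 + (g x)\<^sup>2"
      using sum_squares_bound[of "\<bar>f x\<bar>" "\<bar>g x\<bar>"] by simp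
    moreover have "0 \<le> \<bar>f x\<bar> * \<bar>g x\<bar>" by simp
    ultimately show "norm (f x * g x) \<le> norm ((f x)\<^sup>2 + (g x)\<^sup>2)"
      unfolding norm_mult real_norm_def by linarith
  qed
qed simp

text \<open>A conditional expectation is only measurable for the generated algebra. A genuine
  function \<open>b\<close> on the line is wanted because it is later expanded in a Fourier series
  in y.\<close>

lemma (in finite_measure) real_cond_exp_factor:
  fixes f :: "'a \<Rightarrow> real"
  assumes Y[measurable]: "Y \<in> measurable M borel" and [measurable]: "f \<in> borel_measurable M"
    and f2: "integrable M (\<lambda>x. (f x)\<^sup>2)"
  obtains b :: "real \<Rightarrow> real" where "b \<in> borel_measurable borel"
    "integrable M (\<lambda>x. (b (Y x))\<^sup>2)"
    "\<And>c. c \<in> borel_measurable borel \<Longrightarrow> integrable M (\<lambda>x. (c (Y x))\<^sup>2) \<Longrightarrow>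
       (\<integral>x. c (Y x) * b (Y x) \<partial>M) = (\<integral>x. c (Y x) * f x \<partial>M)"
proof -
  define F where "F = vimage_algebra (space M) Y borel"
  have "subalgebra M F"
    unfolding subalgebra_def F_def by (auto simp: sets_vimage_algebra2)
  then interpret finite_measure_subalgebra M F
    by unfold_locales
  have YF[measurable]: "Y \<in> measurable F borel"
    unfolding F_def by (rule measurable_vimage_algebra1) simp
  have fac: "\<exists>g\<in>borel_measurable borel. \<forall>x\<in>space M. u x = g (Y x)"
    if "u \<in> borel_measurable F" for u :: "'a \<Rightarrow> ennreal"
    using vimage_algebra_factor[of Y "space M" borel u] that by (simp add: F_def)
  let ?E = "real_cond_exp M F f"
  obtain g1 where g1: "g1 \<in> borel_measurable borel" "\<And>x. x \<in> space M \<Longrightarrow> ennreal (?E x) = g1 (Y x)"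
    using fac[of "\<lambda>x. ennreal (?E x)"] by auto
  obtain g2 where g2: "g2 \<in> borel_measurable borel" "\<And>x. x \<in> space M \<Longrightarrow> ennreal (- ?E x) = g2 (Y x)"
    using fac[of "\<lambda>x. ennreal (- ?E x)"] by auto
  \<comment> \<open>\<open>ennreal\<close> truncates negative numbers to 0, so \<open>g1\<close> and
    \<open>g2\<close> factor the positive and the negative part of \<open>?E\<close>.\<close>
  define b where "b = (\<lambda>y. enn2real (g1 y) - enn2real (g2 y))"
  have b[measurable]: "b \<in> borel_measurable borel" using g1(1) g2(1) by (simp add: b_def)
  have bE: "b (Y x) = ?E x" if "x \<in> space M" for x
    unfolding b_def g1(2)[OF that, symmetric] g2(2)[OF that, symmetric]
    by (cases "?E x \<ge> 0") (auto simp: ennreal_neg)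
  have cc: "integrable M (\<lambda>x. c x * d x)" if "c \<in> borel_measurable M" "d \<in> borel_measurable M"
    "integrable M (\<lambda>x. (c x)\<^sup>2)" "integrable M (\<lambda>x. (d x)\<^sup>2)" for c d :: "'a \<Rightarrow> real"
    by (rule cauchy_schwarz_integrable) (use that in auto)
  have f1: "integrable M f" using cc[of "\<lambda>_. 1" f] f2 by simp
  \<comment> \<open>Jensen's inequality for the square keeps \<open>?E\<close>
    square-integrable.\<close>
  have "AE x in M. (?E x)\<^sup>2 \<le> real_cond_exp M F (\<lambda>x. (f x)\<^sup>2) x"
    by (rule real_cond_exp_jensens_inequality(2)[where I=UNIV])
       (use f1 f2 convex_power2 in auto)
  then have E2: "integrable M (\<lambda>x. (?E x)\<^sup>2)"
    by (intro Bochner_Integration.integrable_bound[OF real_cond_exp_int(1)[OF f2]])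
       (auto elim!: eventually_mono)
  have "integrable M (\<lambda>x. (b (Y x))\<^sup>2)"
    using E2 Bochner_Integration.integrable_cong[OF refl, of M "\<lambda>x. (b (Y x))\<^sup>2" "\<lambda>x. (?E x)\<^sup>2"]
    by (simp add: bE)
  moreover have "(\<integral>x. c (Y x) * b (Y x) \<partial>M) = (\<integral>x. c (Y x) * f x \<partial>M)"
    if [measurable]: "c \<in> borel_measurable borel" and c2: "integrable M (\<lambda>x. (c (Y x))\<^sup>2)" for c
  proof -
    have "(\<integral>x. c (Y x) * b (Y x) \<partial>M) = (\<integral>x. c (Y x) * ?E x \<partial>M)"
      by (rule Bochner_Integration.integral_cong) (auto simp: bE)
    also have "\<dots> = (\<integral>x. c (Y x) * f x \<partial>M)"
      by (rule real_cond_exp_intg(2)) (use cc[OF _ _ c2 f2] in auto)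
    finally show ?thesis .
  qed
  ultimately show thesis by (rule that[OF b])
qed

text \<open>The test functions need not be conjugated, since they form a class closed under conjugation.\<close>

definition orth_fibre :: "'a measure \<Rightarrow> ('a \<Rightarrow> real) \<Rightarrow> ('a \<Rightarrow> complex) \<Rightarrow> bool" where
  "orth_fibre M Y h \<longleftrightarrow> (\<forall>c \<in> borel_measurable borel.
     (\<lambda>x. c (Y x)) \<in> L2 M \<longrightarrow> (\<integral>x. h x * c (Y x) \<partial>M) = 0)"

text \<open>Real and imaginary parts are projected separately; the pairing with a complex test
  function then splits into four real pairings.\<close>

lemma (in finite_measure) fibre_projection:
  assumes Y[measurable]: "Y \<in> measurable M borel" and f: "f \<in> L2 M"
  obtains b where "b \<in> borel_measurable borel" "(\<lambda>x. b (Y x)) \<in> L2 M"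
    "orth_fibre M Y (\<lambda>x. f x - b (Y x))"
proof -
  have fm[measurable]: "f \<in> borel_measurable M" using f by (rule L2_measurable)
  have dom: "integrable M (\<lambda>x. (u x)\<^sup>2)" if "u \<in> borel_measurable M" "g \<in> L2 M" "\<And>x. \<bar>u x\<bar> \<le> cmod (g x)"
    for u :: "'a \<Rightarrow> real" and g
  proof (rule Bochner_Integration.integrable_bound[OF L2_sq_integrable[OF that(2)]])
    have "(u x)\<^sup>2 \<le> (cmod (g x))\<^sup>2" for x
      using power_mono[OF that(3)[of x] abs_ge_zero, of 2] by simp
    then show "AE x in M. norm ((u x)\<^sup>2) \<le> norm ((cmod (g x))\<^sup>2)"
      by (intro AE_I2) (simp only: real_norm_def abs_power2)
  qed (use that(1) in measurable)
  have fR[measurable]: "(\<lambda>x. Re (f x)) \<in> borel_measurable M" and fI[measurable]: "(\<lambda>x. Im (f x)) \<in> borel_measurable M"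
    by measurable
  have f2R: "integrable M (\<lambda>x. (Re (f x))\<^sup>2)" by (rule dom[OF fR f abs_Re_le_cmod])
  have f2I: "integrable M (\<lambda>x. (Im (f x))\<^sup>2)" by (rule dom[OF fI f abs_Im_le_cmod])
  obtain p where p[measurable]: "p \<in> borel_measurable borel" and p2: "integrable M (\<lambda>x. (p (Y x))\<^sup>2)"
    and pc: "\<And>c. c \<in> borel_measurable borel \<Longrightarrow> integrable M (\<lambda>x. (c (Y x))\<^sup>2) \<Longrightarrow>
       (\<integral>x. c (Y x) * p (Y x) \<partial>M) = (\<integral>x. c (Y x) * Re (f x) \<partial>M)"
    by (rule real_cond_exp_factor[OF Y fR f2R]) blast
  obtain q where q[measurable]: "q \<in> borel_measurable borel" and q2: "integrable M (\<lambda>x. (q (Y x))\<^sup>2)"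
    and qc: "\<And>c. c \<in> borel_measurable borel \<Longrightarrow> integrable M (\<lambda>x. (c (Y x))\<^sup>2) \<Longrightarrow>
       (\<integral>x. c (Y x) * q (Y x) \<partial>M) = (\<integral>x. c (Y x) * Im (f x) \<partial>M)"
    by (rule real_cond_exp_factor[OF Y fI f2I]) blast
  define b where "b = (\<lambda>y. Complex (p y) (q y))"
  have b[measurable]: "b \<in> borel_measurable borel" unfolding b_def borel_measurable_complex_iff by simp
  have "integrable M (\<lambda>x. (p (Y x))\<^sup>2 + (q (Y x))\<^sup>2)" by (intro Bochner_Integration.integrable_add p2 q2)
  also have "(\<lambda>x. (p (Y x))\<^sup>2 + (q (Y x))\<^sup>2) = (\<lambda>x. (cmod (b (Y x)))\<^sup>2)"
    by (simp add: cmod_power2 b_def)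
  finally have bL: "(\<lambda>x. b (Y x)) \<in> L2 M"
    unfolding L2_def by simp
  have "(\<integral>x. (f x - b (Y x)) * c (Y x) \<partial>M) = 0"
    if [measurable]: "c \<in> borel_measurable borel" and c: "(\<lambda>x. c (Y x)) \<in> L2 M" for c
  proof -
    have cR[measurable]: "(\<lambda>x. Re (c (Y x))) \<in> borel_measurable M" and cI[measurable]: "(\<lambda>x. Im (c (Y x))) \<in> borel_measurable M"
      by measurable
    have R: "integrable M (\<lambda>x. (Re (c (Y x)))\<^sup>2)" by (rule dom[OF cR c abs_Re_le_cmod])
    have I: "integrable M (\<lambda>x. (Im (c (Y x)))\<^sup>2)" by (rule dom[OF cI c abs_Im_le_cmod])
    have pY[measurable]: "(\<lambda>x. p (Y x)) \<in> borel_measurable M" and qY[measurable]: "(\<lambda>x. q (Y x)) \<in> borel_measurable M"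
      by measurable
    note csR = cauchy_schwarz_integrable[OF cR _ R] and csI = cauchy_schwarz_integrable[OF cI _ I]
    note ints = csR[OF fR f2R] csR[OF fI f2I] csI[OF fR f2R] csI[OF fI f2I]
      csR[OF pY p2] csR[OF qY q2] csI[OF pY p2] csI[OF qY q2]
    have ci: "integrable M (\<lambda>x. (f x - b (Y x)) * c (Y x))"
      by (intro L2_mult_integrable L2_diff f bL c)
    have "Re (\<integral>x. (f x - b (Y x)) * c (Y x) \<partial>M)
        = (\<integral>x. (Re (c (Y x)) * Re (f x) - Re (c (Y x)) * p (Y x))
             - (Im (c (Y x)) * Im (f x) - Im (c (Y x)) * q (Y x)) \<partial>M)"
      unfolding integral_Re[OF ci, symmetric]
      by (rule Bochner_Integration.integral_cong) (simp_all add: b_def algebra_simps)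
    also have "\<dots> = 0"
      unfolding Bochner_Integration.integral_diff[OF Bochner_Integration.integrable_diff[OF ints(1,5)] Bochner_Integration.integrable_diff[OF ints(4,8)]]
        Bochner_Integration.integral_diff[OF ints(1,5)] Bochner_Integration.integral_diff[OF ints(4,8)]
      using pc[OF _ R] qc[OF _ I] by simp
    finally have re: "Re (\<integral>x. (f x - b (Y x)) * c (Y x) \<partial>M) = 0" .
    have "Im (\<integral>x. (f x - b (Y x)) * c (Y x) \<partial>M)
        = (\<integral>x. (Im (c (Y x)) * Re (f x) - Im (c (Y x)) * p (Y x))
             + (Re (c (Y x)) * Im (f x) - Re (c (Y x)) * q (Y x)) \<partial>M)"
      unfolding integral_Im[OF ci, symmetric]
      by (rule Bochner_Integration.integral_cong) (simp_all add: b_def algebra_simps)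
    also have "\<dots> = 0"
      unfolding Bochner_Integration.integral_add[OF Bochner_Integration.integrable_diff[OF ints(3,7)] Bochner_Integration.integrable_diff[OF ints(2,6)]]
        Bochner_Integration.integral_diff[OF ints(3,7)] Bochner_Integration.integral_diff[OF ints(2,6)]
      using pc[OF _ I] qc[OF _ R] by simp
    finally show ?thesis using re by (simp add: complex_eq_iff)
  qed
  then show thesis using that[OF b bL] by (auto simp: orth_fibre_def)
qed

subsection \<open>The Kaczmarz iteration\<close>

text \<open>The coordinates are kept abstract so that one development covers
  \<open>(fst, snd)\<close>, \<open>(snd, fst)\<close> and, with constant \<open>Y\<close>, the unit
  interval itself.\<close>

locale circle_fibration = prob_space M for M :: "'a measure" +
  fixes X Y :: "'a \<Rightarrow> real"
  assumes X[measurable]: "X \<in> borel_measurable M" and Y[measurable]: "Y \<in> borel_measurable M"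
begin

definition char :: "int \<Rightarrow> 'a \<Rightarrow> complex" where
  "char k a = cis (2 * pi * real_of_int k * X a)"

lemma char_measurable[measurable]: "char k \<in> borel_measurable M"
  unfolding char_def
  by (rule measurable_compose[where g=cis and N=borel]) (measurable, intro borel_measurable_continuous_onI continuous_intros)

lemma norm_char[simp]: "cmod (char k a) = 1"
  by (simp add: char_def)

lemma char_mult: "char j a * char k a = char (j + k) a"
  by (simp add: char_def cis_mult algebra_simps)

lemma char_mult_assoc: "char j a * (char k a * z) = char (j + k) a * z"
  by (simp add: char_mult mult.assoc[symmetric])

lemma char_0[simp]: "char 0 a = 1"
  by (simp add: char_def)

lemma cnj_char: "cnj (char k a) = char (-k) a"
  by (simp add: char_def cis_cnj)

lemma char_power: "char 1 a ^ n = char (int n) a"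
  by (simp add: char_def Complex.DeMoivre mult_ac)

lemma L2_char: "f \<in> L2 M \<Longrightarrow> (\<lambda>a. char k a * f a) \<in> L2 M"
  by (rule L2_mult_bounded[where C=1]) auto

lemma L2_fibre_bounded:
  assumes "c \<in> borel_measurable borel" "\<And>y. cmod (c y) \<le> C"
  shows "(\<lambda>a. c (Y a)) \<in> L2 M"
  by (rule L2_bounded[where C=C]) (use assms in auto)

lemma L2_mult_fibre:
  assumes "f \<in> L2 M" "c \<in> borel_measurable borel" "\<And>y. cmod (c y) \<le> C"
  shows "(\<lambda>a. c (Y a) * f a) \<in> L2 M"
  by (rule L2_mult_bounded[where C=C]) (use assms in auto)

lemma orth_fibreD:
  assumes "orth_fibre M Y h" "c \<in> borel_measurable borel" "(\<lambda>x. c (Y x)) \<in> L2 M"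
  shows "(\<integral>x. h x * c (Y x) \<partial>M) = 0"
  using assms by (auto simp: orth_fibre_def)

lemma orth_fibre_add:
  assumes "orth_fibre M Y f" "orth_fibre M Y g" "f \<in> L2 M" "g \<in> L2 M"
  shows "orth_fibre M Y (\<lambda>a. f a + g a)"
  unfolding orth_fibre_def
proof safe
  fix c assume c: "c \<in> borel_measurable borel" "(\<lambda>x. c (Y x)) \<in> L2 M"
  show "(\<integral>x. (f x + g x) * c (Y x) \<partial>M) = 0"
    using assms c by (simp add: distrib_right L2_mult_integrable orth_fibreD)
qed

text \<open>Bounded functions of \<open>Y\<close> act as scalars throughout: the factor moves onto
  the test function, which stays in L2.\<close>

lemma orth_fibre_mult:
  assumes "orth_fibre M Y f" "d \<in> borel_measurable borel" "\<And>y. cmod (d y) \<le> C"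
  shows "orth_fibre M Y (\<lambda>a. d (Y a) * f a)"
  unfolding orth_fibre_def
proof safe
  fix c assume c: "c \<in> borel_measurable borel" "(\<lambda>x. c (Y x)) \<in> L2 M"
  have "(\<integral>x. f x * (d (Y x) * c (Y x)) \<partial>M) = 0"
  proof (rule orth_fibreD[OF assms(1), where c="\<lambda>y. d y * c y"])
    show "(\<lambda>y. d y * c y) \<in> borel_measurable borel" using assms(2) c(1) by measurable
    show "(\<lambda>x. d (Y x) * c (Y x)) \<in> L2 M" by (rule L2_mult_fibre[OF c(2) assms(2,3)])
  qed
  then show "(\<integral>x. d (Y x) * f x * c (Y x) \<partial>M) = 0" by (simp add: mult_ac)
qed

text \<open>A relation on runs and not a function of the start: \<open>b n\<close> is determined
  only almost everywhere, and sums, multiples and prolongations of runs should again be runs without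
  matching any choices. \<open>t 0\<close> is arbitrary; only the later residuals are orthogonal to
  the functions of \<open>Y\<close>.\<close>

definition kaczmarz :: "(nat \<Rightarrow> 'a \<Rightarrow> complex) \<Rightarrow> (nat \<Rightarrow> real \<Rightarrow> complex) \<Rightarrow> bool" where
  "kaczmarz t b \<longleftrightarrow> (\<forall>n. t n \<in> L2 M \<and> b n \<in> borel_measurable borel \<and> (\<lambda>a. b n (Y a)) \<in> L2 M \<and>
     t (Suc n) = (\<lambda>a. char (-1) a * t n a - b n (Y a)) \<and> orth_fibre M Y (t (Suc n)))"

lemma kaczmarzD:
  assumes "kaczmarz t b"
  shows "t n \<in> L2 M" "b n \<in> borel_measurable borel" "(\<lambda>a. b n (Y a)) \<in> L2 M"
    "t (Suc n) a = char (-1) a * t n a - b n (Y a)" "orth_fibre M Y (t (Suc n))"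
proof -
  note * = assms[unfolded kaczmarz_def, THEN spec, of n]
  show "t n \<in> L2 M" "b n \<in> borel_measurable borel" "(\<lambda>a. b n (Y a)) \<in> L2 M" "orth_fibre M Y (t (Suc n))"
    using * by blast+
  have "t (Suc n) = (\<lambda>a. char (-1) a * t n a - b n (Y a))" using * by blast
  then show "t (Suc n) a = char (-1) a * t n a - b n (Y a)" by (simp only:)
qed

text \<open>The construction carries an invariant \<open>P\<close> of the residuals and a property
  \<open>Q\<close> of the coefficients; this is how the run from 1 gets coefficients bounded
  everywhere.\<close>

lemma kaczmarz_exists_inv:
  assumes f: "P f" and PL: "\<And>f. P f \<Longrightarrow> f \<in> L2 M"
    and step: "\<And>f. P f \<Longrightarrow> \<exists>b. b \<in> borel_measurable borel \<and> (\<lambda>a. b (Y a)) \<in> L2 M \<and>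
      orth_fibre M Y (\<lambda>a. char (-1) a * f a - b (Y a)) \<and> Q b \<and> P (\<lambda>a. char (-1) a * f a - b (Y a))"
  obtains t b where "kaczmarz t b" "t 0 = f" "\<And>n. P (t n)" "\<And>n. Q (b n)"
proof -
  define R where "R f b \<longleftrightarrow> b \<in> borel_measurable borel \<and> (\<lambda>a. b (Y a)) \<in> L2 M \<and>
      orth_fibre M Y (\<lambda>a. char (-1) a * f a - b (Y a)) \<and> Q b \<and> P (\<lambda>a. char (-1) a * f a - b (Y a))" for f b
  define B where "B f = (SOME b. R f b)" for f
  have B: "R f (B f)" if "P f" for f
    unfolding B_def by (rule someI_ex[of "R f"]) (unfold R_def, rule step[OF that])
  define t where "t = rec_nat f (\<lambda>_ g a. char (-1) a * g a - B g (Y a))"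
  have t0: "t 0 = f" by (simp add: t_def)
  have t: "t (Suc n) = (\<lambda>a. char (-1) a * t n a - B (t n) (Y a))" for n
    by (simp add: t_def)
  have P: "P (t n)" for n
  proof (induction n)
    case (Suc n)
    show ?case unfolding t using B[OF Suc] unfolding R_def by blast
  qed (simp add: t0 f)
  have "kaczmarz t (\<lambda>n. B (t n))"
    unfolding kaczmarz_def t using B[OF P, unfolded R_def] PL[OF P] by blast
  then show thesis
  proof (rule that[of t "\<lambda>n. B (t n)"])
    show "Q (B (t n))" for n using B[OF P, unfolded R_def] by blast
  qed (fact t0 P)+
qed

lemma kaczmarz_exists:
  assumes "f \<in> L2 M"
  obtains t b where "kaczmarz t b" "t 0 = f"
proof (rule kaczmarz_exists_inv[of "\<lambda>f. f \<in> L2 M" f "\<lambda>_. True"])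
  show "\<exists>b. b \<in> borel_measurable borel \<and> (\<lambda>a. b (Y a)) \<in> L2 M \<and>
      orth_fibre M Y (\<lambda>a. char (-1) a * f a - b (Y a)) \<and> True \<and> (\<lambda>a. char (-1) a * f a - b (Y a)) \<in> L2 M"
    if fL: "f \<in> L2 M" for f
  proof -
    obtain b where "b \<in> borel_measurable borel" "(\<lambda>a. b (Y a)) \<in> L2 M"
      "orth_fibre M Y (\<lambda>a. char (-1) a * f a - b (Y a))"
      using fibre_projection[OF Y L2_char[OF fL, of "-1"]] .
    with L2_diff[OF L2_char[OF fL, of "-1"]] show ?thesis by blast
  qed
next
  fix t b assume "kaczmarz t b" "t 0 = f" then show thesis by (rule that)
qed (use assms in simp_all)

lemma kaczmarz_add:
  assumes "kaczmarz t b" "kaczmarz t' b'"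
  shows "kaczmarz (\<lambda>n a. t n a + t' n a) (\<lambda>n y. b n y + b' n y)"
  unfolding kaczmarz_def
proof (intro allI conjI)
  fix n
  note D = kaczmarzD[OF assms(1)] and D' = kaczmarzD[OF assms(2)]
  show "(\<lambda>a. t n a + t' n a) \<in> L2 M" "(\<lambda>a. b n (Y a) + b' n (Y a)) \<in> L2 M"
    by (intro L2_add D D')+
  show "(\<lambda>y. b n y + b' n y) \<in> borel_measurable borel"
    using D(2)[of n] D'(2)[of n] by measurable
  show "(\<lambda>a. t (Suc n) a + t' (Suc n) a) = (\<lambda>a. char (-1) a * (t n a + t' n a) - (b n (Y a) + b' n (Y a)))"
    by (auto simp: D(4) D'(4) algebra_simps)
  show "orth_fibre M Y (\<lambda>a. t (Suc n) a + t' (Suc n) a)"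
    by (intro orth_fibre_add D D')
qed

lemma kaczmarz_mult:
  assumes "kaczmarz t b" and c[measurable]: "c \<in> borel_measurable borel" and C: "\<And>y. cmod (c y) \<le> C"
  shows "kaczmarz (\<lambda>n a. c (Y a) * t n a) (\<lambda>n y. c y * b n y)"
  unfolding kaczmarz_def
proof (intro allI conjI)
  fix n
  note D = kaczmarzD[OF assms(1)]
  show "(\<lambda>a. c (Y a) * t n a) \<in> L2 M" "(\<lambda>a. c (Y a) * b n (Y a)) \<in> L2 M"
    by (intro L2_mult_fibre[OF _ c C] D)+
  show "(\<lambda>y. c y * b n y) \<in> borel_measurable borel"
    using D(2)[of n] by measurable
  show "(\<lambda>a. c (Y a) * t (Suc n) a) = (\<lambda>a. char (-1) a * (c (Y a) * t n a) - c (Y a) * b n (Y a))"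
    by (auto simp: D(4) algebra_simps)
  show "orth_fibre M Y (\<lambda>a. c (Y a) * t (Suc n) a)"
    by (intro orth_fibre_mult[OF _ c C] D)
qed

lemma L2_sq_char: "L2_sq M (\<lambda>a. char k a * f a) = L2_sq M f"
  by (simp add: norm_mult)

text \<open>Pythagoras: multiplication by a character is an isometry, and \<open>t (Suc n)\<close>
  is orthogonal to the subtracted function of \<open>Y\<close>.\<close>

lemma kaczmarz_energy:
  assumes "kaczmarz t b"
  shows "L2_sq M (t n) = L2_sq M (t (Suc n)) + L2_sq M (\<lambda>a. b n (Y a))"
proof -
  note D = kaczmarzD[OF assms]
  have "L2_sq M (t n) = L2_sq M (\<lambda>a. t (Suc n) a + b n (Y a))"
    by (simp add: D(4) norm_mult)
  also have "\<dots> = L2_sq M (t (Suc n)) + L2_sq M (\<lambda>a. b n (Y a))"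
  proof (rule L2_sq_add_orth[OF D(1,3)])
    show "(\<integral>x. t (Suc n) x * cnj (b n (Y x)) \<partial>M) = 0"
      by (rule orth_fibreD[OF D(5) borel_measurable_cnj[OF D(2)] L2_cnj[OF D(3)]])
  qed
  finally show ?thesis .
qed

lemma kaczmarz_antimono:
  assumes "kaczmarz t b" shows "decseq (\<lambda>n. L2_sq M (t n))"
proof (rule decseq_SucI)
  fix n
  have "0 \<le> L2_sq M (\<lambda>a. b n (Y a))" by simp
  then show "L2_sq M (t (Suc n)) \<le> L2_sq M (t n)"
    using kaczmarz_energy[OF assms, of n] by linarith
qed

text \<open>\<open>b k\<close> is subtracted after \<open>k + 1\<close> rotations by
  \<open>char (-1)\<close>, so it carries frequency \<open>k + 1\<close> once the rotations are
  undone.\<close>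

lemma kaczmarz_residual:
  assumes "kaczmarz t b"
  shows "t n a = char (- int n) a * (t 0 a - (\<Sum>k<n. char (int k + 1) a * b k (Y a)))"
proof (induction n)
  case (Suc n)
  show ?case unfolding kaczmarzD(4)[OF assms] Suc
    by (simp add: right_diff_distrib distrib_left char_mult_assoc)
qed simp

lemma kaczmarz_residual_norm:
  assumes "kaczmarz t b"
  shows "L2_sq M (\<lambda>a. (\<Sum>k<n. char (int k + 1) a * b k (Y a)) - t 0 a) = L2_sq M (t n)"
  unfolding kaczmarz_residual[OF assms, of n] L2_sq_char by (simp add: norm_minus_commute)

text \<open>The hypothesis is P|f|^2 \<le> C^2 in integrated form, tested on the sets {Y in D}, and
  |Pf|^2 \<le> P|f|^2. The bound on \<open>b\<close> is obtained at every point, so that the power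
  series built from such functions converge without exceptional sets.\<close>

lemma fibre_projection_bounded:
  assumes f: "f \<in> L2 M" and C: "0 \<le> C"
    and bound: "\<And>D. D \<in> sets borel \<Longrightarrow>
      L2_sq M (\<lambda>a. indicator D (Y a) * f a) \<le> C\<^sup>2 * (\<integral>a. indicator D (Y a) \<partial>M)"
  obtains b where "b \<in> borel_measurable borel" "\<And>y. cmod (b y) \<le> C" "orth_fibre M Y (\<lambda>x. f x - b (Y x))"
proof -
  obtain b where b[measurable]: "b \<in> borel_measurable borel" and bL: "(\<lambda>x. b (Y x)) \<in> L2 M"
    and o: "orth_fibre M Y (\<lambda>x. f x - b (Y x))"
    using fibre_projection[OF Y f] by blast
  \<comment> \<open>The set where the bound fails. Over it the energy of \<open>b\<close> is at most
    that of \<open>f\<close>, which is impossible unless \<open>Y\<close> avoids it almost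
    surely.\<close>
  define D where "D = {y. C < cmod (b y)}"
  have D[measurable]: "D \<in> sets borel" unfolding D_def by measurable
  define d :: "real \<Rightarrow> complex" where "d = indicator D"
  have d[measurable]: "d \<in> borel_measurable borel" unfolding d_def by measurable
  have d1: "cmod (d y) \<le> 1" for y by (simp add: d_def indicator_def)
  have dbL: "(\<lambda>a. d (Y a) * b (Y a)) \<in> L2 M" by (rule L2_mult_fibre[OF bL d d1])
  have "L2_sq M (\<lambda>a. d (Y a) * (f a - b (Y a)) + d (Y a) * b (Y a)) =
      L2_sq M (\<lambda>a. d (Y a) * (f a - b (Y a))) + L2_sq M (\<lambda>a. d (Y a) * b (Y a))"
  proof (rule L2_sq_add_orth)
    show "(\<integral>x. d (Y x) * (f x - b (Y x)) * cnj (d (Y x) * b (Y x)) \<partial>M) = 0"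
      by (rule orth_fibreD[OF orth_fibre_mult[OF o d d1] _ L2_cnj[OF dbL]]) measurable
  qed (intro L2_mult_fibre[OF _ d d1] L2_diff f bL)+
  then have "L2_sq M (\<lambda>a. d (Y a) * b (Y a)) \<le> L2_sq M (\<lambda>a. d (Y a) * f a)"
    by (simp add: algebra_simps)
  also have "\<dots> \<le> C\<^sup>2 * (\<integral>a. indicator D (Y a) \<partial>M)"
    unfolding d_def by (rule bound) simp
  finally have le0: "L2_sq M (\<lambda>a. d (Y a) * b (Y a)) \<le> C\<^sup>2 * (\<integral>a. indicator D (Y a) \<partial>M)" .
  have Dint: "integrable M (\<lambda>a. indicator D (Y a) :: real)"
    by (rule integrable_const_bound[where B=1]) (auto simp: indicator_def)
  have le: "(\<integral>a. (cmod (d (Y a) * b (Y a)))\<^sup>2 - C\<^sup>2 * indicator D (Y a) \<partial>M) \<le> 0"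
    using le0 Dint L2_sq_integrable[OF dbL] by (subst Bochner_Integration.integral_diff) simp_all
  have nn: "0 \<le> (cmod (d (Y a) * b (Y a)))\<^sup>2 - C\<^sup>2 * indicator D (Y a)" for a
    using C by (auto simp: d_def D_def indicator_def intro!: power_mono)
  have int: "integrable M (\<lambda>a. (cmod (d (Y a) * b (Y a)))\<^sup>2 - C\<^sup>2 * indicator D (Y a))"
    using L2_sq_integrable[OF dbL] Dint by (intro Bochner_Integration.integrable_diff) simp_all
  have "AE a in M. (cmod (d (Y a) * b (Y a)))\<^sup>2 - C\<^sup>2 * indicator D (Y a) = 0"
    using integral_nonneg_eq_0_iff_AE[OF int AE_I2[OF nn]]
      antisym[OF le Bochner_Integration.integral_nonneg_AE[OF AE_I2[OF nn]]] by blast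
  then have AE: "AE a in M. Y a \<notin> D"
  proof eventually_elim
    case (elim a)
    show ?case
    proof
      assume "Y a \<in> D"
      then have "(cmod (b (Y a)))\<^sup>2 = C\<^sup>2" "C < cmod (b (Y a))" using elim by (auto simp: d_def D_def)
      then show False using C by (simp add: power2_eq_iff_nonneg)
    qed
  qed
  \<comment> \<open>Setting \<open>b\<close> to 0 on \<open>D\<close> changes \<open>b (Y x)\<close>
    only on a null set, so orthogonality survives.\<close>
  define b' where "b' = (\<lambda>y. if y \<in> D then 0 else b y)"
  have b': "b' \<in> borel_measurable borel" unfolding b'_def by measurable
  have "orth_fibre M Y (\<lambda>x. f x - b' (Y x))"
    unfolding orth_fibre_def
  proof safe
    fix c :: "real \<Rightarrow> complex"
    assume [measurable]: "c \<in> borel_measurable borel" and c: "(\<lambda>x. c (Y x)) \<in> L2 M"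
    have [measurable]: "f \<in> borel_measurable M" by (rule L2_measurable[OF f])
    have "(\<integral>x. (f x - b' (Y x)) * c (Y x) \<partial>M) = (\<integral>x. (f x - b (Y x)) * c (Y x) \<partial>M)"
      by (rule integral_cong_AE) (use AE b' in \<open>auto simp: b'_def elim!: eventually_mono\<close>)
    then show "(\<integral>x. (f x - b' (Y x)) * c (Y x) \<partial>M) = 0" using orth_fibreD[OF o _ c] by simp
  qed
  moreover have "cmod (b' y) \<le> C" for y using C by (auto simp: b'_def D_def)
  ultimately show thesis using that b' by blast
qed

text \<open>The invariant \<open>?P\<close> expresses that the conditional energy given
  \<open>Y\<close> is at most 1. It holds with equality at the start, and subtracting a projection
  can only lower it, also after localising to {Y in D}.\<close>

lemma kaczmarz_one:
  obtains t b where "kaczmarz t b" "t 0 = (\<lambda>_. 1)" "\<And>n y. cmod (b n y) \<le> 1"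
proof -
  let ?P = "\<lambda>f. f \<in> L2 M \<and> (\<forall>D\<in>sets borel. L2_sq M (\<lambda>a. indicator D (Y a) * f a) \<le> (\<integral>a. indicator D (Y a) \<partial>M))"
  show thesis
  proof (rule kaczmarz_exists_inv[of ?P "\<lambda>_. 1" "\<lambda>b. \<forall>y. cmod (b y) \<le> 1"])
    have "L2_sq M (\<lambda>a. indicator D (Y a) * 1) \<le> (\<integral>a. indicator D (Y a) \<partial>M)" for D :: "real set"
      by (rule eq_refl, rule Bochner_Integration.integral_cong) (auto simp: indicator_def)
    then show "?P (\<lambda>_. 1)" using L2_bounded[of "\<lambda>_. 1" 1] by auto
  next
    fix f assume P: "?P f"
    then have f: "f \<in> L2 M" by blast
    obtain b where b: "b \<in> borel_measurable borel" "\<And>y. cmod (b y) \<le> 1"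
      "orth_fibre M Y (\<lambda>x. char (-1) x * f x - b (Y x))"
    proof (rule fibre_projection_bounded[OF L2_char[OF f, of "-1"], of 1])
      show "L2_sq M (\<lambda>a. indicator D (Y a) * (char (-1) a * f a)) \<le> 1\<^sup>2 * (\<integral>a. indicator D (Y a) \<partial>M)"
        if "D \<in> sets borel" for D
        using P that by (simp add: norm_mult)
    qed (use that in auto)
    have bL: "(\<lambda>a. b (Y a)) \<in> L2 M" using b(1,2) by (rule L2_fibre_bounded)
    let ?t = "\<lambda>a. char (-1) a * f a - b (Y a)"
    have t: "?t \<in> L2 M" by (intro L2_diff L2_char f bL)
    have "L2_sq M (\<lambda>a. indicator D (Y a) * ?t a) \<le> (\<integral>a. indicator D (Y a) \<partial>M)" if [measurable]: "D \<in> sets borel" for D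
    proof -
      define d :: "real \<Rightarrow> complex" where "d = indicator D"
      have d[measurable]: "d \<in> borel_measurable borel" unfolding d_def by measurable
      have d1: "cmod (d y) \<le> 1" for y by (simp add: d_def indicator_def)
      have dbL: "(\<lambda>a. d (Y a) * b (Y a)) \<in> L2 M" by (rule L2_mult_fibre[OF bL d d1])
      have "L2_sq M (\<lambda>a. d (Y a) * ?t a + d (Y a) * b (Y a)) =
          L2_sq M (\<lambda>a. d (Y a) * ?t a) + L2_sq M (\<lambda>a. d (Y a) * b (Y a))"
      proof (rule L2_sq_add_orth)
        show "(\<integral>x. d (Y x) * ?t x * cnj (d (Y x) * b (Y x)) \<partial>M) = 0"
          using b(1) by (intro orth_fibreD[OF orth_fibre_mult[OF b(3) d d1] _ L2_cnj[OF dbL]]) measurable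
      qed (intro L2_mult_fibre[OF _ d d1] t bL)+
      moreover have "L2_sq M (\<lambda>a. d (Y a) * ?t a + d (Y a) * b (Y a)) = L2_sq M (\<lambda>a. indicator D (Y a) * f a)"
        by (simp add: algebra_simps d_def norm_mult)
      moreover have "0 \<le> L2_sq M (\<lambda>a. d (Y a) * b (Y a))" by simp
      ultimately have "L2_sq M (\<lambda>a. indicator D (Y a) * ?t a) \<le> L2_sq M (\<lambda>a. indicator D (Y a) * f a)"
        unfolding d_def by linarith
      also have "\<dots> \<le> (\<integral>a. indicator D (Y a) \<partial>M)" using P that by blast
      finally show ?thesis .
    qed
    with b bL t show "\<exists>b. b \<in> borel_measurable borel \<and> (\<lambda>a. b (Y a)) \<in> L2 M \<and>
      orth_fibre M Y (\<lambda>a. char (-1) a * f a - b (Y a)) \<and> (\<forall>y. cmod (b y) \<le> 1) \<and> ?P (\<lambda>a. char (-1) a * f a - b (Y a))"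
      by blast
  qed (use that in auto)
qed

end

subsection \<open>Fourier coefficients on the unit interval\<close>

lemma space_unit_lebesgue: "space unit_lebesgue = {0..<1}"
  by (simp add: space_restrict_space)

interpretation U: prob_space unit_lebesgue
proof
  show "emeasure unit_lebesgue (space unit_lebesgue) = 1"
    by (simp add: space_restrict_space emeasure_restrict_space)
qed

text \<open>The fibration with trivial second coordinate: this makes the characters, and later the density result for
  general fibrations, available on the unit interval.\<close>

interpretation U: circle_fibration unit_lebesgue "\<lambda>x. x" "\<lambda>_. 0"
proof
  show "(\<lambda>x. x) \<in> borel_measurable unit_lebesgue"
    by (rule measurable_restrict_space1) simp
qed simp

lemma integral_const_unit:
  fixes c :: "'b::{banach, second_countable_topology}"
  shows "(\<integral>x. c \<partial>unit_lebesgue) = c"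
  using U.prob_space by (simp only: lebesgue_integral_const scaleR_one)

lemma prob_unit[simp]: "U.prob {0..<1} = 1"
  using U.prob_space by (simp only: space_unit_lebesgue)

lemma integral_char: "(\<integral>x. U.char k x \<partial>unit_lebesgue) = (if k = 0 then 1 else 0)"
proof (cases "k = 0")
  case True
  then show ?thesis by (simp only: U.char_0 integral_const_unit simp_thms if_True)
next
  case False
  define F :: "real \<Rightarrow> complex" where "F x = cis (2 * pi * real_of_int k * x) / (\<i> * of_real (2 * pi * real_of_int k))" for x
  have "(\<integral>x. U.char k x \<partial>unit_lebesgue) = (\<integral>x. indicator {0..<1::real} x *\<^sub>R U.char k x \<partial>lborel)"
    by (subst integral_restrict_space) auto
  \<comment> \<open>The fundamental theorem is applied on the closed interval; the added endpoint is
    a null set.\<close>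
  also have "\<dots> = (\<integral>x. indicator {0..1::real} x *\<^sub>R U.char k x \<partial>lborel)"
  proof (rule integral_cong_AE)
    have "U.char k \<in> borel_measurable borel"
      unfolding U.char_def by (intro borel_measurable_continuous_onI continuous_intros)
    then have m: "U.char k \<in> borel_measurable lborel" by simp
    show "(\<lambda>x. indicator {0..<1::real} x *\<^sub>R U.char k x) \<in> borel_measurable lborel"
      "(\<lambda>x. indicator {0..1::real} x *\<^sub>R U.char k x) \<in> borel_measurable lborel"
      by (intro borel_measurable_scaleR borel_measurable_indicator m; simp)+
    have "AE x in lborel. x \<noteq> (1::real)" by (rule AE_lborel_singleton)
    then show "AE x in lborel. indicator {0..<1::real} x *\<^sub>R U.char k x = indicator {0..1::real} x *\<^sub>R U.char k x"
      by eventually_elim (auto simp: indicator_def)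
  qed
  also have "\<dots> = F 1 - F 0"
  proof (rule integral_FTC_Icc)
    fix x :: real
    define w where "w = \<i> * of_real (2 * pi * real_of_int k)"
    have w: "w \<noteq> 0" using False by (simp add: w_def)
    have "((\<lambda>z. exp (w * z) / w) has_field_derivative exp (w * of_real x)) (at (of_real x))"
      using w by (auto intro!: derivative_eq_intros)
    then have "((\<lambda>x. exp (w * of_real x) / w) has_vector_derivative exp (w * of_real x)) (at x within {0..1})"
      by (rule has_vector_derivative_real_field)
    moreover have "F = (\<lambda>x. exp (w * of_real x) / w)" "U.char k x = exp (w * of_real x)"
      by (simp_all add: F_def U.char_def cis_conv_exp w_def fun_eq_iff mult.assoc)
    ultimately show "(F has_vector_derivative U.char k x) (at x within {0..1})"
      by simp
    show "continuous_on {0..1} (U.char k)"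
      unfolding U.char_def by (intro continuous_intros)
  qed simp
  also have "\<dots> = 0" 
    by (simp add: F_def cis_multiple_2pi[OF Ints_of_int])
  finally show ?thesis using False by simp
qed

definition fourier_coeff :: "(real \<Rightarrow> complex) \<Rightarrow> int \<Rightarrow> complex" where
  "fourier_coeff f k = (\<integral>x. U.char (-k) x * f x \<partial>unit_lebesgue)"

lemma L2_char_unit: "(\<lambda>x. c * U.char k x) \<in> L2 unit_lebesgue"
  by (rule L2_cmult, rule U.L2_bounded[of _ 1]) auto

text \<open>Frequencies are removed one at a time: the new remainder has coefficient 0 at the
  removed frequency, hence is orthogonal to the term just taken away.\<close>

lemma fourier_partial_sum:
  assumes f: "f \<in> L2 unit_lebesgue" and F: "finite F"
  shows "fourier_coeff (\<lambda>x. f x - (\<Sum>k\<in>F. fourier_coeff f k * U.char k x)) j = (if j \<in> F then 0 else fourier_coeff f j)"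
    and "L2_sq unit_lebesgue (\<lambda>x. f x - (\<Sum>k\<in>F. fourier_coeff f k * U.char k x)) =
      L2_sq unit_lebesgue f - (\<Sum>k\<in>F. (cmod (fourier_coeff f k))\<^sup>2)"
proof -
  let ?R = "\<lambda>F x. f x - (\<Sum>k\<in>F. fourier_coeff f k * U.char k x)"
  have R: "?R F \<in> L2 unit_lebesgue" for F
    by (intro L2_diff f L2_sum L2_char_unit)
  have co: "fourier_coeff (\<lambda>x. g x - c * U.char k x) j = fourier_coeff g j - (if j = k then c else 0)"
    if "g \<in> L2 unit_lebesgue" for g c k j
  proof -
    have "fourier_coeff (\<lambda>x. g x - c * U.char k x) j =
        (\<integral>x. U.char (-j) x * g x - c * U.char (k - j) x \<partial>unit_lebesgue)"
      unfolding fourier_coeff_def using U.char_mult[of "-j" _ k] 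
      by (intro Bochner_Integration.integral_cong) (auto simp: algebra_simps)
    also have "\<dots> = fourier_coeff g j - c * (if k - j = 0 then 1 else 0)"
      unfolding fourier_coeff_def integral_char[symmetric]
      using U.L2_integrable[OF U.L2_char[OF that]] U.L2_integrable[OF L2_char_unit[of c]]
      by (subst Bochner_Integration.integral_diff) simp_all
    finally show ?thesis by auto
  qed
  have "fourier_coeff (?R F) j = (if j \<in> F then 0 else fourier_coeff f j) \<and>
      L2_sq unit_lebesgue (?R F) = L2_sq unit_lebesgue f - (\<Sum>k\<in>F. (cmod (fourier_coeff f k))\<^sup>2)" for j
    using F
  proof (induction F arbitrary: j)
    case (insert i F)
    let ?c = "fourier_coeff f i"
    have eq: "?R (insert i F) = (\<lambda>x. ?R F x - ?c * U.char i x)"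
      using insert by (auto simp: algebra_simps)
    have co': "fourier_coeff (?R (insert i F)) j = (if j \<in> insert i F then 0 else fourier_coeff f j)" for j
      unfolding eq co[OF R] using insert.IH[of j] insert.hyps by auto
    have h1: "L2_sq unit_lebesgue (\<lambda>x. ?R (insert i F) x + ?c * U.char i x) =
        L2_sq unit_lebesgue (?R (insert i F)) + L2_sq unit_lebesgue (\<lambda>x. ?c * U.char i x)"
    proof (rule L2_sq_add_orth[OF R L2_char_unit])
      have "(\<integral>x. ?R (insert i F) x * cnj (?c * U.char i x) \<partial>unit_lebesgue)
          = cnj ?c * fourier_coeff (?R (insert i F)) i"
        unfolding fourier_coeff_def integral_mult_right_zero[symmetric]
        by (rule Bochner_Integration.integral_cong) (auto simp: U.cnj_char mult_ac)
      then show "(\<integral>x. ?R (insert i F) x * cnj (?c * U.char i x) \<partial>unit_lebesgue) = 0"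
        by (simp only: co') simp
    qed
    have h2: "L2_sq unit_lebesgue (\<lambda>x. ?c * U.char i x) = (cmod ?c)\<^sup>2"
      by (simp add: norm_mult integral_const_unit)
    have h3: "?R (insert i F) x + ?c * U.char i x = ?R F x" for x
      using insert.hyps by simp
    have "L2_sq unit_lebesgue (?R (insert i F)) = L2_sq unit_lebesgue (?R F) - (cmod ?c)\<^sup>2"
      using h1[unfolded h3 h2] by linarith
    then show ?case using co' insert by auto
  qed simp
  then show "fourier_coeff (?R F) j = (if j \<in> F then 0 else fourier_coeff f j)"
    "L2_sq unit_lebesgue (?R F) = L2_sq unit_lebesgue f - (\<Sum>k\<in>F. (cmod (fourier_coeff f k))\<^sup>2)" by auto
qed

lemma bessel:
  assumes "f \<in> L2 unit_lebesgue" "finite F"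
  shows "(\<Sum>k\<in>F. (cmod (fourier_coeff f k))\<^sup>2) \<le> L2_sq unit_lebesgue f"
proof -
  have "0 \<le> L2_sq unit_lebesgue (\<lambda>x. f x - (\<Sum>k\<in>F. fourier_coeff f k * U.char k x))"
    by (rule Bochner_Integration.integral_nonneg) simp
  then show ?thesis using fourier_partial_sum(2)[OF assms] by linarith
qed

text \<open>Absolute convergence lets the sum leave the integral. The series occurs as the Poisson
  kernel and as \<open>gen\<close> on a circle of radius r, whose coefficients are thereby
  identified.\<close>

lemma fourier_coeff_series:
  assumes "summable (\<lambda>n. cmod (c n))"
  shows "(\<lambda>x. \<Sum>n. c n * U.char (int n) x) \<in> L2 unit_lebesgue"
    and "fourier_coeff (\<lambda>x. \<Sum>n. c n * U.char (int n) x) (int k) = c k"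
proof -
  have s: "summable (\<lambda>n. norm (d n * U.char (i n) x))" if "summable (\<lambda>n. cmod (d n))" for d and i :: "nat \<Rightarrow> int" and x
    using that by (simp add: norm_mult)
  show "(\<lambda>x. \<Sum>n. c n * U.char (int n) x) \<in> L2 unit_lebesgue"
  proof (rule U.L2_bounded)
    show "cmod (\<Sum>n. c n * U.char (int n) x) \<le> (\<Sum>n. cmod (c n))" for x
      using summable_norm[OF s[OF assms, of int x]] by (simp add: norm_mult)
  qed measurable
  have "fourier_coeff (\<lambda>x. \<Sum>n. c n * U.char (int n) x) (int k) =
      (\<integral>x. (\<Sum>n. c n * U.char (int n - int k) x) \<partial>unit_lebesgue)"
    unfolding fourier_coeff_def
  proof (rule Bochner_Integration.integral_cong[OF refl])
    fix x
    have "U.char (- int k) x * (\<Sum>n. c n * U.char (int n) x) = (\<Sum>n. U.char (- int k) x * (c n * U.char (int n) x))"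
      by (rule suminf_mult[symmetric]) (rule summable_norm_cancel[OF s[OF assms]])
    also have "\<dots> = (\<Sum>n. c n * U.char (int n - int k) x)"
      using U.char_mult[of "- int k" x] by (intro suminf_cong) (simp add: mult.left_commute)
    finally show "U.char (- int k) x * (\<Sum>n. c n * U.char (int n) x) = (\<Sum>n. c n * U.char (int n - int k) x)" .
  qed
  also have "\<dots> = (\<Sum>n. (\<integral>x. c n * U.char (int n - int k) x \<partial>unit_lebesgue))"
  proof (rule integral_suminf)
    show "summable (\<lambda>n. \<integral>x. norm (c n * U.char (int n - int k) x) \<partial>unit_lebesgue)"
      using assms by (simp add: norm_mult integral_const_unit)
    show "AE x in unit_lebesgue. summable (\<lambda>n. norm (c n * U.char (int n - int k) x))"
      by (intro AE_I2 s assms)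
    show "integrable unit_lebesgue (\<lambda>x. c n * U.char (int n - int k) x)" for n
      by (rule U.L2_integrable[OF L2_char_unit])
  qed
  also have "\<dots> = (\<Sum>n. if n = k then c n else 0)"
    unfolding integral_mult_right_zero integral_char by (intro suminf_cong) auto
  also have "\<dots> = c k"
    using suminf_finite[of "{k}" "\<lambda>n. if n = k then c n else 0"] by simp
  finally show "fourier_coeff (\<lambda>x. \<Sum>n. c n * U.char (int n) x) (int k) = c k" .
qed

text \<open>The right side is the real part of a geometric series with corrected constant term, so
  the mean of the kernel reduces to the coefficient of frequency 0.\<close>

lemma poisson_kernel_eq:
  assumes "cmod w = r" "r < 1"
  shows "(1 - r\<^sup>2) / (cmod (1 - w))\<^sup>2 = 2 * Re (1 / (1 - w)) - 1"
proof -
  have "w \<noteq> 1" using assms by auto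
  then have nz: "(cmod (1 - w))\<^sup>2 \<noteq> 0" by simp
  have a: "Re (1 / (1 - w)) = Re (1 - w) / (cmod (1 - w))\<^sup>2"
    by (simp add: Re_divide cmod_power2)
  have b: "1 - r\<^sup>2 = 2 * Re (1 - w) - (cmod (1 - w))\<^sup>2"
    unfolding assms(1)[symmetric] cmod_power2 by (simp add: power2_eq_square algebra_simps)
  show ?thesis unfolding a b diff_divide_distrib using nz by (simp del: minus_complex.sel)
qed

lemma poisson_kernel_integral:
  assumes r: "0 \<le> r" "r < 1" and u: "cmod u = 1"
  shows "integrable unit_lebesgue (\<lambda>x. (1 - r\<^sup>2) / (cmod (1 - of_real r * U.char 1 x * u))\<^sup>2)" (is ?I)
    and "(\<integral>x. (1 - r\<^sup>2) / (cmod (1 - of_real r * U.char 1 x * u))\<^sup>2 \<partial>unit_lebesgue) = 1" (is ?E)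
proof -
  let ?f = "\<lambda>x. \<Sum>n. (of_real r * u) ^ n * U.char (int n) x"
  have s: "summable (\<lambda>n. cmod ((of_real r * u) ^ n))"
    using r u by (simp add: norm_power norm_mult)
  have "?f x = 1 / (1 - of_real r * U.char 1 x * u)" for x
  proof -
    have "?f x = (\<Sum>n. (of_real r * U.char 1 x * u) ^ n)"
      by (simp add: U.char_power[symmetric] power_mult_distrib mult_ac)
    also have "\<dots> = 1 / (1 - of_real r * U.char 1 x * u)"
      using r u by (intro suminf_geometric) (simp add: norm_mult)
    finally show ?thesis .
  qed
  then have eq: "(1 - r\<^sup>2) / (cmod (1 - of_real r * U.char 1 x * u))\<^sup>2 = 2 * Re (?f x) - 1" for x
    using poisson_kernel_eq[of "of_real r * U.char 1 x * u" r] r u by (simp add: norm_mult)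
  have fi: "integrable unit_lebesgue ?f"
    by (rule U.L2_integrable[OF fourier_coeff_series(1)[OF s]])
  have "(\<integral>x. ?f x \<partial>unit_lebesgue) = 1"
    using fourier_coeff_series(2)[OF s, of 0] unfolding fourier_coeff_def by simp
  then have "(\<integral>x. Re (?f x) \<partial>unit_lebesgue) = 1"
    using integral_Re[OF fi] by simp
  then show ?I ?E
    unfolding eq using integrable_Re[OF fi] by (simp_all add: integral_const_unit)
qed

subsection \<open>The iteration started at the constant function\<close>

locale unit_kaczmarz = circle_fibration M X Y for M :: "'a measure" and X Y +
  fixes t :: "nat \<Rightarrow> 'a \<Rightarrow> complex" and b :: "nat \<Rightarrow> real \<Rightarrow> complex"
  assumes kacz: "kaczmarz t b" and t0: "t 0 = (\<lambda>_. 1)" and b_le: "cmod (b n y) \<le> 1"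
begin

lemmas kD = kaczmarzD[OF kacz]

lemma b_measurable[measurable]: "b n \<in> borel_measurable borel" by (rule kD)

lemma t_measurable[measurable]: "t n \<in> borel_measurable M" by (rule L2_measurable[OF kD(1)])

text \<open>Crude linear growth suffices: it makes the power series \<open>gen\<close> converge
  absolutely in the open disc, with a bound independent of the point.\<close>

lemma norm_t_le: "cmod (t n a) \<le> real n + 1"
proof (induction n)
  case (Suc n)
  have "cmod (t (Suc n) a) \<le> cmod (char (-1) a * t n a) + cmod (b n (Y a))"
    unfolding kD(4) by (rule norm_triangle_ineq4)
  then show ?case using Suc b_le[of n "Y a"] by (simp add: norm_mult)
qed (simp add: t0)

text \<open>The functions g_z and beta_z of the overview. The exponent \<open>Suc n\<close> in
  \<open>beta\<close> records that \<open>b n\<close> arises in passing from \<open>t n\<close> to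
  \<open>t (Suc n)\<close>.\<close>

definition gen :: "complex \<Rightarrow> 'a \<Rightarrow> complex" where "gen z a = (\<Sum>n. z ^ n * t n a)"
definition beta :: "complex \<Rightarrow> real \<Rightarrow> complex" where "beta z y = (\<Sum>n. z ^ Suc n * b n y)"

lemma summable_majorant: "cmod z < 1 \<Longrightarrow> summable (\<lambda>n. (real n + 1) * cmod z ^ n)"
  using geometric_deriv_sums[of "cmod z"] by (auto simp: sums_iff ac_simps)

lemma norm_gen_term: "cmod (z ^ n * t n a) \<le> (real n + 1) * cmod z ^ n"
  using mult_right_mono[OF norm_t_le[of n a], of "cmod z ^ n"] by (simp add: norm_mult norm_power mult.commute)

lemma summable_gen: "cmod z < 1 \<Longrightarrow> summable (\<lambda>n. cmod (z ^ n * t n a))"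
  by (rule summable_comparison_test'[OF summable_majorant]) (use norm_gen_term in auto)

lemma summable_beta: "cmod z < 1 \<Longrightarrow> summable (\<lambda>n. cmod (z ^ Suc n * b n y))"
proof (rule summable_comparison_test'[where N=0])
  assume "cmod z < 1" then show "summable (\<lambda>n. cmod z ^ Suc n)"
    by (simp add: summable_mult)
  show "norm (cmod (z ^ Suc n * b n y)) \<le> cmod z ^ Suc n" for n
    using mult_left_mono[OF b_le[of n y], of "cmod z ^ Suc n"] by (simp add: norm_mult norm_power)
qed

lemma gen_measurable[measurable]: "gen z \<in> borel_measurable M"
  unfolding gen_def[abs_def] by measurable

lemma beta_measurable[measurable]: "beta z \<in> borel_measurable borel"
  unfolding beta_def[abs_def] by measurable

lemma norm_gen_le:
  assumes "cmod z < 1" shows "cmod (gen z a) \<le> (\<Sum>n. (real n + 1) * cmod z ^ n)"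
proof -
  have "cmod (gen z a) \<le> (\<Sum>n. cmod (z ^ n * t n a))"
    unfolding gen_def by (rule summable_norm[OF summable_gen[OF assms]])
  also have "\<dots> \<le> (\<Sum>n. (real n + 1) * cmod z ^ n)"
    by (rule suminf_le[OF norm_gen_term summable_gen[OF assms] summable_majorant[OF assms]])
  finally show ?thesis .
qed

lemma gen_L2: "cmod z < 1 \<Longrightarrow> gen z \<in> L2 M"
  by (rule L2_bounded[OF gen_measurable norm_gen_le])

lemma beta_L2: "cmod z < 1 \<Longrightarrow> (\<lambda>a. beta z (Y a)) \<in> L2 M"
proof (rule L2_fibre_bounded[OF beta_measurable])
  fix y assume z: "cmod z < 1"
  have "cmod (beta z y) \<le> (\<Sum>n. cmod (z ^ Suc n * b n y))"
    unfolding beta_def by (rule summable_norm[OF summable_beta[OF z]])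
  also have "\<dots> \<le> (\<Sum>n. cmod z ^ Suc n)"
    by (rule suminf_le[OF _ summable_beta[OF z]])
       (use z mult_left_mono[OF b_le, of "cmod z ^ Suc _"] in \<open>auto simp: norm_mult norm_power summable_mult\<close>)
  finally show "cmod (beta z y) \<le> (\<Sum>n. cmod z ^ Suc n)" .
qed

lemma gen_minus_one:
  assumes "cmod z < 1" shows "gen z a - 1 = (\<Sum>n. z ^ Suc n * t (Suc n) a)"
  using suminf_split_head[OF summable_norm_cancel[OF summable_gen[OF assms, of a]]]
  by (simp add: gen_def t0)

lemma gen_step:
  assumes z: "cmod z < 1" shows "gen z a - 1 = z * char (-1) a * gen z a - beta z (Y a)"
proof -
  have "gen z a - 1 = (\<Sum>n. z * char (-1) a * (z ^ n * t n a) - z ^ Suc n * b n (Y a))"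
    unfolding gen_minus_one[OF z] kD(4) by (intro suminf_cong) (simp add: algebra_simps)
  also have "\<dots> = (\<Sum>n. z * char (-1) a * (z ^ n * t n a)) - beta z (Y a)"
    unfolding beta_def
    by (intro suminf_diff[symmetric] summable_mult summable_norm_cancel[OF summable_gen[OF z]]
        summable_norm_cancel[OF summable_beta[OF z]])
  also have "(\<Sum>n. z * char (-1) a * (z ^ n * t n a)) = z * char (-1) a * gen z a"
    unfolding gen_def by (intro suminf_mult summable_norm_cancel[OF summable_gen[OF z]])
  finally show ?thesis .
qed

text \<open>All terms of \<open>gen z a - 1\<close> have index at least 1 and are orthogonal; linear
  growth against the integrable \<open>cmod (c (Y a))\<close> justifies integrating term by
  term.\<close>

lemma gen_orth:
  assumes z: "cmod z < 1" shows "orth_fibre M Y (\<lambda>a. gen z a - 1)"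
  unfolding orth_fibre_def
proof safe
  fix c :: "real \<Rightarrow> complex"
  assume [measurable]: "c \<in> borel_measurable borel" and c: "(\<lambda>a. c (Y a)) \<in> L2 M"
  have ci: "integrable M (\<lambda>a. cmod (c (Y a)))"
    using L2_integrable[OF c] by simp
  let ?u = "\<lambda>n a. z ^ Suc n * (t (Suc n) a * c (Y a))"
  have ui: "integrable M (?u n)" for n
    by (intro integrable_mult_right L2_mult_integrable kD c)
  have un: "cmod (?u n a) = cmod (z ^ Suc n * t (Suc n) a) * cmod (c (Y a))" for n a
    by (simp add: norm_mult)
  have sS: "summable (\<lambda>n. (real (Suc n) + 1) * cmod z ^ Suc n)"
    using summable_Suc_iff[of "\<lambda>n. (real n + 1) * cmod z ^ n"] summable_majorant[OF z] by simp
  have sg: "summable (\<lambda>n. cmod (z ^ Suc n * t (Suc n) a))" for a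
    using summable_Suc_iff[of "\<lambda>n. cmod (z ^ n * t n a)"] summable_gen[OF z] by simp
  have "(\<integral>a. (gen z a - 1) * c (Y a) \<partial>M) = (\<integral>a. (\<Sum>n. ?u n a) \<partial>M)"
    unfolding gen_minus_one[OF z]
    by (intro Bochner_Integration.integral_cong refl, subst suminf_mult2[OF summable_norm_cancel[OF sg]])
       (simp add: mult.assoc)
  also have "\<dots> = (\<Sum>n. \<integral>a. ?u n a \<partial>M)"
  proof (rule integral_suminf[OF ui])
    show "AE a in M. summable (\<lambda>n. norm (?u n a))"
      unfolding un by (intro AE_I2 summable_mult2 sg)
    have "(\<integral>a. cmod (?u n a) \<partial>M) \<le> (real (Suc n) + 1) * cmod z ^ Suc n * (\<integral>a. cmod (c (Y a)) \<partial>M)" for n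
      unfolding integral_mult_right_zero[symmetric]
    proof (intro integral_mono integrable_norm ui integrable_mult_right ci)
      show "cmod (?u n a) \<le> (real (Suc n) + 1) * cmod z ^ Suc n * cmod (c (Y a))" for a
        unfolding un by (intro mult_right_mono norm_gen_term) simp
    qed (rule L2_integrable[OF c])
    then show "summable (\<lambda>n. \<integral>a. norm (?u n a) \<partial>M)"
      by (intro summable_comparison_test'[OF summable_mult2[OF sS]]) auto
  qed
  also have "\<dots> = (\<Sum>n. 0)"
    unfolding integral_mult_right_zero orth_fibreD[OF kD(5) \<open>c \<in> _\<close> c] by simp
  finally show "(\<integral>a. (gen z a - 1) * c (Y a) \<partial>M) = 0" by simp
qed

text \<open>Two orthogonal decompositions share the part \<open>gen z a - 1\<close>: adding 1 gives
  \<open>gen z a\<close>, and adding \<open>beta z (Y a)\<close> gives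
  \<open>z * char (-1) a * gen z a\<close>. Subtracting the two Pythagoras identities cancels the
  common part. Letting \<open>D\<close> vary takes the place of conditioning on
  \<open>Y\<close>.\<close>

lemma gen_energy:
  assumes z: "cmod z < 1" and D[measurable]: "D \<in> sets borel"
  shows "(1 - (cmod z)\<^sup>2) * L2_sq M (\<lambda>a. indicator D (Y a) * gen z a) =
    measure M {a \<in> space M. Y a \<in> D} - L2_sq M (\<lambda>a. indicator D (Y a) * beta z (Y a))"
proof -
  define d :: "real \<Rightarrow> complex" where "d = indicator D"
  have d[measurable]: "d \<in> borel_measurable borel" unfolding d_def by measurable
  have d1: "cmod (d y) \<le> 1" for y by (simp add: d_def indicator_def)
  note dL = L2_mult_fibre[OF _ d d1]
  have g1L: "(\<lambda>a. gen z a - 1) \<in> L2 M"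
    by (intro L2_diff gen_L2 z L2_bounded[of _ 1]) auto
  have d_L2: "(\<lambda>a. d (Y a)) \<in> L2 M" by (rule L2_fibre_bounded[OF d d1])
  note o = orth_fibre_mult[OF gen_orth[OF z] d d1]
  have "L2_sq M (\<lambda>a. d (Y a) * (gen z a - 1) + d (Y a)) =
      L2_sq M (\<lambda>a. d (Y a) * (gen z a - 1)) + L2_sq M (\<lambda>a. d (Y a))"
    by (rule L2_sq_add_orth[OF dL[OF g1L] d_L2], rule orth_fibreD[OF o _ L2_cnj[OF d_L2]]) measurable
  then have 1: "L2_sq M (\<lambda>a. d (Y a) * gen z a) =
      L2_sq M (\<lambda>a. d (Y a) * (gen z a - 1)) + L2_sq M (\<lambda>a. d (Y a))"
    by (simp add: algebra_simps)
  have "L2_sq M (\<lambda>a. d (Y a) * (gen z a - 1) + d (Y a) * beta z (Y a)) =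
      L2_sq M (\<lambda>a. d (Y a) * (gen z a - 1)) + L2_sq M (\<lambda>a. d (Y a) * beta z (Y a))"
    by (rule L2_sq_add_orth[OF dL[OF g1L] dL[OF beta_L2[OF z]]], rule orth_fibreD[OF o _ L2_cnj[OF dL[OF beta_L2[OF z]]]])
       measurable
  moreover have "cmod (d (Y a) * (gen z a - 1) + d (Y a) * beta z (Y a)) = cmod (z * (d (Y a) * gen z a))" for a
    unfolding gen_step[OF z] by (simp add: algebra_simps norm_mult)
  ultimately have 2: "(cmod z)\<^sup>2 * L2_sq M (\<lambda>a. d (Y a) * gen z a) =
      L2_sq M (\<lambda>a. d (Y a) * (gen z a - 1)) + L2_sq M (\<lambda>a. d (Y a) * beta z (Y a))"
    by (simp only: L2_sq_cmult)
  have "L2_sq M (\<lambda>a. d (Y a)) = (\<integral>a. indicator {a \<in> space M. Y a \<in> D} a \<partial>M)"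
    by (intro Bochner_Integration.integral_cong) (auto simp: d_def indicator_def)
  also have "\<dots> = measure M {a \<in> space M. Y a \<in> D}"
    by simp
  finally show ?thesis using 1 2 unfolding d_def by (simp add: algebra_simps)
qed

lemma gen_energy_le:
  assumes "cmod z < 1" "D \<in> sets borel"
  shows "(1 - (cmod z)\<^sup>2) * L2_sq M (\<lambda>a. indicator D (Y a) * gen z a) \<le> measure M {a \<in> space M. Y a \<in> D}"
proof -
  have "0 \<le> L2_sq M (\<lambda>a. indicator D (Y a) * beta z (Y a))" by (rule Bochner_Integration.integral_nonneg) simp
  then show ?thesis using gen_energy[OF assms] by linarith
qed

text \<open>The left side of \<open>gen_energy\<close> is nonnegative, so over {Y in D} the mean of
  |beta|^2 is at most 1; the test set is the one where this fails pointwise.\<close>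

lemma norm_beta_le:
  assumes z: "cmod z < 1" shows "AE a in M. cmod (beta z (Y a)) \<le> 1"
proof -
  define D where "D = {y. 1 < cmod (beta z y)}"
  have D[measurable]: "D \<in> sets borel" unfolding D_def by measurable
  let ?h = "\<lambda>a. (cmod (indicator D (Y a) * beta z (Y a)))\<^sup>2 - indicator {a \<in> space M. Y a \<in> D} a"
  have bL: "(\<lambda>a. indicator D (Y a) * beta z (Y a)) \<in> L2 M"
    by (rule L2_mult_bounded[OF beta_L2[OF z], where C=1]) (auto simp: indicator_def)
  have Dint: "integrable M (indicator {a \<in> space M. Y a \<in> D} :: 'a \<Rightarrow> real)"
    by (rule integrable_real_indicator) (simp_all add: emeasure_eq_measure)
  have int: "integrable M ?h"
    by (intro Bochner_Integration.integrable_diff L2_sq_integrable bL Dint)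
  have nn: "AE a in M. 0 \<le> ?h a"
    by (rule AE_I2) (auto simp: D_def indicator_def)
  have "0 \<le> (1 - (cmod z)\<^sup>2) * L2_sq M (\<lambda>a. indicator D (Y a) * gen z a)"
    using z by (intro mult_nonneg_nonneg Bochner_Integration.integral_nonneg) (auto simp: power_le_one)
  then have "L2_sq M (\<lambda>a. indicator D (Y a) * beta z (Y a)) \<le> measure M {a \<in> space M. Y a \<in> D}"
    using gen_energy[OF z D] by linarith
  then have "(\<integral>a. ?h a \<partial>M) \<le> 0"
    using L2_sq_integrable[OF bL] Dint by (subst Bochner_Integration.integral_diff) simp_all
  then have "AE a in M. ?h a = 0"
    using integral_nonneg_eq_0_iff_AE[OF int nn] antisym[OF _ Bochner_Integration.integral_nonneg_AE[OF nn]] by blast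
  then show ?thesis
  proof (rule AE_mp, intro AE_I2 impI)
    fix a assume a: "a \<in> space M" "?h a = 0"
    show "cmod (beta z (Y a)) \<le> 1"
    proof (rule ccontr)
      assume n: "\<not> ?thesis"
      then have "Y a \<in> D" by (simp add: D_def)
      with a have "(cmod (beta z (Y a)))\<^sup>2 = 1" by simp
      with n show False by (simp add: power2_eq_1_iff)
    qed
  qed
qed

text \<open>Solving \<open>gen_step\<close> for \<open>gen z a\<close> gives a quotient whose
  numerator \<open>1 - beta z (Y a)\<close> has modulus at most 2; its square is the constant
  4.\<close>

lemma norm_gen_sq_le:
  assumes z: "cmod z < 1"
  shows "AE a in M. (1 - (cmod z)\<^sup>2) * (cmod (gen z a))\<^sup>2 \<le> 4 * ((1 - (cmod z)\<^sup>2) / (cmod (1 - z * char (-1) a))\<^sup>2)"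
  using norm_beta_le[OF z]
proof eventually_elim
  case (elim a)
  have nz: "1 - z * char (-1) a \<noteq> 0"
  proof
    assume "1 - z * char (-1) a = 0"
    then have "cmod (z * char (-1) a) = 1" by simp
    with z show False by (simp add: norm_mult)
  qed
  have "(1 - z * char (-1) a) * gen z a = 1 - beta z (Y a)"
    using gen_step[OF z, of a] by (simp add: algebra_simps)
  then have "cmod (gen z a) = cmod (1 - beta z (Y a)) / cmod (1 - z * char (-1) a)"
    using nz by (metis nonzero_mult_div_cancel_left norm_divide)
  also have "\<dots> \<le> 2 / cmod (1 - z * char (-1) a)"
    using norm_triangle_ineq4[of 1 "beta z (Y a)"] elim by (intro divide_right_mono) auto
  finally have "(cmod (gen z a))\<^sup>2 \<le> (2 / cmod (1 - z * char (-1) a))\<^sup>2"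
    by (intro power_mono) auto
  then have "(1 - (cmod z)\<^sup>2) * (cmod (gen z a))\<^sup>2 \<le> (1 - (cmod z)\<^sup>2) * (2 / cmod (1 - z * char (-1) a))\<^sup>2"
    using z by (intro mult_left_mono) (auto simp: power_le_one)
  then show ?case by (simp add: power_divide mult.commute)
qed

end

section \<open>Averages of the energy over circles of radius r < 1, and the limit as r tends to
  1\<close>

context circle_fibration
begin

lemma pair_sigma_finite_unit: "pair_sigma_finite unit_lebesgue M"
  by (intro pair_sigma_finite.intro U.sigma_finite_measure_axioms sigma_finite_measure_axioms)

text \<open>\<open>K\<close> carries almost all of \<open>M\<close>, and \<open>W\<close> contains its neighbourhood in the horizontal direction, with distances
  measured on the circle because \<open>0\<close> and \<open>1\<close> are identified.\<close>

definition fibres_singular :: bool where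
  "fibres_singular \<longleftrightarrow> (\<forall>\<epsilon>>0. \<exists>K\<in>sets M. \<exists>\<delta>>0. \<exists>W\<in>sets (borel :: (real \<times> real) measure).
     emeasure M (space M - K) \<le> ennreal \<epsilon> \<and>
     (\<integral>\<^sup>+ x. emeasure M {a \<in> space M. (x, Y a) \<in> W} \<partial>unit_lebesgue) \<le> ennreal \<epsilon> \<and>
     (\<forall>a\<in>K. \<forall>x\<in>{0..<1}. cmod (U.char 1 x - char 1 a) < \<delta> \<longrightarrow> (x, Y a) \<in> W))"

end

context unit_kaczmarz
begin

abbreviation zr :: "real \<Rightarrow> real \<Rightarrow> complex" where "zr r x \<equiv> of_real r * U.char 1 x"

text \<open>For fixed \<open>a\<close>, the function of x given by \<open>gen (zr r x) a\<close> has
  Fourier coefficients \<open>r ^ n * t n a\<close>, and Bessel's inequality applies. The integral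
  is taken in \<open>ennreal\<close> with Tonelli in view.\<close>

lemma parseval_lower_bound:
  assumes r: "0 \<le> r" "r < 1"
  shows "ennreal (\<Sum>n<N. (r ^ n)\<^sup>2 * (cmod (t n a))\<^sup>2) \<le> (\<integral>\<^sup>+x. ennreal ((cmod (gen (zr r x) a))\<^sup>2) \<partial>unit_lebesgue)"
proof -
  define c where "c n = of_real r ^ n * t n a" for n
  have cz: "zr r x ^ n * t n a = c n * U.char (int n) x" for n x
    by (simp add: c_def power_mult_distrib U.char_power mult_ac)
  have s: "summable (\<lambda>n. cmod (c n))"
    using summable_gen[of "of_real r" a] r by (simp add: c_def)
  have g: "gen (zr r x) a = (\<Sum>n. c n * U.char (int n) x)" for x
    unfolding gen_def cz ..
  let ?g = "\<lambda>x. \<Sum>n. c n * U.char (int n) x"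
  have "(\<Sum>n<N. (r ^ n)\<^sup>2 * (cmod (t n a))\<^sup>2) = (\<Sum>n<N. (cmod (c n))\<^sup>2)"
    using r by (simp add: c_def norm_mult norm_power power_mult_distrib)
  also have "\<dots> = (\<Sum>n<N. (cmod (fourier_coeff ?g (int n)))\<^sup>2)"
    by (simp only: fourier_coeff_series(2)[OF s])
  also have "\<dots> = (\<Sum>k\<in>int ` {..<N}. (cmod (fourier_coeff ?g k))\<^sup>2)"
    by (simp add: sum.reindex)
  also have "\<dots> \<le> L2_sq unit_lebesgue ?g"
    by (rule bessel[OF fourier_coeff_series(1)[OF s]]) simp
  finally have "ennreal (\<Sum>n<N. (r ^ n)\<^sup>2 * (cmod (t n a))\<^sup>2) \<le> ennreal (L2_sq unit_lebesgue ?g)"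
    by (rule ennreal_leI)
  also have "\<dots> = (\<integral>\<^sup>+x. ennreal ((cmod (?g x))\<^sup>2) \<partial>unit_lebesgue)"
    by (rule nn_integral_eq_integral[symmetric, OF L2_sq_integrable[OF fourier_coeff_series(1)[OF s]]]) simp
  finally show ?thesis unfolding g .
qed

lemma gen_joint_measurable[measurable]:
  "(\<lambda>p. gen (zr r (fst p)) (snd p)) \<in> borel_measurable (unit_lebesgue \<Otimes>\<^sub>M M)"
proof -
  have [measurable]: "(\<lambda>p. U.char 1 (fst p)) \<in> borel_measurable (unit_lebesgue \<Otimes>\<^sub>M M)"
    by (rule measurable_compose[OF measurable_fst U.char_measurable])
  have [measurable]: "(\<lambda>p. t n (snd p)) \<in> borel_measurable (unit_lebesgue \<Otimes>\<^sub>M M)" for n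
    by (rule measurable_compose[OF measurable_snd t_measurable])
  show ?thesis unfolding gen_def by measurable
qed

lemma poisson_joint_measurable[measurable]:
  "(\<lambda>p. (1 - r\<^sup>2) / (cmod (1 - zr r (fst p) * char (-1) (snd p)))\<^sup>2) \<in> borel_measurable (unit_lebesgue \<Otimes>\<^sub>M M)"
proof -
  have [measurable]: "(\<lambda>p. U.char 1 (fst p)) \<in> borel_measurable (unit_lebesgue \<Otimes>\<^sub>M M)"
    by (rule measurable_compose[OF measurable_fst U.char_measurable])
  have [measurable]: "(\<lambda>p. char (-1) (snd p)) \<in> borel_measurable (unit_lebesgue \<Otimes>\<^sub>M M)"
    by (rule measurable_compose[OF measurable_snd char_measurable])
  show ?thesis by measurable
qed

text \<open>The weights (1 - r^2) r^(2n) sum to 1, so the double integral dominates an average of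
  the squared norms of the residuals, none of which is below \<open>L\<close>. Finite sums are
  handled first and \<open>N\<close> is sent to infinity at the end.\<close>

lemma energy_lower_bound:
  assumes r: "0 \<le> r" "r < 1" and L: "0 \<le> L" "\<And>n. L \<le> L2_sq M (t n)"
  shows "ennreal L \<le> (\<integral>\<^sup>+x. \<integral>\<^sup>+a. ennreal ((1 - r\<^sup>2) * (cmod (gen (zr r x) a))\<^sup>2) \<partial>M \<partial>unit_lebesgue)" (is "_ \<le> ?I")
proof -
  interpret P: pair_sigma_finite unit_lebesgue M by (rule pair_sigma_finite_unit)
  have r2: "0 \<le> 1 - r\<^sup>2" "r\<^sup>2 < 1" using r by (auto simp: power_le_one abs_square_less_1)
  have "ennreal (L * (1 - (r\<^sup>2) ^ N)) \<le> ?I" for N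
  proof -
    let ?S = "\<lambda>a. \<Sum>n<N. (r ^ n)\<^sup>2 * (cmod (t n a))\<^sup>2"
    have "1 - (r\<^sup>2) ^ N = (1 - r\<^sup>2) * (\<Sum>n<N. (r ^ n)\<^sup>2)"
      using one_diff_power_eq[of "r\<^sup>2" N] by (simp only: power_mult[symmetric] mult.commute)
    then have "L * (1 - (r\<^sup>2) ^ N) = (1 - r\<^sup>2) * (\<Sum>n<N. (r ^ n)\<^sup>2 * L)"
      by (simp add: sum_distrib_left mult_ac)
    also have "\<dots> \<le> (1 - r\<^sup>2) * (\<Sum>n<N. (r ^ n)\<^sup>2 * L2_sq M (t n))"
      by (intro mult_left_mono sum_mono L r2) simp
    also have "(\<Sum>n<N. (r ^ n)\<^sup>2 * L2_sq M (t n)) = (\<integral>a. ?S a \<partial>M)"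
      using L2_sq_integrable[OF kD(1)] by (subst Bochner_Integration.integral_sum) simp_all
    finally have "ennreal (L * (1 - (r\<^sup>2) ^ N)) \<le> ennreal ((1 - r\<^sup>2) * (\<integral>a. ?S a \<partial>M))"
      by (rule ennreal_leI)
    also have "\<dots> = ennreal (1 - r\<^sup>2) * (\<integral>\<^sup>+a. ennreal (?S a) \<partial>M)"
      using L2_sq_integrable[OF kD(1)] r2
      by (subst nn_integral_eq_integral) (auto intro!: sum_nonneg simp: ennreal_mult')
    also have "\<dots> \<le> ennreal (1 - r\<^sup>2) * (\<integral>\<^sup>+a. \<integral>\<^sup>+x. ennreal ((cmod (gen (zr r x) a))\<^sup>2) \<partial>unit_lebesgue \<partial>M)"
      by (intro mult_left_mono nn_integral_mono parseval_lower_bound r) simp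
    also have "(\<integral>\<^sup>+a. \<integral>\<^sup>+x. ennreal ((cmod (gen (zr r x) a))\<^sup>2) \<partial>unit_lebesgue \<partial>M)
        = (\<integral>\<^sup>+x. \<integral>\<^sup>+a. ennreal ((cmod (gen (zr r x) a))\<^sup>2) \<partial>M \<partial>unit_lebesgue)"
      by (rule P.Fubini'[of "\<lambda>x a. ennreal ((cmod (gen (zr r x) a))\<^sup>2)"])
         (use gen_joint_measurable[of r] in \<open>simp add: case_prod_beta\<close>)
    also have "ennreal (1 - r\<^sup>2) * \<dots> = ?I"
    proof -
      have "(\<lambda>x. \<integral>\<^sup>+a. ennreal ((cmod (gen (zr r x) a))\<^sup>2) \<partial>M) \<in> borel_measurable unit_lebesgue"
        using borel_measurable_nn_integral[of "\<lambda>x a. ennreal ((cmod (gen (zr r x) a))\<^sup>2)" unit_lebesgue]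
          gen_joint_measurable[of r] by (simp add: case_prod_beta)
      then have "ennreal (1 - r\<^sup>2) * (\<integral>\<^sup>+x. \<integral>\<^sup>+a. ennreal ((cmod (gen (zr r x) a))\<^sup>2) \<partial>M \<partial>unit_lebesgue)
          = (\<integral>\<^sup>+x. ennreal (1 - r\<^sup>2) * (\<integral>\<^sup>+a. ennreal ((cmod (gen (zr r x) a))\<^sup>2) \<partial>M) \<partial>unit_lebesgue)"
        by (rule nn_integral_cmult[symmetric])
      also have "\<dots> = (\<integral>\<^sup>+x. \<integral>\<^sup>+a. ennreal (1 - r\<^sup>2) * ennreal ((cmod (gen (zr r x) a))\<^sup>2) \<partial>M \<partial>unit_lebesgue)"
        by (intro nn_integral_cong nn_integral_cmult[symmetric]) simp
      also have "\<dots> = ?I" using r2 by (simp add: ennreal_mult)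
      finally show ?thesis .
    qed
    finally show ?thesis .
  qed
  moreover have "(\<lambda>N. ennreal (L * (1 - (r\<^sup>2) ^ N))) \<longlonglongrightarrow> ennreal (L * (1 - 0))"
    using r2 by (intro tendsto_ennrealI tendsto_intros LIMSEQ_power_zero) auto
  ultimately show ?thesis by (intro LIMSEQ_le_const2) auto
qed

text \<open>The energy over {Y in D} is controlled by the mass of that set alone, uniformly in
  \<open>z\<close>. It is applied to the sections of the small neighbourhood
  \<open>W\<close>.\<close>

lemma energy_on_fibre_set:
  assumes z: "cmod z < 1" and D[measurable]: "D \<in> sets borel"
  shows "(\<integral>\<^sup>+a. indicator D (Y a) * ennreal ((1 - (cmod z)\<^sup>2) * (cmod (gen z a))\<^sup>2) \<partial>M) \<le> emeasure M {a \<in> space M. Y a \<in> D}"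
proof -
  have gL: "(\<lambda>a. indicator D (Y a) * gen z a) \<in> L2 M"
    by (rule L2_mult_bounded[OF gen_L2[OF z], where C=1]) (auto simp: indicator_def)
  have z2: "0 \<le> 1 - (cmod z)\<^sup>2" using z by (simp add: power_le_one)
  have "(\<integral>\<^sup>+a. indicator D (Y a) * ennreal ((1 - (cmod z)\<^sup>2) * (cmod (gen z a))\<^sup>2) \<partial>M) =
      (\<integral>\<^sup>+a. ennreal ((1 - (cmod z)\<^sup>2) * (cmod (indicator D (Y a) * gen z a))\<^sup>2) \<partial>M)"
    by (intro nn_integral_cong) (auto simp: indicator_def)
  also have "\<dots> = ennreal ((1 - (cmod z)\<^sup>2) * L2_sq M (\<lambda>a. indicator D (Y a) * gen z a))"
    unfolding integral_mult_right_zero[symmetric]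
    using L2_sq_integrable[OF gL] z2 by (intro nn_integral_eq_integral) auto
  also have "\<dots> \<le> ennreal (measure M {a \<in> space M. Y a \<in> D})"
    by (intro ennreal_leI gen_energy_le z D)
  finally show ?thesis by (simp add: emeasure_eq_measure)
qed

lemma kaczmarz_one_tendsto:
  assumes fibres_singular
  shows "(\<lambda>n. L2_sq M (t n)) \<longlonglongrightarrow> 0"
proof -
  interpret P: pair_sigma_finite unit_lebesgue M by (rule pair_sigma_finite_unit)
  obtain L where lim: "(\<lambda>n. L2_sq M (t n)) \<longlonglongrightarrow> L" and Ln: "\<And>n. L \<le> L2_sq M (t n)"
    using decseq_convergent[OF kaczmarz_antimono[OF kacz], of 0] by auto
  have L0: "0 \<le> L" by (rule LIMSEQ_le_const[OF lim]) simp
  have "L \<le> 0 + e" if e: "0 < e" for e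
  proof -
    \<comment> \<open>Six shares: four for the points off \<open>K\<close>, where only the Poisson
      bound is available, one for the pairs far apart and one for \<open>W\<close>.\<close>
    define \<epsilon> where "\<epsilon> = e / 6"
    have eps: "0 < \<epsilon>" using e by (simp add: \<epsilon>_def)
    obtain K \<delta> W where K[measurable]: "K \<in> sets M" and \<delta>: "0 < \<delta>" and W[measurable]: "W \<in> sets (borel :: (real \<times> real) measure)"
      and MK: "emeasure M (space M - K) \<le> ennreal \<epsilon>"
      and MW: "(\<integral>\<^sup>+ x. emeasure M {a \<in> space M. (x, Y a) \<in> W} \<partial>unit_lebesgue) \<le> ennreal \<epsilon>"
      and KW: "\<And>a x. a \<in> K \<Longrightarrow> x \<in> {0..<1} \<Longrightarrow> cmod (U.char 1 x - char 1 a) < \<delta> \<Longrightarrow> (x, Y a) \<in> W"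
      using assms[unfolded fibres_singular_def, rule_format, OF eps]
      by (elim bexE exE conjE) (rule that, assumption+, blast)
    \<comment> \<open>\<open>s\<close> will be the distance 1 - r to the circle.
      \<open>\<delta> / 2\<close> keeps the radial point at least that far from distant characters,
      and the last entry solves 4 * 2s / (\<delta>/2)^2 \<le> \<epsilon>.\<close>
    define s where "s = min (1/2) (min (\<delta> / 2) (\<epsilon> * \<delta>\<^sup>2 / 32))"
    have s: "0 < s" "s \<le> 1/2" "s \<le> \<delta> / 2" "s \<le> \<epsilon> * \<delta>\<^sup>2 / 32" using eps \<delta> by (auto simp: s_def)
    define r where "r = 1 - s"
    have r: "0 \<le> r" "r < 1" using s by (auto simp: r_def)
    have r2: "0 \<le> 1 - r\<^sup>2" "1 - r\<^sup>2 \<le> 2 * s"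
      using r by (auto simp: power_le_one r_def power2_eq_square algebra_simps)
    have zr: "cmod (zr r x) = r" for x using r by (simp add: norm_mult)
    let ?G = "\<lambda>x a. ennreal ((1 - r\<^sup>2) * (cmod (gen (zr r x) a))\<^sup>2)"
    let ?P = "\<lambda>x a. ennreal (4 * ((1 - r\<^sup>2) / (cmod (1 - zr r x * char (-1) a))\<^sup>2))"
    have far: "4 * ((1 - r\<^sup>2) / (cmod (1 - zr r x * char (-1) a))\<^sup>2) \<le> \<epsilon>"
      if "\<delta> \<le> cmod (U.char 1 x - char 1 a)" for x a
    proof -
      \<comment> \<open>Rotating by \<open>char 1 a\<close> turns the denominator into the distance
        from \<open>char 1 a\<close> to the radial point \<open>zr r x\<close>.\<close>
      have "cmod (1 - zr r x * char (-1) a) = cmod (char 1 a * (1 - zr r x * char (-1) a))"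
        by (simp add: norm_mult)
      also have "char 1 a * (1 - zr r x * char (-1) a) = char 1 a - zr r x"
        using char_mult[of 1 a "-1"] by (simp add: right_diff_distrib mult.left_commute)
      finally have eq: "cmod (1 - zr r x * char (-1) a) = cmod (char 1 a - zr r x)" .
      have "U.char 1 x - zr r x = of_real s * U.char 1 x" by (simp add: r_def algebra_simps)
      then have "cmod (U.char 1 x - zr r x) = s" using s by (simp add: norm_mult)
      then have "\<delta> - s \<le> cmod (char 1 a - zr r x)"
        using that norm_triangle_ineq4[of "U.char 1 x - zr r x" "char 1 a - zr r x"] by simp
      then have "\<delta> / 2 \<le> cmod (1 - zr r x * char (-1) a)" unfolding eq using s by simp
      then have "(\<delta> / 2)\<^sup>2 \<le> (cmod (1 - zr r x * char (-1) a))\<^sup>2" using \<delta> by (intro power_mono) auto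
      then have "(1 - r\<^sup>2) / (cmod (1 - zr r x * char (-1) a))\<^sup>2 \<le> (2 * s) / (\<delta> / 2)\<^sup>2"
        using r2 \<delta> s by (intro frac_le) auto
      also have "\<dots> \<le> \<epsilon> / 4" using s(4) \<delta> by (simp add: field_simps power2_eq_square)
      finally show ?thesis by linarith
    qed
    have meas[measurable]: "(\<lambda>p. ?G (fst p) (snd p)) \<in> borel_measurable (unit_lebesgue \<Otimes>\<^sub>M M)"
      "(\<lambda>p. ?P (fst p) (snd p)) \<in> borel_measurable (unit_lebesgue \<Otimes>\<^sub>M M)"
      using gen_joint_measurable[of r] poisson_joint_measurable[of r] by measurable
    have id_m[measurable]: "(\<lambda>x. x) \<in> borel_measurable unit_lebesgue" by (rule U.X)
    have Wm: "(\<lambda>p. indicator W (fst p, Y (snd p)) :: ennreal) \<in> borel_measurable (unit_lebesgue \<Otimes>\<^sub>M M)"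
      using id_m by measurable
    have secW: "{y. (x, y) \<in> W} \<in> sets borel" for x
      by measurable
    \<comment> \<open>\<open>?A\<close> pays for points off \<open>K\<close> through the Poisson
      kernel, \<open>?B\<close> for pairs in \<open>W\<close> through the energy itself. The
      remaining pairs have circle distance at least \<delta> and cost at most \<epsilon>.\<close>
    let ?A = "\<lambda>x a. ?P x a * indicator (space M - K) a"
    let ?B = "\<lambda>x a. indicator {y. (x, y) \<in> W} (Y a) * ?G x a"
    have Gx: "(\<integral>\<^sup>+a. ?G x a \<partial>M) \<le> (\<integral>\<^sup>+a. ?A x a \<partial>M) + (ennreal \<epsilon> + emeasure M {a \<in> space M. (x, Y a) \<in> W})"
      if x: "x \<in> space unit_lebesgue" for x
    proof -
      have zx: "cmod (zr r x) < 1" using r zr by simp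
      have [measurable]: "(\<lambda>a. ?P x a) \<in> borel_measurable M" "(\<lambda>a. ?G x a) \<in> borel_measurable M"
        by measurable
      have [measurable]: "(\<lambda>a. indicator {y. (x, y) \<in> W} (Y a) :: ennreal) \<in> borel_measurable M"
        using secW[of x] by measurable
      have "(\<integral>\<^sup>+a. ?G x a \<partial>M) \<le> (\<integral>\<^sup>+a. ?A x a + (ennreal \<epsilon> + ?B x a) \<partial>M)"
      proof (rule nn_integral_mono_AE)
        show "AE a in M. ?G x a \<le> ?A x a + (ennreal \<epsilon> + ?B x a)"
          using norm_gen_sq_le[OF zx] AE_space
        proof eventually_elim
          case (elim a)
          have GP: "?G x a \<le> ?P x a" using elim(1) unfolding zr by (rule ennreal_leI)
          consider "a \<notin> K" | "a \<in> K" "(x, Y a) \<in> W" | "\<delta> \<le> cmod (U.char 1 x - char 1 a)"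
            using KW[of a x] x unfolding space_unit_lebesgue by force
          then show ?case
          proof cases
            case 1
            then have "?A x a = ?P x a" using elim(2) by simp
            then show ?thesis using GP by (simp add: add_increasing2)
          next
            case 2
            then have "?B x a = ?G x a" by simp
            then show ?thesis by (simp add: add_increasing)
          next
            case 3
            then have "?G x a \<le> ennreal \<epsilon>" using GP ennreal_leI[OF far[OF 3]] by (rule_tac order_trans)
            then show ?thesis by (simp add: add_increasing add_increasing2)
          qed
        qed
      qed
      also have "\<dots> = (\<integral>\<^sup>+a. ?A x a \<partial>M) + (ennreal \<epsilon> + (\<integral>\<^sup>+a. ?B x a \<partial>M))"
        by (subst nn_integral_add, measurable, subst nn_integral_add, simp_all add: emeasure_space_1)
      also have "\<dots> \<le> (\<integral>\<^sup>+a. ?A x a \<partial>M) + (ennreal \<epsilon> + emeasure M {a \<in> space M. (x, Y a) \<in> W})"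
        using energy_on_fibre_set[OF zx secW[of x]] unfolding zr by (intro add_left_mono) simp
      finally show ?thesis .
    qed
    have Am: "(\<lambda>p. ?A (fst p) (snd p)) \<in> borel_measurable (unit_lebesgue \<Otimes>\<^sub>M M)"
      by measurable
    have WM: "(\<lambda>x. emeasure M {a \<in> space M. (x, Y a) \<in> W}) \<in> borel_measurable unit_lebesgue"
    proof -
      have "(\<lambda>x. \<integral>\<^sup>+a. indicator W (x, Y a) \<partial>M) \<in> borel_measurable unit_lebesgue"
        using borel_measurable_nn_integral[of "\<lambda>x a. indicator W (x, Y a)" unit_lebesgue] Wm
        by (simp add: case_prod_beta)
      also have "(\<lambda>x. \<integral>\<^sup>+a. indicator W (x, Y a) \<partial>M) = (\<lambda>x. emeasure M {a \<in> space M. (x, Y a) \<in> W})"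
      proof
        fix x
        have "(\<integral>\<^sup>+a. indicator W (x, Y a) \<partial>M) = (\<integral>\<^sup>+a. indicator {a \<in> space M. (x, Y a) \<in> W} a \<partial>M)"
          by (intro nn_integral_cong) (simp add: indicator_def)
        also have "\<dots> = emeasure M {a \<in> space M. (x, Y a) \<in> W}"
          by (rule nn_integral_indicator) (use secW[of x] in measurable)
        finally show "(\<integral>\<^sup>+a. indicator W (x, Y a) \<partial>M) = emeasure M {a \<in> space M. (x, Y a) \<in> W}" .
      qed
      finally show ?thesis .
    qed
    have "ennreal L \<le> (\<integral>\<^sup>+x. \<integral>\<^sup>+a. ?G x a \<partial>M \<partial>unit_lebesgue)"
      by (rule energy_lower_bound[OF r L0 Ln])
    also have "\<dots> \<le> (\<integral>\<^sup>+x. (\<integral>\<^sup>+a. ?A x a \<partial>M) + (ennreal \<epsilon> + emeasure M {a \<in> space M. (x, Y a) \<in> W}) \<partial>unit_lebesgue)"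
      by (rule nn_integral_mono[OF Gx])
    also have "\<dots> = (\<integral>\<^sup>+x. \<integral>\<^sup>+a. ?A x a \<partial>M \<partial>unit_lebesgue) +
        (ennreal \<epsilon> + (\<integral>\<^sup>+x. emeasure M {a \<in> space M. (x, Y a) \<in> W} \<partial>unit_lebesgue))"
    proof -
      have "(\<lambda>x. \<integral>\<^sup>+a. ?A x a \<partial>M) \<in> borel_measurable unit_lebesgue"
        using borel_measurable_nn_integral[of ?A unit_lebesgue] Am by (simp add: case_prod_beta)
      then show ?thesis using WM U.emeasure_space_1 by (simp add: nn_integral_add)
    qed
    also have "(\<integral>\<^sup>+x. \<integral>\<^sup>+a. ?A x a \<partial>M \<partial>unit_lebesgue) = (\<integral>\<^sup>+a. \<integral>\<^sup>+x. ?A x a \<partial>unit_lebesgue \<partial>M)"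
      by (rule P.Fubini'[symmetric]) (use Am in \<open>simp add: case_prod_beta\<close>)
    \<comment> \<open>This is why the integrals were exchanged: for each \<open>a\<close> the kernel
      has mean 1 in x, so the part off \<open>K\<close> costs four times its mass, whatever r
      is.\<close>
    also have "\<dots> = (\<integral>\<^sup>+a. 4 * indicator (space M - K) a \<partial>M)"
    proof (rule nn_integral_cong)
      fix a
      have c: "cmod (char (-1) a) = 1" by simp
      note pk = poisson_kernel_integral[OF r c]
      have "(\<integral>\<^sup>+x. ?P x a \<partial>unit_lebesgue) = ennreal (\<integral>x. 4 * ((1 - r\<^sup>2) / (cmod (1 - zr r x * char (-1) a))\<^sup>2) \<partial>unit_lebesgue)"
        using pk(1) r2 by (intro nn_integral_eq_integral integrable_mult_right) auto
      also have "\<dots> = 4" unfolding integral_mult_right_zero pk(2) by simp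
      finally have "(\<integral>\<^sup>+x. ?P x a \<partial>unit_lebesgue) = 4" .
      then show "(\<integral>\<^sup>+x. ?A x a \<partial>unit_lebesgue) = 4 * indicator (space M - K) a"
        by (simp add: indicator_def)
    qed
    also have "\<dots> = 4 * emeasure M (space M - K)"
      by (simp add: nn_integral_cmult)
    finally have "ennreal L \<le> 4 * ennreal \<epsilon> + (ennreal \<epsilon> + ennreal \<epsilon>)"
      using MK MW by (meson add_mono mult_left_mono order_refl order_trans zero_le)
    also have "\<dots> = ennreal (4 * \<epsilon> + (\<epsilon> + \<epsilon>))"
    proof -
      have "4 * ennreal \<epsilon> = ennreal (4 * \<epsilon>)" using eps by (simp add: ennreal_mult)
      then show ?thesis using eps by (simp only: ennreal_plus mult_nonneg_nonneg less_imp_le zero_le_numeral add_nonneg_nonneg)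
    qed
    finally show ?thesis using eps L0 by (simp add: \<epsilon>_def)
  qed
  then have "L \<le> 0" by (rule field_le_epsilon)
  with L0 lim show ?thesis by simp
qed

end

subsection \<open>Density of trigonometric polynomials\<close>

text \<open>An abstract closed subspace \<open>V\<close>, because density is used twice: for the
  effective functions, and with constant \<open>Y\<close> for the functions whose ordinary Fourier
  series converges. \<open>generated\<close> says that every event is determined by the two
  coordinates.\<close>

locale fibred_subspace = circle_fibration M X Y for M :: "'a measure" and X Y +
  fixes V :: "('a \<Rightarrow> complex) set"
  assumes X_range: "a \<in> space M \<Longrightarrow> X a \<in> {0..<1}"
    and generated: "A \<in> sets M \<Longrightarrow> \<exists>B\<in>sets (borel :: (real \<times> real) measure). A = {a \<in> space M. (X a, Y a) \<in> B}"
    and V_sub: "f \<in> V \<Longrightarrow> f \<in> L2 M"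
    and V_add: "f \<in> V \<Longrightarrow> g \<in> V \<Longrightarrow> (\<lambda>a. f a + g a) \<in> V"
    and V_cmult: "f \<in> V \<Longrightarrow> (\<lambda>a. r * f a) \<in> V"
    and V_closed: "f \<in> L2 M \<Longrightarrow> (\<And>\<epsilon>. 0 < \<epsilon> \<Longrightarrow> \<exists>g\<in>V. L2_sq M (\<lambda>a. f a - g a) < \<epsilon>) \<Longrightarrow> f \<in> V"
    and V_char: "c \<in> borel_measurable borel \<Longrightarrow> (\<And>y. cmod (c y) \<le> C) \<Longrightarrow> (\<lambda>a. char k a * c (Y a)) \<in> V"
begin

lemma V_cong:
  assumes "g \<in> V" "f \<in> borel_measurable M" "\<And>a. a \<in> space M \<Longrightarrow> f a = g a"
  shows "f \<in> V"
proof (rule V_closed)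
  show "f \<in> L2 M"
    by (rule L2_dominated[OF V_sub[OF assms(1)] assms(2), where C=1]) (use assms(3) in auto)
  fix \<epsilon> :: real assume "0 < \<epsilon>"
  moreover have "L2_sq M (\<lambda>a. f a - g a) = (\<integral>a. 0 \<partial>M)"
    by (rule Bochner_Integration.integral_cong) (use assms(3) in auto)
  ultimately show "\<exists>g\<in>V. L2_sq M (\<lambda>a. f a - g a) < \<epsilon>" using assms(1) by (intro bexI[where x=g]) simp_all
qed

lemma V_limit:
  assumes F: "\<And>n. F n \<in> V" and f[measurable]: "f \<in> borel_measurable M" and g: "g \<in> L2 M"
    and le: "\<And>n a. a \<in> space M \<Longrightarrow> cmod (F n a) \<le> cmod (g a)"
    and lim: "\<And>a. a \<in> space M \<Longrightarrow> (\<lambda>n. F n a) \<longlonglongrightarrow> f a"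
  shows "f \<in> V"
proof (rule V_closed)
  have fle: "cmod (f a) \<le> cmod (g a)" if "a \<in> space M" for a
    by (rule LIMSEQ_le_const2[OF tendsto_norm[OF lim[OF that]]]) (use le that in auto)
  show fL: "f \<in> L2 M"
    by (rule L2_dominated[OF g f, where C=1]) (use fle in auto)
  have [measurable]: "F n \<in> borel_measurable M" for n by (rule L2_measurable[OF V_sub[OF F]])
  have "(\<lambda>n. L2_sq M (\<lambda>a. f a - F n a)) \<longlonglongrightarrow> (\<integral>a. 0 \<partial>M)"
  proof (rule integral_dominated_convergence[where w="\<lambda>a. 4 * (cmod (g a))\<^sup>2"])
    show "integrable M (\<lambda>a. 4 * (cmod (g a))\<^sup>2)" using L2_sq_integrable[OF g] by simp
    show "AE a in M. (\<lambda>n. (cmod (f a - F n a))\<^sup>2) \<longlonglongrightarrow> 0"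
    proof (rule AE_I2)
      fix a assume "a \<in> space M"
      then have "(\<lambda>n. (cmod (f a - F n a))\<^sup>2) \<longlonglongrightarrow> (cmod (f a - f a))\<^sup>2"
        by (intro tendsto_intros lim)
      then show "(\<lambda>n. (cmod (f a - F n a))\<^sup>2) \<longlonglongrightarrow> 0" by simp
    qed
    show "AE a in M. norm ((cmod (f a - F n a))\<^sup>2) \<le> 4 * (cmod (g a))\<^sup>2" for n
    proof (rule AE_I2)
      fix a assume a: "a \<in> space M"
      have "cmod (f a - F n a) \<le> 2 * cmod (g a)"
        using norm_triangle_ineq4[of "f a" "F n a"] fle[OF a] le[OF a, of n] by linarith
      then have "(cmod (f a - F n a))\<^sup>2 \<le> (2 * cmod (g a))\<^sup>2" by (intro power_mono) auto
      then show "norm ((cmod (f a - F n a))\<^sup>2) \<le> 4 * (cmod (g a))\<^sup>2" by (simp add: power_mult_distrib)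
    qed
  qed measurable
  then have lim0: "(\<lambda>n. L2_sq M (\<lambda>a. f a - F n a)) \<longlonglongrightarrow> 0" by simp
  fix \<epsilon> :: real assume "0 < \<epsilon>"
  from order_tendstoD(2)[OF lim0 this] obtain n where "L2_sq M (\<lambda>a. f a - F n a) < \<epsilon>"
    by (meson eventually_happens sequentially_bot)
  with F[of n] show "\<exists>g\<in>V. L2_sq M (\<lambda>a. f a - g a) < \<epsilon>" by blast
qed

lemma V_zero: "(\<lambda>a. 0) \<in> V"
  using V_char[of "\<lambda>_. 0" 0 0] by simp

lemma V_sum: "(\<And>i. i \<in> I \<Longrightarrow> F i \<in> V) \<Longrightarrow> (\<lambda>a. \<Sum>i\<in>I. F i a) \<in> V"
proof (induction I rule: infinite_finite_induct)
  case (insert i I)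
  then show ?case using V_add[of "F i" "\<lambda>a. \<Sum>i\<in>I. F i a"] by simp
qed (simp_all add: V_zero)

text \<open>All frequencies \<open>k\<close> and all bounded \<open>c\<close> are quantified inside
  so that the class survives products: multiplication by a linear function of
  \<open>char 1 a\<close> shifts \<open>k\<close> by one in both directions.\<close>

definition multipliers :: "('a \<Rightarrow> complex) set" where
  "multipliers = {h. \<forall>k C c. c \<in> borel_measurable borel \<longrightarrow> (\<forall>y. cmod (c y) \<le> C) \<longrightarrow>
     (\<lambda>a. h a * (char k a * c (Y a))) \<in> V}"

lemma multipliersD:
  assumes "h \<in> multipliers" "c \<in> borel_measurable borel" "\<And>y. cmod (c y) \<le> C"
  shows "(\<lambda>a. h a * (char k a * c (Y a))) \<in> V"
  using assms unfolding multipliers_def by blast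

lemma multipliers_polynomial:
  assumes "real_polynomial_function p"
  shows "h \<in> multipliers \<Longrightarrow> (\<lambda>a. of_real (p (char 1 a)) * h a) \<in> multipliers"
  using assms
proof (induction arbitrary: h)
  case (linear f)
  show ?case unfolding multipliers_def
  proof safe
    fix k C and c :: "real \<Rightarrow> complex"
    assume c: "c \<in> borel_measurable borel" "\<forall>y. cmod (c y) \<le> C"
    interpret f: bounded_linear f by fact
    \<comment> \<open>A real-linear functional on the complex plane is a combination of z and its
      conjugate, and the conjugate of \<open>char 1 a\<close> is \<open>char (-1) a\<close>.\<close>
    define A where "A = (of_real (f 1) - \<i> * of_real (f \<i>)) / 2"
    define B where "B = (of_real (f 1) + \<i> * of_real (f \<i>)) / 2"
    have fz: "of_real (f z) = A * z + B * cnj z" for z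
    proof -
      have "z = Re z *\<^sub>R 1 + Im z *\<^sub>R \<i>" by (simp add: complex_eq_iff)
      then have "f z = Re z * f 1 + Im z * f \<i>" by (metis f.add f.scaleR real_scaleR_def)
      then show ?thesis by (simp add: A_def B_def complex_eq_iff field_simps)
    qed
    have V: "(\<lambda>a. h a * (char j a * c (Y a))) \<in> V" for j
      using linear.prems c unfolding multipliers_def by blast
    have "(\<lambda>a. A * (h a * (char (k + 1) a * c (Y a))) + B * (h a * (char (k - 1) a * c (Y a)))) \<in> V"
      by (intro V_add V_cmult V)
    moreover have "of_real (f (char 1 a)) * h a * (char k a * c (Y a)) =
        A * (h a * (char (k + 1) a * c (Y a))) + B * (h a * (char (k - 1) a * c (Y a)))" for a
    proof -
      have "char (k + 1) a = char 1 a * char k a" "char (k - 1) a = char (-1) a * char k a"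
        by (simp_all add: char_mult add.commute)
      then show ?thesis unfolding fz cnj_char by (simp add: algebra_simps)
    qed
    ultimately show "(\<lambda>a. of_real (f (char 1 a)) * h a * (char k a * c (Y a))) \<in> V" by presburger
  qed
next
  case (const r)
  show ?case unfolding multipliers_def
  proof safe
    fix k C and c :: "real \<Rightarrow> complex"
    assume "c \<in> borel_measurable borel" "\<forall>y. cmod (c y) \<le> C"
    then have "(\<lambda>a. h a * (char k a * c (Y a))) \<in> V"
      using const.prems unfolding multipliers_def by blast
    from V_cmult[OF this, of "of_real r"] show "(\<lambda>a. of_real r * h a * (char k a * c (Y a))) \<in> V"
      by (simp add: mult.assoc)
  qed
next
  case (add f g)
  show ?case unfolding multipliers_def
  proof safe
    fix k C and c :: "real \<Rightarrow> complex"
    assume "c \<in> borel_measurable borel" "\<forall>y. cmod (c y) \<le> C"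
    then have "(\<lambda>a. of_real (f (char 1 a)) * h a * (char k a * c (Y a))) \<in> V"
        "(\<lambda>a. of_real (g (char 1 a)) * h a * (char k a * c (Y a))) \<in> V"
      using add.IH[OF add.prems] unfolding multipliers_def by blast+
    from V_add[OF this] show "(\<lambda>a. of_real (f (char 1 a) + g (char 1 a)) * h a * (char k a * c (Y a))) \<in> V"
      by (simp add: distrib_right)
  qed
next
  case (mult f g)
  \<comment> \<open>As \<open>h\<close> is arbitrary in the induction, a product acts by two
    successive multiplications.\<close>
  show ?case using mult.IH(1)[OF mult.IH(2)[OF mult.prems]] by (simp add: mult.assoc)
qed

lemma V_continuous:
  assumes p: "continuous_on UNIV p" and c[measurable]: "c \<in> borel_measurable borel" and C: "\<And>y. cmod (c y) \<le> C"
  shows "(\<lambda>a. of_real (p (char 1 a)) * c (Y a)) \<in> V"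
proof (rule V_closed)
  have one: "(\<lambda>_. 1) \<in> multipliers"
    unfolding multipliers_def by (simp, blast intro: V_char)
  have pm[measurable]: "p \<in> borel_measurable borel" using p by (rule borel_measurable_continuous_onI)
  have comp: "compact (sphere (0::complex) 1)" by simp
  have "bounded (p ` sphere 0 1)"
    using compact_imp_bounded[OF compact_continuous_image[OF continuous_on_subset[OF p] comp]] by simp
  then obtain B where "\<forall>x\<in>p ` sphere 0 1. norm x \<le> B"
    unfolding bounded_iff by blast
  then have B: "\<bar>p z\<bar> \<le> B" if "z \<in> sphere 0 1" for z
    using that unfolding real_norm_def by blast
  have char_sphere: "char 1 a \<in> sphere 0 1" for a by simp
  have "(\<lambda>a. c (Y a)) \<in> L2 M" by (rule L2_fibre_bounded[OF c C])
  then show "(\<lambda>a. of_real (p (char 1 a)) * c (Y a)) \<in> L2 M"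
    by (rule L2_mult_bounded[where C=B]) (use B[OF char_sphere] in auto)
  fix \<epsilon> :: real assume e: "0 < \<epsilon>"
  have C0: "0 \<le> C" using norm_ge_zero C order_trans by blast
  \<comment> \<open>Chosen so that \<eta> (C + 1) has square \<epsilon>/2; \<open>C + 1\<close>
    avoids division by 0.\<close>
  define \<eta> where "\<eta> = sqrt (\<epsilon> / 2) / (C + 1)"
  have eta: "0 < \<eta>" using e C0 by (simp add: \<eta>_def)
  obtain q where q: "real_polynomial_function q" "\<And>z. z \<in> sphere 0 1 \<Longrightarrow> \<bar>p z - q z\<bar> < \<eta>"
    by (rule Stone_Weierstrass_real_polynomial_function[OF comp continuous_on_subset[OF p] eta]) auto
  have gV: "(\<lambda>a. of_real (q (char 1 a)) * c (Y a)) \<in> V"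
    using multipliersD[OF multipliers_polynomial[OF q(1) one] c C, of 0] by simp
  have "(cmod (of_real (p (char 1 a)) * c (Y a) - of_real (q (char 1 a)) * c (Y a)))\<^sup>2 \<le> \<epsilon> / 2" for a
  proof -
    have "cmod (of_real (p (char 1 a)) * c (Y a) - of_real (q (char 1 a)) * c (Y a)) = \<bar>p (char 1 a) - q (char 1 a)\<bar> * cmod (c (Y a))"
      by (simp add: left_diff_distrib[symmetric] norm_mult of_real_diff[symmetric] del: of_real_diff)
    also have "\<dots> \<le> \<eta> * (C + 1)"
      using q(2)[OF char_sphere[of a]] C[of "Y a"] eta by (intro mult_mono) auto
    also have "\<dots> = sqrt (\<epsilon> / 2)" using C0 by (simp add: \<eta>_def)
    finally have "(cmod (of_real (p (char 1 a)) * c (Y a) - of_real (q (char 1 a)) * c (Y a)))\<^sup>2 \<le> (sqrt (\<epsilon> / 2))\<^sup>2"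
      by (intro power_mono) auto
    then show ?thesis using e by simp
  qed
  then have "L2_sq M (\<lambda>a. of_real (p (char 1 a)) * c (Y a) - of_real (q (char 1 a)) * c (Y a)) \<le> (\<integral>a. \<epsilon> / 2 \<partial>M)"
    using e by (intro integral_mono_AE') auto
  also have "\<dots> < \<epsilon>" using e prob_space by simp
  finally show "\<exists>g\<in>V. L2_sq M (\<lambda>a. of_real (p (char 1 a)) * c (Y a) - g a) < \<epsilon>" by (rule bexI[OF _ gV])
qed

lemma V_closed_set:
  assumes S: "closed S" and c[measurable]: "c \<in> borel_measurable borel" and C: "\<And>y. cmod (c y) \<le> C"
  shows "(\<lambda>a. indicator S (char 1 a) * c (Y a)) \<in> V"
proof (cases "S = {}")
  \<comment> \<open>\<open>infdist\<close> to the empty set is 0 by convention, so the ramps below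
    would all be 1.\<close>
  case True then show ?thesis using V_zero by simp
next
  case False
  \<comment> \<open>For positive \<open>n\<close> a continuous ramp from 1 on \<open>S\<close> down
    to 0 at distance 1/n; these decrease to the indicator because \<open>S\<close> is
    closed.\<close>
  define p where "p n z = max 0 (1 - real n * infdist z S)" for n and z :: complex
  have [measurable]: "S \<in> sets borel" using S by simp
  have p01: "0 \<le> p n z" "p n z \<le> 1" for n z
    by (auto simp: p_def infdist_nonneg)
  have cL: "(\<lambda>a. c (Y a)) \<in> L2 M" by (rule L2_fibre_bounded[OF c C])
  show ?thesis
  proof (rule V_limit[OF _ _ cL])
    show "(\<lambda>a. of_real (p n (char 1 a)) * c (Y a)) \<in> V" for n
      by (rule V_continuous[OF _ c C]) (unfold p_def, intro continuous_intros)
    show "cmod (of_real (p n (char 1 a)) * c (Y a)) \<le> cmod (c (Y a))" for n a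
      using p01[of n "char 1 a"] by (simp add: norm_mult mult_left_le_one_le)
    have "(\<lambda>n. p n z) \<longlonglongrightarrow> indicator S z" for z
    proof (cases "z \<in> S")
      case True
      then show ?thesis by (simp add: p_def)
    next
      case False
      then have "0 < infdist z S" using S \<open>S \<noteq> {}\<close> infdist_pos_not_in_closed by blast
      then obtain N where N: "1 < real N * infdist z S" using reals_Archimedean3 by blast
      have "p n z = 0" if "n \<ge> N" for n
      proof -
        have "real N * infdist z S \<le> real n * infdist z S" using that infdist_nonneg by (intro mult_right_mono) auto
        with N show ?thesis by (simp add: p_def)
      qed
      then have "\<forall>\<^sub>F n in sequentially. p n z = 0" by (auto simp: eventually_sequentially)
      then show ?thesis using False by (simp add: tendsto_eventually)
    qed
    then have "(\<lambda>n. of_real (p n (char 1 a)) * c (Y a)) \<longlonglongrightarrow> of_real (indicator S (char 1 a)) * c (Y a)" for a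
      by (intro tendsto_intros)
    then show "(\<lambda>n. of_real (p n (char 1 a)) * c (Y a)) \<longlonglongrightarrow> indicator S (char 1 a) * c (Y a)" for a
      by (simp add: of_real_indicator)
  qed measurable
qed

text \<open>The free map \<open>q\<close> and weight \<open>f\<close> make this serve both Dynkin
  arguments below, on the circle and on the circle times the line.\<close>

lemma V_disjoint_union:
  assumes A: "\<And>i. (\<lambda>a. indicator (A i) (q a) * f a) \<in> V" and disj: "disjoint_family A" and f: "f \<in> L2 M"
  shows "(\<lambda>a. indicator (\<Union>i::nat. A i) (q a) * f a) \<in> V"
proof (rule V_limit[OF _ _ f])
  have eq: "(\<Sum>i<n. indicator (A i) (q a) * f a) = indicator (\<Union>i<n. A i) (q a) * f a" for n a
    using disj by (subst indicator_UN_disjoint) (auto simp: sum_distrib_right disjoint_family_on_def)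
  show "(\<lambda>a. indicator (\<Union>i<n. A i) (q a) * f a) \<in> V" for n
    unfolding eq[symmetric] by (intro V_sum A)
  show "cmod (indicator (\<Union>i<n. A i) (q a) * f a) \<le> cmod (f a)" for n a
    by (simp add: indicator_def)
  show lim: "(\<lambda>n. indicator (\<Union>i<n. A i) (q a) * f a) \<longlonglongrightarrow> indicator (\<Union>i. A i) (q a) * f a" for a
    by (intro tendsto_mult_right LIMSEQ_indicator_UN)
  show "(\<lambda>a. indicator (\<Union>i. A i) (q a) * f a) \<in> borel_measurable M"
  proof (rule borel_measurable_LIMSEQ_metric[OF _ lim])
    show "(\<lambda>a. indicator (\<Union>i<n. A i) (q a) * f a) \<in> borel_measurable M" for n
      unfolding eq[symmetric] by (intro L2_measurable[OF V_sub] V_sum A)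
  qed
qed

lemma V_compl:
  assumes "(\<lambda>a. indicator A (q a) * f a) \<in> V" "f \<in> V"
  shows "(\<lambda>a. indicator (- A) (q a) * f a) \<in> V"
proof -
  have "indicator (- A) (q a) * f a = f a + (-1) * (indicator A (q a) * f a)" for a
    by (simp add: indicator_def)
  then show ?thesis using V_add[OF assms(2) V_cmult[OF assms(1), of "-1"]] by presburger
qed

lemma V_fibre: "c \<in> borel_measurable borel \<Longrightarrow> (\<And>y. cmod (c y) \<le> C) \<Longrightarrow> (\<lambda>a. c (Y a)) \<in> V"
  using V_char[of c C 0] by simp

text \<open>Dynkin's lemma from the closed sets, which are stable under intersection.\<close>

lemma V_borel_circle:
  assumes S: "S \<in> sets borel" and c[measurable]: "c \<in> borel_measurable borel" and C: "\<And>y. cmod (c y) \<le> C"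
  shows "(\<lambda>a. indicator S (char 1 a) * c (Y a)) \<in> V"
proof -
  have cV: "(\<lambda>a. c (Y a)) \<in> V" by (rule V_fibre[OF c C])
  have "S \<in> sigma_sets UNIV (Collect closed)" using S by (simp add: borel_eq_closed)
  have Int: "Int_stable (Collect (closed :: complex set \<Rightarrow> bool))" by (auto simp: Int_stable_def)
  then show ?thesis using subset_UNIV[of "Collect closed", folded Pow_UNIV] \<open>S \<in> sigma_sets UNIV (Collect closed)\<close>
  proof (induction rule: sigma_sets_induct_disjoint)
    fix A assume "(\<lambda>a. indicator A (char 1 a) * c (Y a)) \<in> V"
    then show "(\<lambda>a. indicator (UNIV - A) (char 1 a) * c (Y a)) \<in> V"
      using V_compl cV by (simp add: Compl_eq_Diff_UNIV)
  next
    fix A :: "nat \<Rightarrow> complex set"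
    assume "disjoint_family A" "\<And>i. (\<lambda>a. indicator (A i) (char 1 a) * c (Y a)) \<in> V"
    then show "(\<lambda>a. indicator (\<Union>i. A i) (char 1 a) * c (Y a)) \<in> V"
      by (intro V_disjoint_union V_sub[OF cV])
  qed (use V_closed_set[OF _ c C] V_zero in auto)
qed

text \<open>Dynkin's lemma from the measurable rectangles, where the preceding lemma applies with
  \<open>c\<close> an indicator.\<close>

lemma V_borel_pair:
  assumes B: "B \<in> sets (borel :: (complex \<times> real) measure)"
  shows "(\<lambda>a. indicator B (char 1 a, Y a)) \<in> V"
proof -
  have 1: "(\<lambda>_. 1) \<in> V" using V_fibre[of "\<lambda>_. 1" 1] by simp
  let ?G = "{A \<times> D | A D. A \<in> sets (borel :: complex measure) \<and> D \<in> sets (borel :: real measure)}"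
  have "B \<in> sigma_sets UNIV ?G"
    using B unfolding borel_prod[symmetric] sets_pair_measure by simp
  with Int_stable_pair_measure_generator subset_UNIV[of ?G, folded Pow_UNIV]
  have "(\<lambda>a. indicator B (char 1 a, Y a) * 1) \<in> V"
  proof (induction rule: sigma_sets_induct_disjoint)
    fix A assume "A \<in> ?G"
    then obtain S D where S: "A = S \<times> D" "S \<in> sets borel" "D \<in> sets borel" by blast
    have "(\<lambda>a. indicator S (char 1 a) * indicator D (Y a)) \<in> V"
      by (rule V_borel_circle[OF S(2), where C=1]) (use S(3) in \<open>auto simp: indicator_def\<close>)
    then show "(\<lambda>a. indicator A (char 1 a, Y a) * 1) \<in> V"
      unfolding S(1) by (simp add: indicator_times)
  next
    fix A :: "(complex \<times> real) set" assume "(\<lambda>a. indicator A (char 1 a, Y a) * 1) \<in> V"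
    from V_compl[OF this 1] show "(\<lambda>a. indicator (UNIV - A) (char 1 a, Y a) * 1) \<in> V"
      by (simp add: Compl_eq_Diff_UNIV)
  next
    fix A :: "nat \<Rightarrow> (complex \<times> real) set"
    assume "disjoint_family A" "\<And>i. (\<lambda>a. indicator (A i) (char 1 a, Y a) * 1) \<in> V"
    then show "(\<lambda>a. indicator (\<Union>i. A i) (char 1 a, Y a) * 1) \<in> V"
      by (intro V_disjoint_union V_sub[OF 1])
  qed (use V_zero in auto)
  then show ?thesis by simp
qed

text \<open>The half-open range of \<open>X\<close> makes the passage to the circle injective. The
  Borel inverse \<open>Arg2pi\<close> turns events in (X, Y) into events in the circle point and
  \<open>Y\<close>, where polynomial approximation works.\<close>

lemma Arg2pi_char: "a \<in> space M \<Longrightarrow> Arg2pi (char 1 a) / (2 * pi) = X a"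
proof -
  assume a: "a \<in> space M"
  have "Arg2pi (char 1 a) = 2 * pi * X a"
    using X_range[OF a] by (intro Arg2pi_unique[of 1]) (auto simp: char_def cis_conv_exp)
  then show ?thesis by simp
qed

lemma V_indicator:
  assumes A: "A \<in> sets M" shows "indicator A \<in> V"
proof -
  obtain B where B: "B \<in> sets (borel :: (real \<times> real) measure)" "A = {a \<in> space M. (X a, Y a) \<in> B}"
    using generated[OF A] by blast
  have "Arg2pi \<in> borel_measurable borel"
  proof (rule borel_measurableI_le)
    show "{z \<in> space borel. Arg2pi z \<le> t} \<in> sets borel" for t
      using borel_closed[OF closed_Arg2pi2pi_le] by simp
  qed
  then have "(\<lambda>p. (Arg2pi (fst p) / (2 * pi), snd p)) \<in> borel_measurable (borel :: (complex \<times> real) measure)"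
    unfolding borel_prod[symmetric] by measurable
  from measurable_sets[OF this B(1)] have "{p. (Arg2pi (fst p) / (2 * pi), snd p) \<in> B} \<in> sets borel"
    by (simp add: vimage_def)
  from V_borel_pair[OF this] show ?thesis
    by (rule V_cong) (use A Arg2pi_char in \<open>auto simp: B(2) indicator_def\<close>)
qed

lemma V_eq_L2: assumes f: "f \<in> L2 M" shows "f \<in> V"
proof -
  have fm: "f \<in> borel_measurable M" by (rule L2_measurable[OF f])
  obtain F where F': "\<forall>n. simple_function M (F n)" "\<forall>a\<in>space M. (\<lambda>n. F n a) \<longlonglongrightarrow> f a"
    "\<forall>n. \<forall>a\<in>space M. dist (F n a) 0 \<le> 2 * dist (f a) 0"
    using borel_measurable_implies_sequence_metric[OF fm, of 0] by blast
  have F: "simple_function M (F n)" for n using F'(1) by blast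
  have FV: "F n \<in> V" for n
  proof (rule V_cong)
    show "(\<lambda>a. \<Sum>y\<in>F n ` space M. y * indicator (F n -` {y} \<inter> space M) a) \<in> V"
      using F[of n] by (intro V_sum V_cmult V_indicator) (auto simp: simple_function_def)
    show "F n \<in> borel_measurable M" by (rule borel_measurable_simple_function[OF F])
    fix a assume a: "a \<in> space M"
    have "(\<Sum>y\<in>F n ` space M. y * indicator (F n -` {y} \<inter> space M) a) = (\<Sum>y\<in>F n ` space M. if y = F n a then F n a else 0)"
      by (intro sum.cong) (use a in \<open>auto simp: indicator_def\<close>)
    also have "\<dots> = F n a" using a F[of n] by (simp add: simple_function_def)
    finally show "F n a = (\<Sum>y\<in>F n ` space M. y * indicator (F n -` {y} \<inter> space M) a)" ..
  qed
  show ?thesis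
  proof (rule V_limit)
    show "F n \<in> V" for n by (rule FV)
    show "(\<lambda>a. 2 * f a) \<in> L2 M" by (rule L2_cmult[OF f])
    show "cmod (F n a) \<le> cmod (2 * f a)" if "a \<in> space M" for n a
      using F'(3) that by (simp add: norm_mult)
    show "(\<lambda>n. F n a) \<longlonglongrightarrow> f a" if "a \<in> space M" for a
      using F'(2) that by blast
  qed (rule fm)
qed

end

subsection \<open>Effectiveness of the Kaczmarz iteration\<close>

lemma L2_sq_tendsto_zeroI:
  assumes "\<And>n. L2_sq M (F n) \<le> g n" "(g \<longlongrightarrow> 0) net"
  shows "((\<lambda>n. L2_sq M (F n)) \<longlongrightarrow> 0) net"
proof (rule tendsto_sandwich[OF _ _ tendsto_const assms(2)])
  show "\<forall>\<^sub>F n in net. 0 \<le> L2_sq M (F n)" by simp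
  show "\<forall>\<^sub>F n in net. L2_sq M (F n) \<le> g n" by (intro always_eventually allI assms(1))
qed

context circle_fibration
begin

text \<open>The difference of two runs is a run, and norms decrease along runs. So residuals depend
  continuously on the start and, up to null sets, not on the choice of coefficients.\<close>

lemma kaczmarz_contraction:
  assumes "kaczmarz t b" "kaczmarz t' b'"
  shows "L2_sq M (\<lambda>a. t n a - t' n a) \<le> L2_sq M (\<lambda>a. t 0 a - t' 0 a)"
proof -
  have "kaczmarz (\<lambda>n a. -1 * t' n a) (\<lambda>n y. -1 * b' n y)"
    using kaczmarz_mult[OF assms(2), of "\<lambda>_. -1" 1] by simp
  from kaczmarz_antimono[OF kaczmarz_add[OF assms(1) this]] show ?thesis
    by (simp add: decseq_def)
qed

lemma kaczmarz_Cons: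
  assumes f: "f \<in> L2 M" and b: "b0 \<in> borel_measurable borel" "(\<lambda>a. b0 (Y a)) \<in> L2 M"
    and o: "orth_fibre M Y (t 0)" and t0: "t 0 = (\<lambda>a. char (-1) a * f a - b0 (Y a))" and k: "kaczmarz t b"
  shows "kaczmarz (case_nat f t) (case_nat b0 b)"
  unfolding kaczmarz_def
proof
  fix n
  show "case_nat f t n \<in> L2 M \<and> case_nat b0 b n \<in> borel_measurable borel \<and> (\<lambda>a. case_nat b0 b n (Y a)) \<in> L2 M \<and>
     case_nat f t (Suc n) = (\<lambda>a. char (-1) a * case_nat f t n a - case_nat b0 b n (Y a)) \<and> orth_fibre M Y (case_nat f t (Suc n))"
  proof (cases n)
    case 0
    then show ?thesis using f b o t0 by simp
  next
    case (Suc m)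
    show ?thesis unfolding Suc nat.case by (rule k[unfolded kaczmarz_def, THEN spec])
  qed
qed

text \<open>All runs from \<open>f\<close> are demanded because the coefficients are a choice; by
  \<open>effectiveI\<close> a single convergent run is enough.\<close>

definition effective :: "('a \<Rightarrow> complex) set" where
  "effective = {f \<in> L2 M. \<forall>t b. kaczmarz t b \<longrightarrow> t 0 = f \<longrightarrow> (\<lambda>n. L2_sq M (t n)) \<longlonglongrightarrow> 0}"

text \<open>The gap to a nearby run never grows, so a nearby run tending to 0 takes this one below
  any bound. A nearby run with the same start yields \<open>effectiveI\<close>; one with a nearby
  start yields closedness.\<close>

lemma effective_approx:
  assumes f: "f \<in> L2 M"
    and approx: "\<And>\<epsilon>. 0 < \<epsilon> \<Longrightarrow> \<exists>t b. kaczmarz t b \<and> L2_sq M (\<lambda>a. f a - t 0 a) < \<epsilon> \<and> (\<lambda>n. L2_sq M (t n)) \<longlonglongrightarrow> 0"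
  shows "f \<in> effective"
  unfolding effective_def
proof (rule CollectI, rule conjI[OF f], intro allI impI)
  fix t b assume t: "kaczmarz t b" "t 0 = f"
  show "(\<lambda>n. L2_sq M (t n)) \<longlonglongrightarrow> 0"
  proof (rule order_tendstoI)
    fix \<epsilon> :: real assume e: "0 < \<epsilon>"
    then obtain t' b' where t': "kaczmarz t' b'" "L2_sq M (\<lambda>a. f a - t' 0 a) < \<epsilon> / 4" "(\<lambda>n. L2_sq M (t' n)) \<longlonglongrightarrow> 0"
      using approx[of "\<epsilon> / 4"] by auto
    have "\<forall>\<^sub>F n in sequentially. L2_sq M (t' n) < \<epsilon> / 4"
      by (rule order_tendstoD(2)[OF t'(3)]) (use e in simp)
    then show "\<forall>\<^sub>F n in sequentially. L2_sq M (t n) < \<epsilon>"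
    proof eventually_elim
      case (elim n)
      note L = kaczmarzD(1)[OF t(1), of n] kaczmarzD(1)[OF t'(1), of n]
      have "L2_sq M (t n) \<le> 2 * L2_sq M (\<lambda>a. t n a - t' n a) + 2 * L2_sq M (t' n)"
        using L2_sq_add_le[OF L2_diff[OF L] L(2)] by simp
      also have "L2_sq M (\<lambda>a. t n a - t' n a) \<le> L2_sq M (\<lambda>a. f a - t' 0 a)"
        using kaczmarz_contraction[OF t(1) t'(1), of n] t(2) by simp
      finally show ?case using elim t'(2) by simp
    qed
  next
    fix \<epsilon> :: real assume "\<epsilon> < 0"
    moreover have "0 \<le> L2_sq M (t n)" for n by simp
    ultimately show "\<forall>\<^sub>F n in sequentially. \<epsilon> < L2_sq M (t n)"
      by (intro always_eventually allI) (rule less_le_trans)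
  qed
qed

lemma effectiveI:
  assumes "kaczmarz t b" "(\<lambda>n. L2_sq M (t n)) \<longlonglongrightarrow> 0"
  shows "t 0 \<in> effective"
  by (rule effective_approx[OF kaczmarzD(1)[OF assms(1)]]) (use assms in auto)

lemma effectiveD: "f \<in> effective \<Longrightarrow> kaczmarz t b \<Longrightarrow> t 0 = f \<Longrightarrow> (\<lambda>n. L2_sq M (t n)) \<longlonglongrightarrow> 0"
  unfolding effective_def by blast

lemma effective_L2: "f \<in> effective \<Longrightarrow> f \<in> L2 M"
  by (simp add: effective_def)

lemma effective_kaczmarz:
  assumes "f \<in> effective"
  obtains t b where "kaczmarz t b" "t 0 = f" "(\<lambda>n. L2_sq M (t n)) \<longlonglongrightarrow> 0"
proof -
  obtain t b where t: "kaczmarz t b" "t 0 = f"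
    by (rule kaczmarz_exists[OF effective_L2[OF assms]])
  then show thesis using effectiveD[OF assms t] that by blast
qed

lemma effective_add:
  assumes "f \<in> effective" "g \<in> effective" shows "(\<lambda>a. f a + g a) \<in> effective"
proof -
  obtain t b where t: "kaczmarz t b" "t 0 = f" "(\<lambda>n. L2_sq M (t n)) \<longlonglongrightarrow> 0"
    by (rule effective_kaczmarz[OF assms(1)])
  obtain t' b' where t': "kaczmarz t' b'" "t' 0 = g" "(\<lambda>n. L2_sq M (t' n)) \<longlonglongrightarrow> 0"
    by (rule effective_kaczmarz[OF assms(2)])
  have "(\<lambda>n. 2 * L2_sq M (t n) + 2 * L2_sq M (t' n)) \<longlonglongrightarrow> 2 * 0 + 2 * 0"
    by (intro tendsto_intros t t')
  then have "(\<lambda>n. 2 * L2_sq M (t n) + 2 * L2_sq M (t' n)) \<longlonglongrightarrow> 0" by simp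
  then have "(\<lambda>n. L2_sq M (\<lambda>a. t n a + t' n a)) \<longlonglongrightarrow> 0"
    by (rule L2_sq_tendsto_zeroI[rotated]) (rule L2_sq_add_le[OF kaczmarzD(1)[OF t(1)] kaczmarzD(1)[OF t'(1)]])
  from effectiveI[OF kaczmarz_add[OF t(1) t'(1)] this] show ?thesis by (simp add: t(2) t'(2))
qed

lemma effective_mult:
  assumes f: "f \<in> effective" and c: "c \<in> borel_measurable borel" "\<And>y. cmod (c y) \<le> C"
  shows "(\<lambda>a. c (Y a) * f a) \<in> effective"
proof -
  obtain t b where t: "kaczmarz t b" "t 0 = f" "(\<lambda>n. L2_sq M (t n)) \<longlonglongrightarrow> 0"
    by (rule effective_kaczmarz[OF f])
  have le: "L2_sq M (\<lambda>a. c (Y a) * t n a) \<le> C\<^sup>2 * L2_sq M (t n)" for n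
    by (rule L2_sq_mono[OF _ L2_mult_fibre[OF _ c]])
       (use kaczmarzD(1)[OF t(1)] c(2) in \<open>auto simp: norm_mult intro!: mult_right_mono\<close>)
  have "(\<lambda>n. C\<^sup>2 * L2_sq M (t n)) \<longlonglongrightarrow> C\<^sup>2 * 0"
    by (intro tendsto_intros t)
  then have "(\<lambda>n. C\<^sup>2 * L2_sq M (t n)) \<longlonglongrightarrow> 0" by simp
  then have "(\<lambda>n. L2_sq M (\<lambda>a. c (Y a) * t n a)) \<longlonglongrightarrow> 0"
    by (rule L2_sq_tendsto_zeroI[OF le])
  from effectiveI[OF kaczmarz_mult[OF t(1) c] this] show ?thesis by (simp add: t(2))
qed

lemma effective_closed:
  assumes f: "f \<in> L2 M" and "\<And>\<epsilon>. 0 < \<epsilon> \<Longrightarrow> \<exists>g\<in>effective. L2_sq M (\<lambda>a. f a - g a) < \<epsilon>"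
  shows "f \<in> effective"
proof (rule effective_approx[OF f])
  fix \<epsilon> :: real assume "0 < \<epsilon>"
  then obtain g where g: "g \<in> effective" "L2_sq M (\<lambda>a. f a - g a) < \<epsilon>" using assms(2) by blast
  obtain t b where "kaczmarz t b" "t 0 = g" "(\<lambda>n. L2_sq M (t n)) \<longlonglongrightarrow> 0"
    by (rule effective_kaczmarz[OF g(1)])
  with g(2) show "\<exists>t b. kaczmarz t b \<and> L2_sq M (\<lambda>a. f a - t 0 a) < \<epsilon> \<and> (\<lambda>n. L2_sq M (t n)) \<longlonglongrightarrow> 0"
    by auto
qed

text \<open>The iteration for \<open>f\<close> continues as the iteration for its first iterate, so both converge or neither does.
  This moves effectiveness from one frequency to the next, in both directions.\<close>

lemma effective_step:
  assumes f: "f \<in> L2 M" and b: "b0 \<in> borel_measurable borel" "(\<lambda>a. b0 (Y a)) \<in> L2 M"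
    and o: "orth_fibre M Y (\<lambda>a. char (-1) a * f a - b0 (Y a))"
  shows "f \<in> effective \<longleftrightarrow> (\<lambda>a. char (-1) a * f a - b0 (Y a)) \<in> effective"
proof -
  have "(\<lambda>a. char (-1) a * f a - b0 (Y a)) \<in> L2 M" by (intro L2_diff L2_char f b)
  then obtain t b where t: "kaczmarz t b" "t 0 = (\<lambda>a. char (-1) a * f a - b0 (Y a))"
    by (rule kaczmarz_exists)
  have c: "kaczmarz (case_nat f t) (case_nat b0 b)"
    by (rule kaczmarz_Cons[OF f assms(2,3) _ t(2,1)]) (simp only: t(2) o)
  have s: "(\<lambda>n. L2_sq M (case_nat f t n)) \<longlonglongrightarrow> 0 \<longleftrightarrow> (\<lambda>n. L2_sq M (t n)) \<longlonglongrightarrow> 0"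
    using filterlim_sequentially_Suc[of "\<lambda>n. L2_sq M (case_nat f t n)" "nhds 0"] by simp
  show ?thesis
  proof
    assume "f \<in> effective"
    from effectiveD[OF this c] have "(\<lambda>n. L2_sq M (t n)) \<longlonglongrightarrow> 0" using s by simp
    from effectiveI[OF t(1) this] show "(\<lambda>a. char (-1) a * f a - b0 (Y a)) \<in> effective" by (simp only: t(2))
  next
    assume "(\<lambda>a. char (-1) a * f a - b0 (Y a)) \<in> effective"
    from effectiveD[OF this t] have "(\<lambda>n. L2_sq M (case_nat f t n)) \<longlonglongrightarrow> 0" using s by simp
    from effectiveI[OF c this] show "f \<in> effective" by simp
  qed
qed

lemma effective_fibre:
  assumes sing: fibres_singular and c: "c \<in> borel_measurable borel" "\<And>y. cmod (c y) \<le> C"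
  shows "(\<lambda>a. c (Y a)) \<in> effective"
proof -
  obtain t b where t: "kaczmarz t b" "t 0 = (\<lambda>_. 1)" "\<And>n y. cmod (b n y) \<le> 1"
    by (rule kaczmarz_one) blast
  then interpret unit_kaczmarz M X Y t b by unfold_locales
  have "t 0 \<in> effective" by (rule effectiveI[OF t(1) kaczmarz_one_tendsto[OF sing]])
  from effective_mult[OF this c] show ?thesis by (simp add: t(2))
qed

text \<open>The first residual of frequency \<open>k + 1\<close> is frequency \<open>k\<close> minus
  its projection. That projection is a bounded function of \<open>Y\<close>, hence effective itself,
  and may be added or dropped.\<close>

lemma effective_char_step:
  assumes sing: fibres_singular and c[measurable]: "c \<in> borel_measurable borel" and C: "\<And>y. cmod (c y) \<le> C"
  shows "(\<lambda>a. char (k + 1) a * c (Y a)) \<in> effective \<longleftrightarrow> (\<lambda>a. char k a * c (Y a)) \<in> effective"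
proof -
  let ?f = "\<lambda>k a. char k a * c (Y a)"
  have C0: "0 \<le> C" using norm_ge_zero C order_trans by blast
  have fL: "?f k \<in> L2 M" for k by (rule L2_char[OF L2_fibre_bounded[OF c C]])
  obtain b where b: "b \<in> borel_measurable borel" "\<And>y. cmod (b y) \<le> C" "orth_fibre M Y (\<lambda>a. ?f k a - b (Y a))"
  proof (rule fibre_projection_bounded[OF fL C0])
    fix D :: "real set" assume [measurable]: "D \<in> sets borel"
    have "L2_sq M (\<lambda>a. indicator D (Y a) * ?f k a) \<le> (\<integral>a. C\<^sup>2 * indicator D (Y a) \<partial>M)"
    proof (rule integral_mono')
      show "integrable M (\<lambda>a. C\<^sup>2 * indicator D (Y a))"
        by (rule integrable_const_bound[where B="C\<^sup>2"]) (auto simp: indicator_def)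
      show "(cmod (indicator D (Y a) * ?f k a))\<^sup>2 \<le> C\<^sup>2 * indicator D (Y a)" for a
        using power_mono[OF C[of "Y a"], of 2] by (simp add: norm_mult indicator_def)
    qed simp
    then show "L2_sq M (\<lambda>a. indicator D (Y a) * ?f k a) \<le> C\<^sup>2 * (\<integral>a. indicator D (Y a) \<partial>M)"
      by simp
  qed blast
  have f: "char (-1) a * ?f (k + 1) a = ?f k a" for a by (simp add: char_mult_assoc)
  have bE: "(\<lambda>a. b (Y a)) \<in> effective" by (rule effective_fibre[OF sing b(1,2)])
  have bE': "(\<lambda>a. - b (Y a)) \<in> effective"
    using effective_mult[OF bE, of "\<lambda>_. -1" 1] by simp
  have "?f (k + 1) \<in> effective \<longleftrightarrow> (\<lambda>a. char (-1) a * ?f (k + 1) a - b (Y a)) \<in> effective"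
    by (rule effective_step[OF fL b(1) effective_L2[OF bE]]) (simp only: f b(3))
  also have "\<dots> \<longleftrightarrow> (\<lambda>a. ?f k a - b (Y a)) \<in> effective" by (simp only: f)
  also have "\<dots> \<longleftrightarrow> ?f k \<in> effective"
    using effective_add[OF _ bE, of "\<lambda>a. ?f k a - b (Y a)"] effective_add[OF _ bE', of "?f k"] by auto
  finally show ?thesis .
qed

lemma effective_char:
  assumes sing: fibres_singular and c: "c \<in> borel_measurable borel" "\<And>y. cmod (c y) \<le> C"
  shows "(\<lambda>a. char k a * c (Y a)) \<in> effective"
proof (induction k rule: int_induct[where k=0])
  case base
  show ?case using effective_fibre[OF sing c] by simp
next
  case (step1 k)
  then show ?case using effective_char_step[OF sing c] by blast
next
  case (step2 k)
  then show ?case using effective_char_step[OF sing c, of "k - 1"] by simp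
qed

lemma kaczmarz_expansion:
  assumes sing: fibres_singular and X_range: "\<And>a. a \<in> space M \<Longrightarrow> X a \<in> {0..<1}"
    and generated: "\<And>A. A \<in> sets M \<Longrightarrow> \<exists>B\<in>sets (borel :: (real \<times> real) measure). A = {a \<in> space M. (X a, Y a) \<in> B}"
    and f: "f \<in> L2 M"
  obtains b where "\<And>n. b n \<in> borel_measurable borel" "\<And>n. (\<lambda>a. b n (Y a)) \<in> L2 M"
    "(\<lambda>n. L2_sq M (\<lambda>a. (\<Sum>k<n. char (int k + 1) a * b k (Y a)) - f a)) \<longlonglongrightarrow> 0"
proof -
  interpret fibred_subspace M X Y effective
  proof (unfold_locales, fact X_range, fact generated)
    show "(\<lambda>a. r * f a) \<in> effective" if "f \<in> effective" for f r
      using effective_mult[OF that, of "\<lambda>_. r" "cmod r"] by simp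
  qed (use effective_L2 effective_add effective_closed effective_char[OF sing] in blast)+
  obtain t b where t: "kaczmarz t b" "t 0 = f" "(\<lambda>n. L2_sq M (t n)) \<longlonglongrightarrow> 0"
    by (rule effective_kaczmarz[OF V_eq_L2[OF f]])
  show thesis
    by (rule that[of b], fact kaczmarzD(2)[OF t(1)], fact kaczmarzD(3)[OF t(1)])
       (use t(3) in \<open>simp only: kaczmarz_residual_norm[OF t(1), unfolded t(2)]\<close>)
qed

end

subsection \<open>Fourier series on the unit interval\<close>

lemma fourier_coeff_add:
  assumes "f \<in> L2 unit_lebesgue" "g \<in> L2 unit_lebesgue"
  shows "fourier_coeff (\<lambda>x. f x + g x) k = fourier_coeff f k + fourier_coeff g k"
  unfolding fourier_coeff_def distrib_left
  by (intro Bochner_Integration.integral_add U.L2_integrable U.L2_char assms)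

lemma fourier_coeff_cmult: "fourier_coeff (\<lambda>x. c * f x) k = c * fourier_coeff f k"
  unfolding fourier_coeff_def mult.left_commute[of _ c] by simp

definition fourier_remainder :: "int set \<Rightarrow> (real \<Rightarrow> complex) \<Rightarrow> real \<Rightarrow> complex" where
  "fourier_remainder F f x = f x - (\<Sum>k\<in>F. fourier_coeff f k * U.char k x)"

lemma fourier_remainder_L2: "f \<in> L2 unit_lebesgue \<Longrightarrow> fourier_remainder F f \<in> L2 unit_lebesgue"
  unfolding fourier_remainder_def[abs_def] by (intro L2_diff L2_sum L2_char_unit)

lemma fourier_remainder_le:
  assumes "f \<in> L2 unit_lebesgue" "finite F"
  shows "L2_sq unit_lebesgue (fourier_remainder F f) \<le> L2_sq unit_lebesgue f"
proof -
  have "0 \<le> (\<Sum>k\<in>F. (cmod (fourier_coeff f k))\<^sup>2)" by (rule sum_nonneg) simp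
  then show ?thesis
    using fourier_partial_sum(2)[OF assms] unfolding fourier_remainder_def by linarith
qed

lemma fourier_remainder_add:
  assumes "f \<in> L2 unit_lebesgue" "g \<in> L2 unit_lebesgue"
  shows "fourier_remainder F (\<lambda>x. f x + g x) x = fourier_remainder F f x + fourier_remainder F g x"
  unfolding fourier_remainder_def fourier_coeff_add[OF assms] by (simp add: distrib_right sum.distrib)

lemma fourier_remainder_cmult:
  "fourier_remainder F (\<lambda>x. c * f x) x = c * fourier_remainder F f x"
  unfolding fourier_remainder_def fourier_coeff_cmult by (simp add: right_diff_distrib sum_distrib_left mult.assoc)

definition fourier_summable :: "(real \<Rightarrow> complex) set" where
  "fourier_summable = {f \<in> L2 unit_lebesgue. \<forall>\<epsilon>>0. \<exists>N. \<forall>K\<ge>N. \<forall>L\<ge>N.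
     L2_sq unit_lebesgue (fourier_remainder {- int K..int L} f) < \<epsilon>}"

lemma fourier_summableI:
  assumes "f \<in> L2 unit_lebesgue" "\<And>\<epsilon>. 0 < \<epsilon> \<Longrightarrow> \<exists>N. \<forall>K\<ge>N. \<forall>L\<ge>N.
     L2_sq unit_lebesgue (fourier_remainder {- int K..int L} f) < \<epsilon>"
  shows "f \<in> fourier_summable"
  using assms unfolding fourier_summable_def by blast

lemma fourier_summableD:
  assumes "f \<in> fourier_summable" "0 < \<epsilon>"
  obtains N where "\<And>K L. N \<le> K \<Longrightarrow> N \<le> L \<Longrightarrow> L2_sq unit_lebesgue (fourier_remainder {- int K..int L} f) < \<epsilon>"
  using assms unfolding fourier_summable_def by blast

text \<open>With constant \<open>Y\<close> the generating functions are scaled characters, whose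
  remainders eventually vanish; density gives the rest. Closedness holds because taking remainders
  does not increase the norm.\<close>

lemma L2_subset_fourier_summable:
  assumes f: "f \<in> L2 unit_lebesgue" shows "f \<in> fourier_summable"
proof -
  interpret fibred_subspace unit_lebesgue "\<lambda>x. x" "\<lambda>_. 0" fourier_summable
  proof
    show "x \<in> {0..<1}" if "x \<in> space unit_lebesgue" for x :: real using that by (simp add: space_unit_lebesgue)
  next
    fix A assume A: "A \<in> sets unit_lebesgue"
    then have "A \<in> sets borel" "A \<subseteq> space unit_lebesgue"
      using sets.sets_into_space[OF A] by (auto simp: sets_restrict_space_iff)
    then show "\<exists>B\<in>sets (borel :: (real \<times> real) measure). A = {a \<in> space unit_lebesgue. (a, 0) \<in> B}"
      by (intro bexI[where x="A \<times> UNIV"]) (auto simp: borel_prod[symmetric])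
  next
    show "f \<in> L2 unit_lebesgue" if "f \<in> fourier_summable" for f using that by (simp add: fourier_summable_def)
  next
    fix f g assume fg: "f \<in> fourier_summable" "g \<in> fourier_summable"
    then have L: "f \<in> L2 unit_lebesgue" "g \<in> L2 unit_lebesgue" by (auto simp: fourier_summable_def)
    show "(\<lambda>x. f x + g x) \<in> fourier_summable"
    proof (rule fourier_summableI[OF L2_add[OF L]])
      fix \<epsilon> :: real assume "0 < \<epsilon>"
      then have e: "0 < \<epsilon> / 4" by simp
      obtain N where N: "\<And>K L. N \<le> K \<Longrightarrow> N \<le> L \<Longrightarrow> L2_sq unit_lebesgue (fourier_remainder {- int K..int L} f) < \<epsilon> / 4"
        by (rule fourier_summableD[OF fg(1) e]) blast
      obtain N' where N': "\<And>K L. N' \<le> K \<Longrightarrow> N' \<le> L \<Longrightarrow> L2_sq unit_lebesgue (fourier_remainder {- int K..int L} g) < \<epsilon> / 4"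
        by (rule fourier_summableD[OF fg(2) e]) blast
      have "L2_sq unit_lebesgue (fourier_remainder {- int K..int L} (\<lambda>x. f x + g x)) < \<epsilon>"
        if "max N N' \<le> K" "max N N' \<le> L" for K L
      proof -
        have "L2_sq unit_lebesgue (fourier_remainder {- int K..int L} (\<lambda>x. f x + g x)) \<le>
            2 * L2_sq unit_lebesgue (fourier_remainder {- int K..int L} f) + 2 * L2_sq unit_lebesgue (fourier_remainder {- int K..int L} g)"
          unfolding fourier_remainder_add[OF \<open>f \<in> L2 _\<close> \<open>g \<in> L2 _\<close>]
          by (intro L2_sq_add_le fourier_remainder_L2 \<open>f \<in> L2 _\<close> \<open>g \<in> L2 _\<close>)
        also have "\<dots> < 2 * (\<epsilon> / 4) + 2 * (\<epsilon> / 4)"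
          using N[of K L] N'[of K L] that by linarith
        finally show ?thesis by simp
      qed
      then show "\<exists>N. \<forall>K\<ge>N. \<forall>L\<ge>N. L2_sq unit_lebesgue (fourier_remainder {- int K..int L} (\<lambda>x. f x + g x)) < \<epsilon>"
        by blast
    qed
  next
    fix f r assume fV: "f \<in> fourier_summable"
    then have L: "f \<in> L2 unit_lebesgue" by (auto simp: fourier_summable_def)
    show "(\<lambda>x. r * f x) \<in> fourier_summable"
    proof (rule fourier_summableI[OF L2_cmult[OF L]])
      fix \<epsilon> :: real assume e: "0 < \<epsilon>"
      define \<eta> where "\<eta> = \<epsilon> / ((cmod r)\<^sup>2 + 1)"
      have r1: "0 < (cmod r)\<^sup>2 + 1" by (simp add: add_nonneg_pos)
      have eta: "0 < \<eta>" using e r1 by (simp add: \<eta>_def)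
      obtain N where N: "\<And>K L. N \<le> K \<Longrightarrow> N \<le> L \<Longrightarrow> L2_sq unit_lebesgue (fourier_remainder {- int K..int L} f) < \<eta>"
        by (rule fourier_summableD[OF fV eta]) blast
      have "L2_sq unit_lebesgue (fourier_remainder {- int K..int L} (\<lambda>x. r * f x)) < \<epsilon>"
        if "N \<le> K" "N \<le> L" for K L
      proof -
        have "L2_sq unit_lebesgue (fourier_remainder {- int K..int L} (\<lambda>x. r * f x)) \<le> (cmod r)\<^sup>2 * \<eta>"
          unfolding fourier_remainder_cmult L2_sq_cmult using N[OF that] by (intro mult_left_mono) auto
        also have "\<dots> < ((cmod r)\<^sup>2 + 1) * \<eta>" using eta by (simp add: distrib_right)
        also have "\<dots> = \<epsilon>" using r1 by (simp add: \<eta>_def)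
        finally show ?thesis .
      qed
      then show "\<exists>N. \<forall>K\<ge>N. \<forall>L\<ge>N. L2_sq unit_lebesgue (fourier_remainder {- int K..int L} (\<lambda>x. r * f x)) < \<epsilon>"
        by blast
    qed
  next
    fix f :: "real \<Rightarrow> complex" assume L: "f \<in> L2 unit_lebesgue"
      and approx: "\<And>\<epsilon>. 0 < \<epsilon> \<Longrightarrow> \<exists>g\<in>fourier_summable. L2_sq unit_lebesgue (\<lambda>a. f a - g a) < \<epsilon>"
    show "f \<in> fourier_summable"
    proof (rule fourier_summableI[OF L])
      fix \<epsilon> :: real assume "0 < \<epsilon>"
      then have e: "0 < \<epsilon> / 4" by simp
      obtain g where g: "g \<in> fourier_summable" "L2_sq unit_lebesgue (\<lambda>a. f a - g a) < \<epsilon> / 4"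
        using approx[OF e] by blast
      then have gL: "g \<in> L2 unit_lebesgue" by (auto simp: fourier_summable_def)
      obtain N where N: "\<And>K L. N \<le> K \<Longrightarrow> N \<le> L \<Longrightarrow> L2_sq unit_lebesgue (fourier_remainder {- int K..int L} g) < \<epsilon> / 4"
        by (rule fourier_summableD[OF g(1) e]) blast
      have "L2_sq unit_lebesgue (fourier_remainder {- int K..int L} f) < \<epsilon>" if "N \<le> K" "N \<le> L" for K L
      proof -
        let ?F = "{- int K..int L}"
        have "fourier_remainder ?F f x = fourier_remainder ?F (\<lambda>x. f x - g x) x + fourier_remainder ?F g x" for x
          using fourier_remainder_add[OF L2_diff[OF \<open>f \<in> L2 _\<close> gL] gL, of ?F x] by simp
        then have "L2_sq unit_lebesgue (fourier_remainder ?F f) =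
            L2_sq unit_lebesgue (\<lambda>x. fourier_remainder ?F (\<lambda>x. f x - g x) x + fourier_remainder ?F g x)"
          by presburger
        also have "\<dots> \<le> 2 * L2_sq unit_lebesgue (fourier_remainder ?F (\<lambda>x. f x - g x)) + 2 * L2_sq unit_lebesgue (fourier_remainder ?F g)"
          by (intro L2_sq_add_le fourier_remainder_L2 L2_diff \<open>f \<in> L2 _\<close> gL)
        also have "\<dots> < 2 * (\<epsilon> / 4) + 2 * (\<epsilon> / 4)"
          using N[OF that] g(2) fourier_remainder_le[OF L2_diff[OF \<open>f \<in> L2 _\<close> gL], of ?F] by force
        finally show ?thesis by simp
      qed
      then show "\<exists>N. \<forall>K\<ge>N. \<forall>L\<ge>N. L2_sq unit_lebesgue (fourier_remainder {- int K..int L} f) < \<epsilon>"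
        by blast
    qed
  next
    fix c :: "real \<Rightarrow> complex" and C k
    have co: "fourier_coeff (\<lambda>x. U.char k x * c 0) j = (if j = k then c 0 else 0)" for j
    proof -
      have "fourier_coeff (\<lambda>x. U.char k x * c 0) j = (\<integral>x. c 0 * U.char (k - j) x \<partial>unit_lebesgue)"
        unfolding fourier_coeff_def using U.char_mult[of "-j" _ k]
        by (intro Bochner_Integration.integral_cong) (auto simp: algebra_simps)
      then show ?thesis by (simp only: integral_mult_right_zero integral_char) auto
    qed
    \<comment> \<open>Once the range contains \<open>k\<close>, the partial sum is the function
      itself.\<close>
    have "fourier_remainder {- int K..int L} (\<lambda>x. U.char k x * c 0) x = 0" if "nat \<bar>k\<bar> \<le> K" "nat \<bar>k\<bar> \<le> L" for K L x
    proof -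
      have "(\<Sum>j\<in>{- int K..int L}. fourier_coeff (\<lambda>x. U.char k x * c 0) j * U.char j x) =
          (\<Sum>j\<in>{- int K..int L}. if j = k then U.char k x * c 0 else 0)"
        unfolding co by (intro sum.cong) auto
      also have "\<dots> = U.char k x * c 0" using that by (subst sum.delta) auto
      finally show ?thesis by (simp add: fourier_remainder_def)
    qed
    then have "\<exists>N. \<forall>K\<ge>N. \<forall>L\<ge>N. L2_sq unit_lebesgue (fourier_remainder {- int K..int L} (\<lambda>x. U.char k x * c 0)) < \<epsilon>" if "0 < \<epsilon>" for \<epsilon>
      using that by (intro exI[where x="nat \<bar>k\<bar>"]) simp
    then show "(\<lambda>x. U.char k x * c 0) \<in> fourier_summable"
      using L2_char_unit[of "c 0" k] by (intro fourier_summableI) (simp_all add: mult.commute)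
  qed
  show ?thesis by (rule V_eq_L2[OF f])
qed

text \<open>The lower bound on the density puts \<open>c\<close> into L2 of Lebesgue measure, and
  the upper bound carries convergence back to \<nu>. Both bounds concern only the set where the
  density is positive.\<close>

lemma ess_equiv_fourier:
  assumes \<nu>: "ess_equiv_lebesgue \<nu>" and c: "c \<in> L2 \<nu>"
  obtains a where "((\<lambda>(K, L). L2_sq \<nu> (\<lambda>y. (\<Sum>m\<in>{- int K..int L}. a m * U.char m y) - c y)) \<longlongrightarrow> 0)
    (sequentially \<times>\<^sub>F sequentially)"
proof -
  define h where "h = RN_deriv unit_lebesgue \<nu>"
  have h[measurable]: "h \<in> borel_measurable unit_lebesgue" by (simp add: h_def)
  have sets_eq: "sets \<nu> = sets unit_lebesgue"
    using \<nu> by (simp add: ess_equiv_lebesgue_def sets_restrict_space)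
  have dens: "density unit_lebesgue h = \<nu>"
    unfolding h_def using \<nu> sets_eq by (intro U.density_RN_deriv) (auto simp: ess_equiv_lebesgue_def)
  obtain C1 C2 where "AE x in \<nu>. h x \<le> ennreal C1" "AE x in \<nu>. 1 / h x \<le> ennreal C2"
    using \<nu> by (auto simp: ess_equiv_lebesgue_def ess_bounded_def h_def)
  \<comment> \<open>Almost everywhere for \<nu> means Lebesgue-almost everywhere on the set where
    \<open>h\<close> is positive.\<close>
  then have b: "AE x in unit_lebesgue. 0 < h x \<longrightarrow> h x \<le> ennreal C1" "AE x in unit_lebesgue. 0 < h x \<longrightarrow> 1 / h x \<le> ennreal C2"
    unfolding dens[symmetric] AE_density[OF h] by auto
  \<comment> \<open>One constant for both bounds; the 1 makes it positive, so that
    \<open>\<epsilon> / C\<close> below is a valid tolerance.\<close>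
  define C where "C = max 1 (max C1 C2)"
  have C: "0 \<le> C" "ennreal C1 \<le> ennreal C" "ennreal C2 \<le> ennreal C" by (auto simp: C_def intro!: ennreal_leI)
  have hC: "AE x in unit_lebesgue. h x \<le> ennreal C"
    using b(1)
  proof eventually_elim
    case (elim x)
    then show ?case
      by (cases "h x = 0") (use order_trans[OF _ C(2)] in \<open>simp_all add: zero_less_iff_neq_zero del: ennreal_le_iff\<close>)
  qed
  have hC': "AE x in unit_lebesgue. h x \<noteq> 0 \<longrightarrow> 1 \<le> ennreal C * h x"
    using b(2) hC
  proof eventually_elim
    case (elim x)
    show ?case
    proof
      assume nz: "h x \<noteq> 0"
      \<comment> \<open>Cancelling in \<open>ennreal\<close> requires \<open>h x\<close> to be
        finite as well as nonzero, which \<open>hC\<close> supplies.\<close>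
      have "h x * (1 / h x) = 1"
        using nz elim(2) by (simp add: ennreal_times_divide ennreal_divide_self le_less_trans)
      moreover have "h x * (1 / h x) \<le> h x * ennreal C"
        using elim(1) nz order_trans[OF _ C(3)] by (intro mult_left_mono) (simp_all add: zero_less_iff_neq_zero)
      ultimately show "1 \<le> ennreal C * h x" by (simp add: mult.commute)
    qed
  qed
  have cm[measurable]: "c \<in> borel_measurable unit_lebesgue"
    using L2_measurable[OF c] by (simp cong: measurable_cong_sets add: sets_eq)
  \<comment> \<open>Where \<open>h\<close> vanishes, \<open>c\<close> is invisible to \<nu> but
    arbitrary for Lebesgue measure, so it is cut off there. The coefficients sought are those of
    \<open>c'\<close>.\<close>
  define c' where "c' x = (if h x = 0 then 0 else c x)" for x
  have c'm[measurable]: "c' \<in> borel_measurable unit_lebesgue"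
    unfolding c'_def by measurable
  have nu_int: "(\<integral>\<^sup>+x. ennreal ((cmod (f x))\<^sup>2) \<partial>\<nu>) = (\<integral>\<^sup>+x. h x * ennreal ((cmod (f x))\<^sup>2) \<partial>unit_lebesgue)"
    if [measurable]: "f \<in> borel_measurable unit_lebesgue" for f :: "real \<Rightarrow> complex"
    unfolding dens[symmetric] by (rule nn_integral_density) measurable
  have "(\<integral>\<^sup>+x. ennreal ((cmod (c' x))\<^sup>2) \<partial>unit_lebesgue) \<le> (\<integral>\<^sup>+x. ennreal C * (h x * ennreal ((cmod (c x))\<^sup>2)) \<partial>unit_lebesgue)"
  proof (rule nn_integral_mono_AE)
    show "AE x in unit_lebesgue. ennreal ((cmod (c' x))\<^sup>2) \<le> ennreal C * (h x * ennreal ((cmod (c x))\<^sup>2))"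
      using hC'
    proof eventually_elim
      case (elim x)
      show ?case
      proof (cases "h x = 0")
        case False
        then have "1 * ennreal ((cmod (c x))\<^sup>2) \<le> ennreal C * h x * ennreal ((cmod (c x))\<^sup>2)"
          using elim by (intro mult_right_mono) auto
        then show ?thesis using False by (simp add: c'_def mult.assoc)
      qed (simp add: c'_def)
    qed
  qed
  also have "\<dots> = ennreal C * (\<integral>\<^sup>+x. ennreal ((cmod (c x))\<^sup>2) \<partial>\<nu>)"
    unfolding nu_int[OF cm] by (rule nn_integral_cmult) measurable
  also have "\<dots> < \<infinity>"
    unfolding nn_integral_eq_integral[OF L2_sq_integrable[OF c] AE_I2[OF zero_le_power2]]
    by (simp add: ennreal_mult_less_top)
  finally have c'L: "c' \<in> L2 unit_lebesgue"
    unfolding L2_def by (auto intro!: integrableI_nonneg)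
  have le: "L2_sq \<nu> f \<le> C * L2_sq unit_lebesgue f" if f: "f \<in> L2 unit_lebesgue" for f
  proof -
    note [measurable] = L2_measurable[OF f]
    have fi: "(\<integral>\<^sup>+x. ennreal ((cmod (f x))\<^sup>2) \<partial>unit_lebesgue) = ennreal (L2_sq unit_lebesgue f)"
      by (rule nn_integral_eq_integral[OF L2_sq_integrable[OF f]]) simp
    have f\<nu>[measurable]: "f \<in> borel_measurable \<nu>"
      using L2_measurable[OF f] by (simp cong: measurable_cong_sets add: sets_eq)
    have "(\<integral>\<^sup>+x. ennreal ((cmod (f x))\<^sup>2) \<partial>\<nu>) \<le> (\<integral>\<^sup>+x. ennreal C * ennreal ((cmod (f x))\<^sup>2) \<partial>unit_lebesgue)"
      unfolding nu_int[OF L2_measurable[OF f]]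
      by (rule nn_integral_mono_AE) (use hC in \<open>auto elim!: eventually_mono intro!: mult_right_mono\<close>)
    also have "\<dots> = ennreal C * ennreal (L2_sq unit_lebesgue f)"
      unfolding fi[symmetric] by (rule nn_integral_cmult) measurable
    also have "\<dots> = ennreal (C * L2_sq unit_lebesgue f)" using C by (simp add: ennreal_mult)
    finally have n: "(\<integral>\<^sup>+x. ennreal ((cmod (f x))\<^sup>2) \<partial>\<nu>) \<le> ennreal (C * L2_sq unit_lebesgue f)" .
    have C0: "0 \<le> C * L2_sq unit_lebesgue f" using C by simp
    have "L2_sq \<nu> f = enn2real (\<integral>\<^sup>+x. ennreal ((cmod (f x))\<^sup>2) \<partial>\<nu>)"
      by (rule integral_eq_nn_integral) simp_all
    also have "\<dots> \<le> C * L2_sq unit_lebesgue f"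
      using enn2real_mono[OF n] C0 by simp
    finally show ?thesis .
  qed
  have AE: "AE x in \<nu>. c' x = c x"
    unfolding dens[symmetric] AE_density[OF h] by (rule AE_I2) (simp add: c'_def)
  let ?S = "\<lambda>K L y. \<Sum>m\<in>{- int K..int L}. fourier_coeff c' m * U.char m y"
  have bound: "L2_sq \<nu> (\<lambda>y. ?S K L y - c y) \<le> C * L2_sq unit_lebesgue (fourier_remainder {- int K..int L} c')" for K L
  proof -
    have m: "borel_measurable \<nu> = (borel_measurable unit_lebesgue :: (real \<Rightarrow> complex) set)"
      by (rule measurable_cong_sets[OF sets_eq refl])
    have Sm: "?S K L \<in> borel_measurable \<nu>" unfolding m by measurable
    have cm': "c \<in> borel_measurable \<nu>" "fourier_remainder {- int K..int L} c' \<in> borel_measurable \<nu>"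
      unfolding m using cm L2_measurable[OF fourier_remainder_L2[OF c'L]] by auto
    have "L2_sq \<nu> (\<lambda>y. ?S K L y - c y) = L2_sq \<nu> (fourier_remainder {- int K..int L} c')"
    proof (rule integral_cong_AE)
      show "AE y in \<nu>. (cmod (?S K L y - c y))\<^sup>2 = (cmod (fourier_remainder {- int K..int L} c' y))\<^sup>2"
        using AE by eventually_elim (simp add: fourier_remainder_def norm_minus_commute)
    qed (use Sm cm' in measurable)
    also have "\<dots> \<le> C * L2_sq unit_lebesgue (fourier_remainder {- int K..int L} c')"
      by (rule le[OF fourier_remainder_L2[OF c'L]])
    finally show ?thesis .
  qed
  have "((\<lambda>(K, L). L2_sq \<nu> (\<lambda>y. ?S K L y - c y)) \<longlongrightarrow> 0) (sequentially \<times>\<^sub>F sequentially)"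
  proof (rule order_tendstoI)
    fix \<epsilon> :: real assume e: "0 < \<epsilon>"
    have C1: "0 < C" by (simp add: C_def)
    obtain N where N: "\<And>K L. N \<le> K \<Longrightarrow> N \<le> L \<Longrightarrow> L2_sq unit_lebesgue (fourier_remainder {- int K..int L} c') < \<epsilon> / C"
      by (rule fourier_summableD[OF L2_subset_fourier_summable[OF c'L], of "\<epsilon> / C"]) (use e C1 in auto)
    have "L2_sq \<nu> (\<lambda>y. ?S K L y - c y) < \<epsilon>" if "N \<le> K" "N \<le> L" for K L
      using le_less_trans[OF bound mult_strict_left_mono[OF N[OF that] C1]] C1 by simp
    then show "\<forall>\<^sub>F p in sequentially \<times>\<^sub>F sequentially. (case p of (K, L) \<Rightarrow> L2_sq \<nu> (\<lambda>y. ?S K L y - c y)) < \<epsilon>"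
      unfolding eventually_prod_sequentially by (auto intro!: exI[where x=N])
  next
    fix \<epsilon> :: real assume "\<epsilon> < 0"
    then have "\<epsilon> < L2_sq \<nu> (\<lambda>y. ?S K L y - c y)" for K L
      by (rule less_le_trans) simp
    then show "\<forall>\<^sub>F p in sequentially \<times>\<^sub>F sequentially. \<epsilon> < (case p of (K, L) \<Rightarrow> L2_sq \<nu> (\<lambda>y. ?S K L y - c y))"
      by (intro always_eventually) auto
  qed
  then show thesis by (rule that)
qed

subsection \<open>Singular measures with an absolutely continuous marginal\<close>

context circle_fibration
begin

text \<open>By Fubini almost every horizontal section of a planar null set is null, and the law of
  \<open>Y\<close> does not charge the exceptional heights. So a compact part of the carrier is null
  for Lebesgue measure times \<open>M\<close>, and its shrinking neighbourhoods have product measure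
  tending to 0.\<close>

lemma singular_imp_fibres_singular:
  assumes X_range: "\<And>a. a \<in> space M \<Longrightarrow> X a \<in> {0..<1}"
    and S: "S \<in> sets (borel :: (real \<times> real) measure)" "emeasure lborel S = 0" "AE a in M. (X a, Y a) \<in> S"
    and ac: "\<And>Z. Z \<in> sets borel \<Longrightarrow> emeasure lborel Z = 0 \<Longrightarrow> AE a in M. Y a \<notin> Z"
  shows fibres_singular
  unfolding fibres_singular_def
proof (intro allI impI)
  fix \<epsilon> :: real assume e: "0 < \<epsilon>"
  let ?N = "distr M borel (\<lambda>a. (X a, Y a))"
  have XY[measurable]: "(\<lambda>a. (X a, Y a)) \<in> measurable M borel"
    unfolding borel_prod[symmetric] by measurable
  \<comment> \<open>Keeping the first coordinate in [0,1) makes wrapping onto the circle injective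
    on \<open>K'\<close>.\<close>
  define S' where "S' = S \<inter> {0..<1} \<times> UNIV"
  have S'[measurable]: "S' \<in> sets borel" using S(1) by (simp add: S'_def borel_prod[symmetric])
  have "emeasure ?N S' = emeasure M ((\<lambda>a. (X a, Y a)) -` S' \<inter> space M)"
    by (rule emeasure_distr) measurable
  also have "\<dots> = 1"
  proof (rule emeasure_eq_1_AE)
    show "(\<lambda>a. (X a, Y a)) -` S' \<inter> space M \<in> sets M" by measurable
    show "AE a in M. a \<in> (\<lambda>a. (X a, Y a)) -` S' \<inter> space M"
      using S(3) AE_space by eventually_elim (use X_range in \<open>auto simp: S'_def\<close>)
  qed
  finally have N1: "emeasure ?N S' = 1" .
  interpret N: prob_space ?N by (rule prob_space_distr) measurable
  have eps: "1 - ennreal \<epsilon> = ennreal (1 - \<epsilon>)" using ennreal_minus[of \<epsilon> 1] e by simp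
  \<comment> \<open>Inner regularity of the law of the coordinate pair: a compact part of
    \<open>S'\<close> carries all but \<epsilon>.\<close>
  have "1 - ennreal \<epsilon> < (SUP K \<in> {K. K \<subseteq> S' \<and> compact K}. emeasure ?N K)"
    unfolding inner_regular[of ?N S', OF _ _ S', simplified, symmetric] N1
    using e by (simp add: eps)
  then obtain K' where K': "K' \<subseteq> S'" "compact K'" "1 - ennreal \<epsilon> < emeasure ?N K'"
    unfolding less_SUP_iff by blast
  have K'b[measurable]: "K' \<in> sets borel" by (rule borel_compact[OF K'(2)])
  define K where "K = (\<lambda>a. (X a, Y a)) -` K' \<inter> space M"
  have K[measurable]: "K \<in> sets M" unfolding K_def by measurable
  have "emeasure ?N K' = ennreal (prob K)"
    unfolding K_def emeasure_eq_measure[symmetric] by (rule emeasure_distr) measurable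
  then have "ennreal (1 - \<epsilon>) < ennreal (prob K)" using K'(3) unfolding eps by simp
  then have "1 - \<epsilon> < prob K" using ennreal_leI[of "prob K" "1 - \<epsilon>"] by (meson not_le)
  then have MK: "emeasure M (space M - K) \<le> ennreal \<epsilon>"
    using prob_compl[OF K] by (simp add: emeasure_eq_measure ennreal_leI)
  show "\<exists>K\<in>sets M. \<exists>\<delta>>0. \<exists>W\<in>sets (borel :: (real \<times> real) measure).
     emeasure M (space M - K) \<le> ennreal \<epsilon> \<and>
     (\<integral>\<^sup>+ x. emeasure M {a \<in> space M. (x, Y a) \<in> W} \<partial>unit_lebesgue) \<le> ennreal \<epsilon> \<and>
     (\<forall>a\<in>K. \<forall>x\<in>{0..<1}. cmod (U.char 1 x - char 1 a) < \<delta> \<longrightarrow> (x, Y a) \<in> W)"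
  proof (cases "K' = {}")
    \<comment> \<open>\<open>infdist\<close> to the empty set is 0, so the neighbourhoods of the
      other case would be the whole plane; here \<open>W\<close> is empty.\<close>
    case True
    then have "K = {}" by (simp add: K_def)
    with MK show ?thesis
      by (intro bexI[OF _ K] exI[where x=1] conjI, simp, intro bexI[where x="{}"] conjI) simp_all
  next
    case False
    interpret P: pair_sigma_finite unit_lebesgue M by (rule pair_sigma_finite_unit)
    \<comment> \<open>Wraps the first coordinate onto the circle, so that points near 1 count as
      near 0. The image of the compact \<open>K'\<close> is closed.\<close>
    define \<Psi> :: "real \<times> real \<Rightarrow> complex \<times> real" where "\<Psi> p = (cis (2 * pi * fst p), snd p)" for p
    have \<Psi>: "continuous_on T \<Psi>" for T
      unfolding \<Psi>_def by (intro continuous_intros)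
    have \<Psi>_eq: "\<Psi> (x, y) = (U.char 1 x, y)" for x y by (simp add: \<Psi>_def U.char_def)
    define F where "F = \<Psi> ` K'"
    have F: "closed F" "F \<noteq> {}"
      using compact_imp_closed[OF compact_continuous_image[OF \<Psi> K'(2)]] False by (auto simp: F_def)
    have F_inj: "(x, y) \<in> K'" if x: "x \<in> {0..<1}" and "\<Psi> (x, y) \<in> F" for x y
    proof -
      from that(2) obtain p where p: "p \<in> K'" "\<Psi> (x, y) = \<Psi> p" unfolding F_def by blast
      define x' where "x' = fst p"
      have x': "(x', y) \<in> K'" "cis (2 * pi * x) = cis (2 * pi * x')"
        using p by (simp_all add: x'_def \<Psi>_def)
      have arg: "Arg2pi (cis (2 * pi * u)) = 2 * pi * u" if "u \<in> {0..<1}" for u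
        using that by (intro Arg2pi_unique[of 1]) (auto simp: cis_conv_exp)
      have x'_range: "x' \<in> {0..<1}" using K'(1) x'(1) by (auto simp: S'_def)
      have "2 * pi * x = Arg2pi (cis (2 * pi * x))" by (rule arg[OF x, symmetric])
      also have "\<dots> = 2 * pi * x'" unfolding x'(2) by (rule arg[OF x'_range])
      finally have "x = x'" by simp
      with x'(1) show ?thesis by simp
    qed
    define W where "W n = {p. infdist (\<Psi> p) F < 1 / real (Suc n)}" for n
    have W[measurable]: "W n \<in> sets borel" for n
      unfolding W_def by (intro borel_open open_Collect_less continuous_on_infdist \<Psi> continuous_on_const)
    \<comment> \<open>The horizontal coordinate is decoupled from the point of \<open>M\<close>,
      which contributes only its height.\<close>
    let ?q = "\<lambda>p. (fst p, Y (snd p))"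
    have q[measurable]: "?q \<in> measurable (unit_lebesgue \<Otimes>\<^sub>M M) borel"
      unfolding borel_prod[symmetric]
      by (intro measurable_Pair measurable_compose[OF measurable_fst U.X] measurable_compose[OF measurable_snd Y])
    define A where "A n = ?q -` W n \<inter> space (unit_lebesgue \<Otimes>\<^sub>M M)" for n
    have A: "A n \<in> sets (unit_lebesgue \<Otimes>\<^sub>M M)" for n
      unfolding A_def by measurable
    have "infdist (\<Psi> p) F = 0" if "\<And>n. p \<in> W n" for p
    proof (rule ccontr)
      assume "infdist (\<Psi> p) F \<noteq> 0"
      then have "0 < infdist (\<Psi> p) F" using infdist_nonneg[of "\<Psi> p" F] by linarith
      then obtain n where "1 / real (Suc n) < infdist (\<Psi> p) F" using nat_approx_posE by blast
      with that[of n] show False by (simp add: W_def)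
    qed
    then have W_Int: "\<Psi> p \<in> F" if "\<And>n. p \<in> W n" for p
      using that F in_closed_iff_infdist_zero by blast
    have Int: "(\<Inter>n. A n) \<subseteq> ?q -` K' \<inter> space (unit_lebesgue \<Otimes>\<^sub>M M)"
    proof
      fix p assume p: "p \<in> (\<Inter>n. A n)"
      then have "\<Psi> (?q p) \<in> F" by (intro W_Int) (auto simp: A_def)
      moreover have "p \<in> space (unit_lebesgue \<Otimes>\<^sub>M M)" using p by (auto simp: A_def)
      moreover from this have "fst p \<in> {0..<1}" by (auto simp: space_pair_measure space_unit_lebesgue)
      ultimately show "p \<in> ?q -` K' \<inter> space (unit_lebesgue \<Otimes>\<^sub>M M)" using F_inj by auto
    qed
    let ?E = "?q -` K' \<inter> space (unit_lebesgue \<Otimes>\<^sub>M M)"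
    have E: "?E \<in> sets (unit_lebesgue \<Otimes>\<^sub>M M)" by measurable
    have E0: "emeasure (unit_lebesgue \<Otimes>\<^sub>M M) ?E = 0"
    proof -
      let ?u = "\<lambda>y. emeasure lborel ((\<lambda>x. (x, y)) -` K')"
      have K'p: "K' \<in> sets (lborel \<Otimes>\<^sub>M lborel)" unfolding lborel_prod using K'b by simp
      have um[measurable]: "?u \<in> borel_measurable lborel"
        by (rule lborel_pair.measurable_emeasure_Pair2[OF K'p])
      have "emeasure lborel K' \<le> emeasure lborel S"
        using K'(1) S(1) by (intro emeasure_mono) (auto simp: S'_def)
      then have "emeasure (lborel \<Otimes>\<^sub>M lborel) K' = 0" unfolding lborel_prod using S(2) by simp
      then have "(\<integral>\<^sup>+y. ?u y \<partial>lborel) = 0"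
        using lborel_pair.emeasure_pair_measure_alt2[OF K'p] by simp
      then have "emeasure lborel {y \<in> space lborel. ?u y \<noteq> 0} = 0"
        using nn_integral_0_iff[OF um] by simp
      moreover have "{y \<in> space lborel. ?u y \<noteq> 0} \<in> sets borel"
        using um by measurable
      \<comment> \<open>Heights whose section of \<open>K'\<close> has positive length form a
        Lebesgue null set, and \<open>ac\<close> applies to it.\<close>
      ultimately have AE: "AE a in M. Y a \<notin> {y \<in> space lborel. ?u y \<noteq> 0}" by (intro ac)
      have "emeasure (unit_lebesgue \<Otimes>\<^sub>M M) ?E = (\<integral>\<^sup>+a. emeasure unit_lebesgue ((\<lambda>x. (x, a)) -` ?E) \<partial>M)"
        by (rule P.emeasure_pair_measure_alt2[OF E])
      also have "\<dots> = (\<integral>\<^sup>+a. 0 \<partial>M)"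
      proof (rule nn_integral_cong_AE)
        show "AE a in M. emeasure unit_lebesgue ((\<lambda>x. (x, a)) -` ?E) = 0"
          using AE AE_space
        proof eventually_elim
          case (elim a)
          have "(\<lambda>x. (x, a)) -` ?E \<in> sets unit_lebesgue" using E by (rule sets_Pair2)
          then have "emeasure unit_lebesgue ((\<lambda>x. (x, a)) -` ?E) = emeasure lborel ((\<lambda>x. (x, a)) -` ?E)"
            by (intro emeasure_restrict_space) (auto simp: space_pair_measure space_restrict_space)
          also have "\<dots> \<le> ?u (Y a)"
          proof (rule emeasure_mono)
            show "(\<lambda>x. (x, Y a)) -` K' \<in> sets lborel" by (rule sets_Pair2[OF K'p])
          qed auto
          also have "\<dots> = 0" using elim by simp
          finally show ?case by simp
        qed
      qed
      finally show ?thesis by simp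
    qed
    have fin: "finite_measure (unit_lebesgue \<Otimes>\<^sub>M M)"
      by (intro finite_measure_pair_measure U.finite_measure_axioms finite_measure_axioms)
    \<comment> \<open>Continuity from above for a finite measure: the sets \<open>A n\<close>
      decrease to a subset of the null set \<open>?E\<close>.\<close>
    have "(\<lambda>n. emeasure (unit_lebesgue \<Otimes>\<^sub>M M) (A n)) \<longlonglongrightarrow> emeasure (unit_lebesgue \<Otimes>\<^sub>M M) (\<Inter>n. A n)"
    proof (rule Lim_emeasure_decseq)
      have "1 / real (Suc (Suc n)) \<le> 1 / real (Suc n)" for n by (simp add: field_simps)
      then have "W (Suc n) \<subseteq> W n" for n unfolding W_def by (auto intro: less_le_trans)
      then show "decseq A" unfolding A_def by (intro decseq_SucI) blast
    qed (use A fin in \<open>auto simp: finite_measure.emeasure_finite\<close>)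
    also have "emeasure (unit_lebesgue \<Otimes>\<^sub>M M) (\<Inter>n. A n) = 0"
      using emeasure_mono[OF Int E] E0 by simp
    finally have "\<forall>\<^sub>F n in sequentially. emeasure (unit_lebesgue \<Otimes>\<^sub>M M) (A n) < ennreal \<epsilon>"
      by (rule order_tendstoD(2)) (use e in simp)
    then obtain n where n: "emeasure (unit_lebesgue \<Otimes>\<^sub>M M) (A n) < ennreal \<epsilon>"
      by (meson eventually_happens sequentially_bot)
    have "(\<integral>\<^sup>+ x. emeasure M {a \<in> space M. (x, Y a) \<in> W n} \<partial>unit_lebesgue) = (\<integral>\<^sup>+ x. emeasure M (Pair x -` A n) \<partial>unit_lebesgue)"
    proof (rule nn_integral_cong)
      fix x assume "x \<in> space unit_lebesgue"
      then have "{a \<in> space M. (x, Y a) \<in> W n} = Pair x -` A n"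
        by (auto simp: A_def space_pair_measure)
      then show "emeasure M {a \<in> space M. (x, Y a) \<in> W n} = emeasure M (Pair x -` A n)" by simp
    qed
    also have "\<dots> = emeasure (unit_lebesgue \<Otimes>\<^sub>M M) (A n)"
      by (rule emeasure_pair_measure_alt[OF A, symmetric])
    finally have MW: "(\<integral>\<^sup>+ x. emeasure M {a \<in> space M. (x, Y a) \<in> W n} \<partial>unit_lebesgue) \<le> ennreal \<epsilon>"
      using n by simp
    have KW: "(x, Y a) \<in> W n" if "a \<in> K" and "cmod (U.char 1 x - char 1 a) < 1 / real (Suc n)" for a x
    proof -
      have "\<Psi> (X a, Y a) \<in> F" using that(1) by (auto simp: K_def F_def)
      then have "infdist (\<Psi> (x, Y a)) F \<le> dist (\<Psi> (x, Y a)) (\<Psi> (X a, Y a))" by (rule infdist_le)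
      also have "\<dots> = cmod (U.char 1 x - char 1 a)"
        by (simp add: \<Psi>_def dist_Pair_Pair U.char_def char_def dist_norm)
      finally show ?thesis using that(2) by (simp add: W_def)
    qed
    show ?thesis
    proof (rule bexI[OF _ K], rule exI[where x="1 / real (Suc n)"], rule conjI, simp, rule bexI[OF _ W[of n]], intro conjI ballI impI)
    qed (use MK MW KW in blast)+
  qed
qed

end

section \<open>Assembling the iterated double series\<close>

lemma char_borel_measurable[measurable]: "U.char m \<in> borel_measurable borel"
  unfolding U.char_def[abs_def] by (intro borel_measurable_continuous_onI continuous_intros)

context circle_fibration
begin

lemma exp_eq_char:
  "exp (2 * of_real pi * \<i> * of_real (real n * X a + real_of_int m * Y a)) = char (int n) a * U.char m (Y a)"
proof -
  have "2 * of_real pi * \<i> * of_real (real n * X a + real_of_int m * Y a) =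
      \<i> * of_real (2 * pi * real_of_int (int n) * X a) + \<i> * of_real (2 * pi * real_of_int m * Y a)"
    by (simp add: algebra_simps)
  then show ?thesis unfolding char_def U.char_def cis_conv_exp by (simp only: exp_add)
qed

text \<open>The outer sum is the Kaczmarz expansion in \<open>X\<close>, and each coefficient is
  expanded in the law of \<open>Y\<close>. Both halves of the theorem are instances with the
  coordinates in one order or the other.\<close>

lemma iterated_fourier_series:
  assumes X_range: "\<And>a. a \<in> space M \<Longrightarrow> X a \<in> {0..<1}" and Y_range: "\<And>a. a \<in> space M \<Longrightarrow> Y a \<in> {0..<1}"
    and generated: "\<And>A. A \<in> sets M \<Longrightarrow> \<exists>B\<in>sets (borel :: (real \<times> real) measure). A = {a \<in> space M. (X a, Y a) \<in> B}"
    and S: "S \<in> sets (borel :: (real \<times> real) measure)" "emeasure lborel S = 0" "AE a in M. (X a, Y a) \<in> S"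
    and ess: "ess_equiv_lebesgue (distr M (restrict_space borel {0..<1}) Y)"
    and f: "f \<in> L2 M"
  shows "\<exists>d. L2_iterated_sums M (\<lambda>n m a. d n m * exp (2 * of_real pi * \<i> * of_real (real n * X a + real_of_int m * Y a))) f"
proof -
  let ?\<nu> = "distr M (restrict_space borel {0..<1}) Y"
  have Ym[measurable]: "Y \<in> measurable M (restrict_space borel {0..<1})"
    by (rule measurable_restrict_space2) (use Y_range in auto)
  have sing: fibres_singular
  proof (rule singular_imp_fibres_singular[OF X_range S])
    fix Z :: "real set" assume Z: "Z \<in> sets borel" "emeasure lborel Z = 0"
    have Zi: "Z \<inter> {0..<1} \<in> sets (restrict_space borel {0..<1})"
      using Z(1) by (auto simp: sets_restrict_space)
    have "emeasure unit_lebesgue (Z \<inter> {0..<1}) = emeasure lborel (Z \<inter> {0..<1})"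
      by (rule emeasure_restrict_space) auto
    also have "\<dots> = 0"
      using emeasure_mono[of "Z \<inter> {0..<1}" Z lborel] Z by simp
    finally have "Z \<inter> {0..<1} \<in> null_sets unit_lebesgue"
      using Zi by (auto simp: null_sets_def sets_restrict_space)
    then have "Z \<inter> {0..<1} \<in> null_sets ?\<nu>"
      using ess by (auto simp: ess_equiv_lebesgue_def absolutely_continuous_def)
    then have "emeasure M (Y -` (Z \<inter> {0..<1}) \<inter> space M) = 0"
      using emeasure_distr[OF Ym Zi] by auto
    moreover have "Y -` (Z \<inter> {0..<1}) \<inter> space M \<in> sets M" using Ym Zi by (rule measurable_sets)
    ultimately have "AE a in M. a \<notin> Y -` (Z \<inter> {0..<1}) \<inter> space M"
      by (intro AE_not_in) (auto simp: null_sets_def)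
    then show "AE a in M. Y a \<notin> Z"
      using AE_space by eventually_elim (use Y_range in auto)
  qed
  obtain b where b[measurable]: "\<And>n. b n \<in> borel_measurable borel" and bL: "\<And>n. (\<lambda>a. b n (Y a)) \<in> L2 M"
    and lim: "(\<lambda>n. L2_sq M (\<lambda>a. (\<Sum>k<n. char (int k + 1) a * b k (Y a)) - f a)) \<longlonglongrightarrow> 0"
    by (rule kaczmarz_expansion[OF sing X_range generated f]) blast+
  have borel_nu: "c \<in> borel_measurable ?\<nu>" if "c \<in> borel_measurable borel" for c :: "real \<Rightarrow> complex"
    using measurable_restrict_space1[OF that, of "{0..<1}"] by simp
  have L2_sq_nu: "L2_sq M (\<lambda>a. c (Y a)) = L2_sq ?\<nu> c" if c: "c \<in> borel_measurable borel" for c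
    using borel_nu[OF c] by (intro integral_distr[OF Ym, symmetric]) simp
  have bnu: "b n \<in> L2 ?\<nu>" for n
    using bL[of n] borel_nu[OF b] integrable_distr_eq[OF Ym, of "\<lambda>y. (cmod (b n y))\<^sup>2"]
    by (auto simp: L2_def)
  have "\<exists>a. ((\<lambda>(K, L). L2_sq ?\<nu> (\<lambda>y. (\<Sum>m\<in>{- int K..int L}. a m * U.char m y) - b n y)) \<longlongrightarrow> 0)
      (sequentially \<times>\<^sub>F sequentially)" for n
    by (rule ess_equiv_fourier[OF ess bnu[of n]]) blast
  then have "\<exists>e. \<forall>n. ((\<lambda>(K, L). L2_sq ?\<nu> (\<lambda>y. (\<Sum>m\<in>{- int K..int L}. e n m * U.char m y) - b n y)) \<longlongrightarrow> 0)
      (sequentially \<times>\<^sub>F sequentially)"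
    by (intro choice allI)
  then obtain e where e: "\<And>n. ((\<lambda>(K, L). L2_sq ?\<nu> (\<lambda>y. (\<Sum>m\<in>{- int K..int L}. e n m * U.char m y) - b n y)) \<longlongrightarrow> 0)
      (sequentially \<times>\<^sub>F sequentially)"
    by (elim exE) (rule that, erule spec)
  \<comment> \<open>The Kaczmarz expansion starts with the frequency \<open>1\<close>, so the coefficients of frequency \<open>0\<close> vanish.\<close>
  define d where "d n m = (case n of 0 \<Rightarrow> 0 | Suc k \<Rightarrow> e k m)" for n m
  define g where "g n a = (case n of 0 \<Rightarrow> 0 | Suc k \<Rightarrow> char (int k + 1) a * b k (Y a))" for n a
  let ?u = "\<lambda>n m a. d n m * exp (2 * of_real pi * \<i> * of_real (real n * X a + real_of_int m * Y a))"
  have u: "?u n m = (\<lambda>a. d n m * (char (int n) a * U.char m (Y a)))" for n m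
    unfolding exp_eq_char ..
  have cY: "(\<lambda>a. U.char m (Y a)) \<in> L2 M" for m
    by (rule L2_fibre_bounded[where C=1]) auto
  have uL: "(\<lambda>a. \<Sum>m\<in>I. ?u n m a) \<in> L2 M" for n and I :: "int set"
    unfolding exp_eq_char by (intro L2_sum L2_cmult L2_char cY)
  have gL: "g n \<in> L2 M" for n
  proof (cases n)
    case 0
    then show ?thesis by (simp add: g_def[abs_def] L2_def)
  next
    case (Suc k)
    then show ?thesis using L2_char[OF bL[of k]] by (simp add: g_def[abs_def])
  qed
  have inner: "L2_bisums M (?u n) (g n)" for n
    unfolding L2_bisums_def L2_tendsto_def
  proof (intro conjI allI gL)
    show "(case i of (K, L) \<Rightarrow> \<lambda>a. \<Sum>m\<in>{- int K..int L}. ?u n m a) \<in> L2 M" for i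
      by (cases i) (simp only: prod.case uL)
    have "((\<lambda>(K, L). L2_sq M (\<lambda>a. (\<Sum>m\<in>{- int K..int L}. ?u n m a) - g n a)) \<longlongrightarrow> 0) (sequentially \<times>\<^sub>F sequentially)"
    proof (cases n)
      case 0
      then show ?thesis by (simp add: d_def g_def case_prod_unfold)
    next
      case (Suc k)
      \<comment> \<open>The outer character has modulus 1 and drops out; what is left depends on
        \<open>Y\<close> alone and is integrated against its law.\<close>
      have "L2_sq M (\<lambda>a. (\<Sum>m\<in>{- int K..int L}. ?u n m a) - g n a) =
          L2_sq ?\<nu> (\<lambda>y. (\<Sum>m\<in>{- int K..int L}. e k m * U.char m y) - b k y)" for K L
      proof -
        have "(\<Sum>m\<in>{- int K..int L}. ?u n m a) - g n a =
            char (int k + 1) a * ((\<Sum>m\<in>{- int K..int L}. e k m * U.char m (Y a)) - b k (Y a))" for a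
          unfolding exp_eq_char Suc d_def g_def
          by (simp add: right_diff_distrib sum_distrib_left mult_ac add.commute)
        then have "L2_sq M (\<lambda>a. (\<Sum>m\<in>{- int K..int L}. ?u n m a) - g n a) =
            L2_sq M (\<lambda>a. char (int k + 1) a * ((\<Sum>m\<in>{- int K..int L}. e k m * U.char m (Y a)) - b k (Y a)))"
          by presburger
        also have "\<dots> = L2_sq M (\<lambda>a. (\<Sum>m\<in>{- int K..int L}. e k m * U.char m (Y a)) - b k (Y a))"
          by (rule L2_sq_char)
        also have "\<dots> = L2_sq ?\<nu> (\<lambda>y. (\<Sum>m\<in>{- int K..int L}. e k m * U.char m y) - b k y)"
          by (rule L2_sq_nu) measurable
        finally show ?thesis .
      qed
      then show ?thesis using e[of k] by presburger
    qed
    then have "((\<lambda>p. sqrt (case p of (K, L) \<Rightarrow> L2_sq M (\<lambda>a. (\<Sum>m\<in>{- int K..int L}. ?u n m a) - g n a))) \<longlongrightarrow> sqrt 0) (sequentially \<times>\<^sub>F sequentially)"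
      by (rule tendsto_real_sqrt)
    then show "((\<lambda>i. L2_norm M (\<lambda>a. (case i of (K, L) \<Rightarrow> \<lambda>a. \<Sum>m\<in>{- int K..int L}. ?u n m a) a - g n a)) \<longlongrightarrow> 0) (sequentially \<times>\<^sub>F sequentially)"
      by (simp add: L2_norm_def case_prod_unfold)
  qed
  have outer: "L2_sums M g f"
    unfolding L2_sums_def L2_tendsto_def
  proof (intro conjI allI f)
    show "(\<lambda>a. \<Sum>n<N. g n a) \<in> L2 M" for N by (intro L2_sum gL)
    \<comment> \<open>\<open>g 0\<close> vanishes, so \<open>Suc N\<close> outer terms amount to
      \<open>N\<close> Kaczmarz steps.\<close>
    have "(\<Sum>n<Suc N. g n a) = (\<Sum>k<N. char (int k + 1) a * b k (Y a))" for N a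
      unfolding sum.lessThan_Suc_shift by (simp add: g_def)
    then have "(\<lambda>N. L2_sq M (\<lambda>a. (\<Sum>n<Suc N. g n a) - f a)) \<longlonglongrightarrow> 0" using lim by presburger
    then have "(\<lambda>N. L2_sq M (\<lambda>a. (\<Sum>n<N. g n a) - f a)) \<longlonglongrightarrow> 0"
      by (rule filterlim_sequentially_Suc[THEN iffD1])
    then have "(\<lambda>N. sqrt (L2_sq M (\<lambda>a. (\<Sum>n<N. g n a) - f a))) \<longlonglongrightarrow> sqrt 0"
      by (rule tendsto_real_sqrt)
    then show "(\<lambda>N. L2_norm M (\<lambda>a. (\<Sum>n<N. g n a) - f a)) \<longlonglongrightarrow> 0"
      by (simp add: L2_norm_def)
  qed
  show ?thesis unfolding L2_iterated_sums_def using inner outer by blast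
qed

end

text \<open>For the x-marginal the coordinates are exchanged, and the Lebesgue null carrier has to
  be reflected with them.\<close>

lemma emeasure_lborel_swap:
  assumes S: "S \<in> sets (borel :: (real \<times> real) measure)" "emeasure lborel S = 0"
  shows "prod.swap -` S \<in> sets borel" "emeasure lborel (prod.swap -` S) = 0"
proof -
  have sw: "prod.swap = (\<lambda>(x :: real, y :: real). (y, x))" by (auto simp: fun_eq_iff)
  have m: "(\<lambda>(x :: real, y :: real). (y, x)) \<in> measurable (lborel \<Otimes>\<^sub>M lborel) (lborel \<Otimes>\<^sub>M lborel)"
    by (rule measurable_pair_swap')
  have Sp: "S \<in> sets (lborel \<Otimes>\<^sub>M lborel)" unfolding lborel_prod using S by simp
  have sp: "space (lborel \<Otimes>\<^sub>M lborel :: (real \<times> real) measure) = UNIV" by (simp add: space_pair_measure)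
  have "prod.swap -` S \<in> sets (lborel \<Otimes>\<^sub>M lborel)"
    using measurable_sets[OF m Sp] unfolding sp sw by simp
  then show "prod.swap -` S \<in> sets borel" unfolding lborel_prod by simp
  have "emeasure (lborel \<Otimes>\<^sub>M lborel) S = emeasure (lborel \<Otimes>\<^sub>M lborel) (prod.swap -` S)"
    by (subst (1) lborel_pair.distr_pair_swap) (simp only: emeasure_distr[OF m Sp] sp sw Int_UNIV_right)
  then show "emeasure lborel (prod.swap -` S) = 0" unfolding lborel_prod using S(2) by simp
qed

theorem theorem5:
  fixes \<mu> :: "(real \<times> real) measure"
  assumes "prob_space \<mu>"
    and "sets \<mu> = sets (restrict_space borel unit_square)"
    and "mutually_singular \<mu> square_lebesgue"
    and "ess_equiv_lebesgue (marginal_x \<mu>) \<or> ess_equiv_lebesgue (marginal_y \<mu>)"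
  shows "(ess_equiv_lebesgue (marginal_y \<mu>) \<longrightarrow>
            (\<forall>f\<in>L2 \<mu>. \<exists>d :: nat \<Rightarrow> int \<Rightarrow> complex.
               L2_iterated_sums \<mu>
                 (\<lambda>n m (x, y). d n m * exp (2 * of_real pi * \<i> * of_real (real n * x + real_of_int m * y))) f)) \<and>
         (ess_equiv_lebesgue (marginal_x \<mu>) \<longrightarrow>
            (\<forall>f\<in>L2 \<mu>. \<exists>d :: nat \<Rightarrow> int \<Rightarrow> complex.
               L2_iterated_sums \<mu>
                 (\<lambda>n m (x, y). d n m * exp (2 * of_real pi * \<i> * of_real (real n * y + real_of_int m * x))) f))"
proof -
  interpret prob_space \<mu> by fact
  note sets_eq = assms(2)
  have space_eq: "space \<mu> = unit_square"
    using sets_eq_imp_space_eq[OF sets_eq] by (simp add: space_restrict_space)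
  have square: "unit_square \<in> sets borel" by (simp add: borel_prod[symmetric])
  have sub: "A \<in> sets borel" "A \<subseteq> unit_square" if "A \<in> sets \<mu>" for A
    using that square unfolding sets_eq by (auto simp: sets_restrict_space_iff)
  have m: "g \<in> borel_measurable \<mu>" if "g \<in> borel_measurable borel" for g :: "real \<times> real \<Rightarrow> real"
    unfolding measurable_cong_sets[OF sets_eq refl] by (rule measurable_restrict_space1[OF that])
  have fm: "fst \<in> borel_measurable \<mu>" "snd \<in> borel_measurable \<mu>"
    by (intro m; simp add: borel_prod[symmetric])+
  obtain A where A: "A \<in> sets \<mu>" "emeasure \<mu> A = 0" "emeasure square_lebesgue (space square_lebesgue - A) = 0"
    using assms(3) by (auto simp: mutually_singular_def)
  \<comment> \<open>Singularity gives a \<mu>-null set \<open>A\<close> carrying the Lebesgue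
    measure of the square; its complement is Lebesgue null and carries \<mu>.\<close>
  define S where "S = unit_square - A"
  have S: "S \<in> sets borel" using sub[OF A(1)] square by (simp add: S_def)
  have S0: "emeasure lborel S = 0"
  proof -
    have "emeasure square_lebesgue S = emeasure lborel S"
      using square by (intro emeasure_restrict_space) (auto simp: S_def)
    then show ?thesis using A(3) by (simp add: S_def space_restrict_space)
  qed
  have SAE: "AE p in \<mu>. p \<in> S"
    using AE_not_in[of A \<mu>] A(1,2) AE_space[of \<mu>] by (auto simp: null_sets_def S_def space_eq)
  note swap = emeasure_lborel_swap[OF S S0]
  show ?thesis
  proof (intro conjI impI ballI)
    fix f assume ess: "ess_equiv_lebesgue (marginal_y \<mu>)" and f: "f \<in> L2 \<mu>"
    interpret circle_fibration \<mu> fst snd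
      by unfold_locales (use fm in auto)
    have "\<exists>d. L2_iterated_sums \<mu> (\<lambda>n m p. d n m * exp (2 * of_real pi * \<i> * of_real (real n * fst p + real_of_int m * snd p))) f"
    proof (rule iterated_fourier_series[OF _ _ _ S S0 _ ess[unfolded marginal_y_def] f])
      show "\<exists>B\<in>sets (borel :: (real \<times> real) measure). C = {a \<in> space \<mu>. (fst a, snd a) \<in> B}" if "C \<in> sets \<mu>" for C
        using sub[OF that] by (intro bexI[where x=C]) (auto simp: space_eq)
    qed (use SAE in \<open>auto simp: space_eq\<close>)
    then show "\<exists>d. L2_iterated_sums \<mu>
        (\<lambda>n m (x, y). d n m * exp (2 * of_real pi * \<i> * of_real (real n * x + real_of_int m * y))) f"
      by (simp only: case_prod_unfold)
  next
    fix f assume ess: "ess_equiv_lebesgue (marginal_x \<mu>)" and f: "f \<in> L2 \<mu>"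
    \<comment> \<open>Now y is the Kaczmarz variable and x the fibre variable; the carrier is the
      reflected set from \<open>swap\<close>.\<close>
    interpret circle_fibration \<mu> snd fst
      by unfold_locales (use fm in auto)
    have "\<exists>d. L2_iterated_sums \<mu> (\<lambda>n m p. d n m * exp (2 * of_real pi * \<i> * of_real (real n * snd p + real_of_int m * fst p))) f"
    proof (rule iterated_fourier_series[OF _ _ _ swap _ ess[unfolded marginal_x_def] f])
      show "\<exists>B\<in>sets (borel :: (real \<times> real) measure). C = {a \<in> space \<mu>. (snd a, fst a) \<in> B}" if "C \<in> sets \<mu>" for C
      proof (rule bexI)
        have "(\<lambda>p. (snd p, fst p)) \<in> measurable (borel :: (real \<times> real) measure) (borel :: (real \<times> real) measure)"
          unfolding borel_prod[symmetric] by measurable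
        from measurable_sets[OF this sub(1)[OF that]] show "{p. (snd p, fst p) \<in> C} \<in> sets borel"
          by (simp add: vimage_def)
      qed (use sub(2)[OF that] in \<open>auto simp: space_eq\<close>)
    qed (use SAE in \<open>auto simp: space_eq\<close>)
    then show "\<exists>d. L2_iterated_sums \<mu>
        (\<lambda>n m (x, y). d n m * exp (2 * of_real pi * \<i> * of_real (real n * y + real_of_int m * x))) f"
      by (simp only: case_prod_unfold)
  qed
qed

end
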